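(* Let $A$ be a regular weak multiplier Hopf algebra. If $A$ has a faithful left cointegral $h\in A$, then $A$ is Frobenius.
   Context: All algebras are over $\mathbb{C}$, associative, possibly non-unital, with non-degenerate product. $A$ is idempotent if $A^2=A$; $M(A)$ is the multiplier algebra (identity $1$); $A'$ is the space of all linear functionals on $A$. A coproduct is a homomorphism $\Delta:A\to M(A\otimes A)$ with $\Delta(a)(1\otimes b),(a\otimes 1)\Delta(b)\in A\otimes A$, coassociative: $(a\otimes1\otimes1)(\Delta\otimes id)(\Delta(b)(1\otimes c))=(id\otimes\Delta)((a\otimes1)\Delta(b))(1\otimes1\otimes c)$. Put $T_1(a\otimes b)=\Delta(a)(1\otimes b)$, $T_2(a\otimes b)=(a\otimes1)\Delta(b)$. $\Delta$ is full if the smallest subspaces $V,W\subset A$ with $\Delta(A)(1\otimes A)\subset V\otimes A$ and $(A\otimes1)\Delta(A)\subset A\otimes W$ both equal $A$. A counit is a linear functional $\varepsilon$ with $(\varepsilon\otimes id)(\Delta(a)(1\otimes b))=ab$, $(id\otimes\varepsilon)((c\otimes1)\Delta(a))=ca$. A weak multiplier Hopf algebra is a non-degenerate idempotent algebra $A$ with a full coproduct $\Delta$ and a counit such that: (i) there is an idempotent $E\in M(A\otimes A)$ with $T_1(A\otimes A)=E(A\otimes A)$, $T_2(A\otimes A)=(A\otimes A)E$; (ii) $(id\otimes\Delta)E=(E\otimes1)(1\otimes E)=(1\otimes E)(E\otimes1)$; (iii) $\mathrm{Ker}(T_i)=(1-G_i)(A\otimes A)$, $i=1,2$, where $G_1,G_2$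 are the linear maps on $A\otimes A$ given by $(G_1\otimes id)(\Delta_{13}(a)(1\otimes b\otimes c))=\Delta_{13}(a)(1\otimes E)(1\otimes b\otimes c)$ and $(id\otimes G_2)((a\otimes b\otimes1)\Delta_{13}(c))=(a\otimes b\otimes1)(E\otimes1)\Delta_{13}(c)$. Here $\Delta$ (and likewise $id\otimes\Delta$) is uniquely extended to multipliers, with $\Delta(1)=E$. With Sweedler notation $\Delta(a)=\sum a_{(1)}\otimes a_{(2)}$, the antipode $S$ is the non-degenerate anti-homomorphism $A\to M(A)$ with $E(a\otimes b)=\sum a_{(1)}\otimes a_{(2)}S(a_{(3)})b$, $(a\otimes b)E=\sum aS(b_{(1)})b_{(2)}\otimes b_{(3)}$, $G_1(a\otimes b)=\sum a_{(1)}\otimes S(a_{(2)})a_{(3)}b$, $G_2(a\otimes b)=\sum ab_{(1)}S(b_{(2)})\otimes b_{(3)}$, $\sum S(a_{(1)})a_{(2)}S(a_{(3)})=S(a)$; it extends to $M(A)$. $A$ is regular if $S$ is bijective from $A$ to $A$; then also $\Delta(a)(b\otimes1),(1\otimes a)\Delta(b)\in A\otimes A$. Put $\varepsilon_t(a)=\sum a_{(1)}S(a_{(2)})$. For $f\in A'$, $(id\otimes f)\Delta(a)$ and $(f\otimes id)\Delta(a)$ are the elements of $M(A)$ defined by slicing after multiplying, on either side, by $b\otimes1$, resp. $1\otimes b$, $b\in A$. A left cointegral is a non-zero $h\in M(A)$ with $ah=\varepsilon_t(a)h$ for all $a\in A$. It is faithful if for $f\in A'$, $(id\otimes f)\Delta(h)=0$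 or $(f\otimes id)\Delta(h)=0$ implies $f=0$. $A'$ is a left $A$-module via $a\omega=\omega(\cdot\,a)$, i.e. $(a\omega)(b)=\omega(ba)$, and $AA'=\widetilde A=\{\omega(\cdot\,a):a\in A,\omega\in A'\}$. An algebra $A$ (possibly infinite-dimensional, possibly without identity) is called Frobenius if there is a left $A$-module isomorphism from $A$ to $AA'$. *)

theory Defs
  imports Complex_Main "HOL-Library.Poly_Mapping"
begin

section \<open>Complex vector spaces and (possibly non-unital) algebras\<close>

class complex_vector = ab_group_add +
  fixes scaleC :: "complex \<Rightarrow> 'a \<Rightarrow> 'a"  (infixr "*\<^sub>C" 75)
  assumes scaleC_add_right: "c *\<^sub>C (x + y) = c *\<^sub>C x + c *\<^sub>C y"
    and scaleC_add_left: "(c + d) *\<^sub>C x = c *\<^sub>C x + d *\<^sub>C x"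
    and scaleC_scaleC: "c *\<^sub>C d *\<^sub>C x = (c * d) *\<^sub>C x"
    and scaleC_one: "1 *\<^sub>C x = x"

text \<open>The class \<^class>\<open>ring\<close> requires associativity but no identity.\<close>

class complex_algebra = complex_vector + ring +
  assumes mult_scaleC_left: "c *\<^sub>C x * y = c *\<^sub>C (x * y)"
    and mult_scaleC_right: "x * c *\<^sub>C y = c *\<^sub>C (x * y)"

instantiation complex :: complex_algebra
begin
definition scaleC_complex_def [simp]: "c *\<^sub>C (x::complex) = c * x"
instance by standard (simp_all add: algebra_simps)
end

global_interpretation complex_vector: vector_space
  "scaleC :: complex \<Rightarrow> 'a \<Rightarrow> 'a::complex_vector"
  by unfold_locales (simp_all add: scaleC_add_right scaleC_add_left scaleC_scaleC scaleC_one)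

abbreviation clinear :: "('a::complex_vector \<Rightarrow> 'b::complex_vector) \<Rightarrow> bool" where
  "clinear \<equiv> Vector_Spaces.linear scaleC scaleC"

lemma clinear_iff: "clinear f \<longleftrightarrow> (\<forall>x y. f (x + y) = f x + f y) \<and> (\<forall>c x. f (c *\<^sub>C x) = c *\<^sub>C f x)"
  by (auto simp: Vector_Spaces.linear_iff complex_vector.vector_space_axioms)

lemma clinearD:
  assumes "clinear f"
  shows "f (x + y) = f x + f y" "f (c *\<^sub>C x) = c *\<^sub>C f x" "f 0 = 0" "f (- x) = - f x"
    "f (x - y) = f x - f y"
proof -
  show a: "f (x + y) = f x + f y" and s: "f (c *\<^sub>C x) = c *\<^sub>C f x" for x y c
    using assms by (auto simp: clinear_iff)
  show z: "f 0 = 0" using a[of 0 0] by simp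
  show m: "f (- x) = - f x" for x using a[of x "- x"] z by (simp add: eq_neg_iff_add_eq_0 add.commute)
  show "f (x - y) = f x - f y" using a[of x "- y"] m[of y] by simp
qed

definition cbilinear :: "('a::complex_vector \<Rightarrow> 'b::complex_vector \<Rightarrow> 'c::complex_vector) \<Rightarrow> bool" where
  "cbilinear f \<longleftrightarrow> (\<forall>b. clinear (\<lambda>a. f a b)) \<and> (\<forall>a. clinear (f a))"

definition algebra_hom :: "('a::complex_algebra \<Rightarrow> 'b::complex_algebra) \<Rightarrow> bool" where
  "algebra_hom f \<longleftrightarrow> clinear f \<and> (\<forall>x y. f (x * y) = f x * f y)"

definition algebra_antihom :: "('a::complex_algebra \<Rightarrow> 'b::complex_algebra) \<Rightarrow> bool" where
  "algebra_antihom f \<longleftrightarrow> clinear f \<and> (\<forall>x y. f (x * y) = f y * f x)"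


section \<open>The algebraic tensor product\<close>

instantiation poly_mapping :: (type, complex_vector) complex_vector
begin
lift_definition scaleC_poly_mapping :: "complex \<Rightarrow> ('a \<Rightarrow>\<^sub>0 'b) \<Rightarrow> ('a \<Rightarrow>\<^sub>0 'b)"
  is "\<lambda>c f k. c *\<^sub>C f k"
  by (erule finite_subset[rotated]) auto
instance
  by standard (transfer; simp add: fun_eq_iff scaleC_add_right scaleC_add_left scaleC_scaleC scaleC_one)+
end

text \<open>The tensor product is the quotient of the free vector space on pairs by the usual bilinearity
  relations.\<close>

definition tensor_relations :: "('a::complex_vector \<times> 'b::complex_vector \<Rightarrow>\<^sub>0 complex) set" where
  "tensor_relations = complex_vector.span
     ({Poly_Mapping.single (x + x', y) 1 - Poly_Mapping.single (x, y) 1 - Poly_Mapping.single (x', y) 1 | x x' y. True}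
    \<union> {Poly_Mapping.single (x, y + y') 1 - Poly_Mapping.single (x, y) 1 - Poly_Mapping.single (x, y') 1 | x y y'. True}
    \<union> {Poly_Mapping.single (c *\<^sub>C x, y) 1 - c *\<^sub>C Poly_Mapping.single (x, y) 1 | c x y. True}
    \<union> {Poly_Mapping.single (x, c *\<^sub>C y) 1 - c *\<^sub>C Poly_Mapping.single (x, y) 1 | c x y. True})"

lemma subspace_tensor_relations: "complex_vector.subspace tensor_relations"
  unfolding tensor_relations_def by (rule complex_vector.subspace_span)

lemmas tensor_relations_closed =
  complex_vector.subspace_0[OF subspace_tensor_relations]
  complex_vector.subspace_add[OF subspace_tensor_relations]
  complex_vector.subspace_diff[OF subspace_tensor_relations]
  complex_vector.subspace_neg[OF subspace_tensor_relations]
  complex_vector.subspace_scale[OF subspace_tensor_relations]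

quotient_type (overloaded) ('a, 'b) tensor =
  "('a::complex_vector \<times> 'b::complex_vector) \<Rightarrow>\<^sub>0 complex" / "\<lambda>x y. x - y \<in> tensor_relations"
proof (rule equivpI)
  show "reflp (\<lambda>x y :: 'a \<times> 'b \<Rightarrow>\<^sub>0 complex. x - y \<in> tensor_relations)"
    by (rule reflpI) (simp add: tensor_relations_closed)
  show "symp (\<lambda>x y :: 'a \<times> 'b \<Rightarrow>\<^sub>0 complex. x - y \<in> tensor_relations)"
    by (rule sympI) (metis minus_diff_eq tensor_relations_closed(4))
  show "transp (\<lambda>x y :: 'a \<times> 'b \<Rightarrow>\<^sub>0 complex. x - y \<in> tensor_relations)"
    by (rule transpI) (use tensor_relations_closed(2) in fastforce)
qed

instantiation tensor :: (complex_vector, complex_vector) complex_vector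
begin

lift_definition zero_tensor :: "('a, 'b) tensor" is 0 .
lift_definition plus_tensor :: "('a, 'b) tensor \<Rightarrow> ('a, 'b) tensor \<Rightarrow> ('a, 'b) tensor" is plus
  by (metis add_diff_add tensor_relations_closed(2))
lift_definition uminus_tensor :: "('a, 'b) tensor \<Rightarrow> ('a, 'b) tensor" is uminus
  by (metis minus_diff_minus tensor_relations_closed(4))
lift_definition minus_tensor :: "('a, 'b) tensor \<Rightarrow> ('a, 'b) tensor \<Rightarrow> ('a, 'b) tensor" is minus
proof -
  fix p p' q q' :: "'a \<times> 'b \<Rightarrow>\<^sub>0 complex"
  assume "p - p' \<in> tensor_relations" "q - q' \<in> tensor_relations"
  then have "(p - p') - (q - q') \<in> tensor_relations" by (rule tensor_relations_closed(3))
  then show "(p - q) - (p' - q') \<in> tensor_relations" by (simp add: algebra_simps)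
qed
lift_definition scaleC_tensor :: "complex \<Rightarrow> ('a, 'b) tensor \<Rightarrow> ('a, 'b) tensor" is scaleC
  by (metis complex_vector.scale_right_diff_distrib tensor_relations_closed(5))

instance
  by standard (transfer; simp add: tensor_relations_closed scaleC_add_right scaleC_add_left
      scaleC_scaleC scaleC_one algebra_simps)+

end

lift_definition tens :: "'a::complex_vector \<Rightarrow> 'b::complex_vector \<Rightarrow> ('a, 'b) tensor"  (infixr "\<otimes>" 76)
  is "\<lambda>x y. Poly_Mapping.single (x, y) 1" .

text \<open>\<open>tensor_lift f\<close> is the linear map on the tensor product induced by a bilinear map \<open>f\<close>; it
  is meaningless for other \<open>f\<close>.\<close>

definition free_lift :: "('a \<Rightarrow> 'c::complex_vector) \<Rightarrow> ('a \<Rightarrow>\<^sub>0 complex) \<Rightarrow> 'c" where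
  "free_lift f p = (\<Sum>k\<in>Poly_Mapping.keys p. Poly_Mapping.lookup p k *\<^sub>C f k)"

definition tensor_lift ::
  "('a::complex_vector \<Rightarrow> 'b::complex_vector \<Rightarrow> 'c::complex_vector) \<Rightarrow> ('a, 'b) tensor \<Rightarrow> 'c" where
  "tensor_lift f t = free_lift (\<lambda>(x, y). f x y) (rep_tensor t)"

lemma tens_bilinear:
  "(x + x') \<otimes> y = x \<otimes> y + x' \<otimes> y" "x \<otimes> (y + y') = x \<otimes> y + x \<otimes> y'"
  "(c *\<^sub>C x) \<otimes> y = c *\<^sub>C (x \<otimes> y)" "x \<otimes> (c *\<^sub>C y) = c *\<^sub>C (x \<otimes> y)"
     apply (transfer, unfold tensor_relations_def diff_diff_eq[symmetric], rule complex_vector.span_base, blast)+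
  done

lemma cbilinear_tens: "cbilinear (\<otimes>)"
  by (simp add: cbilinear_def clinear_iff tens_bilinear)

lemma free_lift_superset:
  assumes "finite K" "Poly_Mapping.keys p \<subseteq> K"
  shows "free_lift f p = (\<Sum>k\<in>K. Poly_Mapping.lookup p k *\<^sub>C f k)"
  unfolding free_lift_def
  by (rule sum.mono_neutral_left) (use assms in \<open>auto simp: in_keys_iff\<close>)

lemma clinear_free_lift: "clinear (free_lift f)"
proof -
  have "free_lift f (p + q) = free_lift f p + free_lift f q" for p q
  proof -
    let ?K = "Poly_Mapping.keys p \<union> Poly_Mapping.keys q"
    have "free_lift f (p + q) = (\<Sum>k\<in>?K. Poly_Mapping.lookup (p + q) k *\<^sub>C f k)"
      by (rule free_lift_superset) (auto simp: Poly_Mapping.keys_add)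
    also have "\<dots> = (\<Sum>k\<in>?K. Poly_Mapping.lookup p k *\<^sub>C f k) + (\<Sum>k\<in>?K. Poly_Mapping.lookup q k *\<^sub>C f k)"
      by (simp add: lookup_add scaleC_add_left sum.distrib)
    also have "\<dots> = free_lift f p + free_lift f q"
      by (subst (1 2) free_lift_superset[of ?K]) auto
    finally show ?thesis .
  qed
  moreover have "free_lift f (c *\<^sub>C p) = c *\<^sub>C free_lift f p" for c p
  proof -
    have "free_lift f (c *\<^sub>C p) = (\<Sum>k\<in>Poly_Mapping.keys p. Poly_Mapping.lookup (c *\<^sub>C p) k *\<^sub>C f k)"
      by (rule free_lift_superset) (auto simp: in_keys_iff scaleC_poly_mapping.rep_eq)
    then show ?thesis
      by (simp add: free_lift_def scaleC_poly_mapping.rep_eq scaleC_scaleC complex_vector.scale_sum_right)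
  qed
  ultimately show ?thesis by (simp add: clinear_iff)
qed

lemma free_lift_single: "free_lift f (Poly_Mapping.single k 1) = f k"
  by (subst free_lift_superset[of "{k}"]) (auto simp: scaleC_one)

lemma free_lift_relations:
  assumes f: "cbilinear f" and p: "p \<in> tensor_relations"
  shows "free_lift (\<lambda>(x, y). f x y) p = 0"
proof -
  have "complex_vector.subspace {p. free_lift (\<lambda>(x, y). f x y) p = 0}"
    by (auto intro!: complex_vector.subspaceI simp: clinearD[OF clinear_free_lift])
  moreover have "f (x + x') y = f x y + f x' y" "f x (y + y') = f x y + f x y'"
    "f (c *\<^sub>C x) y = c *\<^sub>C f x y" "f x (c *\<^sub>C y) = c *\<^sub>C f x y" for x x' y y' c
    using f by (auto simp: cbilinear_def clinear_iff)
  ultimately have "tensor_relations \<subseteq> {p. free_lift (\<lambda>(x, y). f x y) p = 0}"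
    unfolding tensor_relations_def
    by (intro complex_vector.span_minimal)
       (auto simp: clinearD[OF clinear_free_lift] free_lift_single)
  with p show ?thesis by auto
qed

lemma tensor_lift_abs:
  assumes "cbilinear f"
  shows "tensor_lift f (abs_tensor p) = free_lift (\<lambda>(x, y). f x y) p"
proof -
  have "rep_tensor (abs_tensor p) - p \<in> tensor_relations"
    by (rule tensor.abs_eq_iff[THEN iffD1]) (rule Quotient3_abs_rep[OF Quotient3_tensor])
  from free_lift_relations[OF assms this] show ?thesis
    by (simp add: tensor_lift_def clinearD[OF clinear_free_lift])
qed

lemma clinear_tensor_lift:
  assumes "cbilinear f"
  shows "clinear (tensor_lift f)"
  unfolding clinear_iff
proof (intro conjI allI)
  fix s t :: "('a, 'b) tensor" and c
  obtain p q where "s = abs_tensor p" "t = abs_tensor q"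
    using Quotient3_abs_rep[OF Quotient3_tensor, of s] Quotient3_abs_rep[OF Quotient3_tensor, of t] by metis
  then show "tensor_lift f (s + t) = tensor_lift f s + tensor_lift f t"
    and "tensor_lift f (c *\<^sub>C s) = c *\<^sub>C tensor_lift f s"
    by (simp_all add: plus_tensor.abs_eq scaleC_tensor.abs_eq tensor_lift_abs[OF assms]
        clinearD[OF clinear_free_lift])
qed

lemma tensor_lift_tens:
  assumes "cbilinear f"
  shows "tensor_lift f (x \<otimes> y) = f x y"
  by (simp add: tens.abs_eq tensor_lift_abs[OF assms] free_lift_single)

lemma tensor_induct [case_names tens add, induct type: tensor]:
  assumes tens: "\<And>x y. P (x \<otimes> y)" and add: "\<And>s t. P s \<Longrightarrow> P t \<Longrightarrow> P (s + t)"
  shows "P t"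
proof -
  have single: "P (abs_tensor (Poly_Mapping.single k v))" for k :: "'a \<times> 'b" and v
  proof -
    have "Poly_Mapping.single k v = v *\<^sub>C Poly_Mapping.single k 1"
      by transfer (auto simp: fun_eq_iff when_def)
    then have "abs_tensor (Poly_Mapping.single k v) = (v *\<^sub>C fst k) \<otimes> snd k"
      by (simp add: tens_bilinear(3)) (simp add: tens.abs_eq scaleC_tensor.abs_eq)
    then show ?thesis using tens by simp
  qed
  have *: "P (abs_tensor p)" if "finite K" "Poly_Mapping.keys p \<subseteq> K" for K and p :: "'a \<times> 'b \<Rightarrow>\<^sub>0 complex"
    using that
  proof (induction K arbitrary: p rule: finite_induct)
    case empty
    then have "p = 0" by (intro poly_mapping_eqI) (auto simp: in_keys_iff)
    then show ?case using single[of undefined 0] by simp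
  next
    case (insert k K)
    let ?q = "p - Poly_Mapping.single k (Poly_Mapping.lookup p k)"
    have "Poly_Mapping.keys ?q \<subseteq> K"
      using insert.prems by (auto simp: in_keys_iff lookup_minus lookup_single when_def split: if_splits)
    from add[OF insert.IH[OF this] single[of k "Poly_Mapping.lookup p k"]] show ?case
      by (simp add: plus_tensor.abs_eq)
  qed
  show ?thesis using *[OF finite_keys order_refl, of "rep_tensor t"] Quotient3_abs_rep[OF Quotient3_tensor, of t] by simp
qed

lemma clinear_eq_tensor:
  assumes "clinear f" "clinear g" "\<And>x y. f (x \<otimes> y) = g (x \<otimes> y)"
  shows "f t = g t"
  by (induction t) (use assms in \<open>auto simp: clinearD\<close>)

definition tensor_map :: "('a::complex_vector \<Rightarrow> 'c::complex_vector) \<Rightarrow> ('b::complex_vector \<Rightarrow> 'd::complex_vector)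
    \<Rightarrow> ('a, 'b) tensor \<Rightarrow> ('c, 'd) tensor" where
  "tensor_map f g = tensor_lift (\<lambda>x y. f x \<otimes> g y)"

lemma tensor_map:
  assumes "clinear f" "clinear g"
  shows "clinear (tensor_map f g)" "tensor_map f g (x \<otimes> y) = f x \<otimes> g y"
proof -
  have "cbilinear (\<lambda>x y. f x \<otimes> g y)"
    using assms by (simp add: cbilinear_def clinear_iff tens_bilinear)
  then show "clinear (tensor_map f g)" "tensor_map f g (x \<otimes> y) = f x \<otimes> g y"
    by (simp_all add: tensor_map_def clinear_tensor_lift tensor_lift_tens)
qed

text \<open>The product of \<open>A \<otimes> B\<close>, determined by \<open>(a \<otimes> b) (c \<otimes> d) = a c \<otimes> b d\<close>.\<close>

definition tensor_mult :: "('a::complex_algebra, 'b::complex_algebra) tensor \<Rightarrow> ('a, 'b) tensor \<Rightarrow> ('a, 'b) tensor" where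
  "tensor_mult s t = tensor_lift (\<lambda>a b. tensor_lift (\<lambda>c d. (a * c) \<otimes> (b * d)) t) s"

lemma clinear_mult: "clinear ((*) a)" "clinear (\<lambda>x. x * a)" for a :: "'a::complex_algebra"
  by (simp_all add: clinear_iff mult_scaleC_left mult_scaleC_right algebra_simps)

lemma tensor_mult:
  fixes s t :: "('a::complex_algebra, 'b::complex_algebra) tensor" and a c :: 'a and b d :: 'b
  shows "clinear (tensor_mult s)" "clinear (\<lambda>s. tensor_mult s t)"
    "tensor_mult (a \<otimes> b) (c \<otimes> d) = (a * c) \<otimes> (b * d)"
proof -
  have in_bil: "cbilinear (\<lambda>c d. (a * c) \<otimes> (b * d))" for a :: 'a and b :: 'b
    by (simp add: cbilinear_def clinear_iff tens_bilinear mult_scaleC_right algebra_simps)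
  have out_bil: "cbilinear (\<lambda>a b. tensor_lift (\<lambda>c d. (a * c) \<otimes> (b * d)) t)" for t :: "('a, 'b) tensor"
  proof (induction t)
    case (tens x y)
    show ?case
      by (simp add: tensor_lift_tens[OF in_bil])
         (simp add: cbilinear_def clinear_iff tens_bilinear mult_scaleC_left algebra_simps)
  next
    case (add s t)
    then show ?case
      by (simp add: clinearD[OF clinear_tensor_lift[OF in_bil]])
         (simp add: cbilinear_def clinear_iff scaleC_add_right algebra_simps)
  qed
  show "tensor_mult (a \<otimes> b) (c \<otimes> d) = (a * c) \<otimes> (b * d)"
    unfolding tensor_mult_def by (subst tensor_lift_tens[OF out_bil]) (rule tensor_lift_tens[OF in_bil])
  have pure: "tensor_mult (a \<otimes> b) t = tensor_lift (\<lambda>c d. (a * c) \<otimes> (b * d)) t" for a :: 'a and b :: 'b and t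
    unfolding tensor_mult_def by (rule tensor_lift_tens[OF out_bil])
  show r: "clinear (\<lambda>s. tensor_mult s t)" for t :: "('a, 'b) tensor"
    using clinear_tensor_lift[OF out_bil, of t] by (simp add: tensor_mult_def[abs_def])
  have "tensor_mult s (t + t') = tensor_mult s t + tensor_mult s t'"
    and "tensor_mult s (k *\<^sub>C t) = k *\<^sub>C tensor_mult s t" for t t' k
  proof (induction s)
    case (tens a b)
    { case 1 show ?case
        by (simp add: pure clinearD[OF clinear_tensor_lift[OF in_bil]]) }
    { case 2 show ?case
        by (simp add: pure clinearD[OF clinear_tensor_lift[OF in_bil]]) }
  next
    case (add s s')
    { case 1 show ?case by (simp add: clinearD[OF r] add) }
    { case 2 show ?case by (simp add: clinearD[OF r] add scaleC_add_right) }
  qed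
  then show "clinear (tensor_mult s)" by (simp add: clinear_iff)
qed

instantiation tensor :: (complex_algebra, complex_algebra) complex_algebra
begin

definition times_tensor_def: "s * t = tensor_mult s (t :: ('a, 'b) tensor)"

instance
proof
  fix r s t :: "('a, 'b) tensor" and c
  note lin = clinearD[OF tensor_mult(1)] clinearD[OF tensor_mult(2)]
  show "(r + s) * t = r * t + s * t" "r * (s + t) = r * s + r * t"
    "c *\<^sub>C r * s = c *\<^sub>C (r * s)" "r * c *\<^sub>C s = c *\<^sub>C (r * s)"
    by (simp_all add: times_tensor_def lin)
  show "r * s * t = r * (s * t)"
    unfolding times_tensor_def
  proof (induction r)
    case (tens x y)
    show ?case
    proof (induction s)
      case (tens x' y')
      show ?case
        by (induction t) (simp_all add: tensor_mult(3) lin mult.assoc)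
    qed (simp add: lin)
  qed (simp add: lin)
qed

end

lemma tens_mult_tens: "(a \<otimes> b) * (c \<otimes> d) = (a * c) \<otimes> (b * d)"
  by (simp add: times_tensor_def tensor_mult)


definition tensor_assoc ::
  "(('a::complex_vector, 'b::complex_vector) tensor, 'c::complex_vector) tensor \<Rightarrow> ('a, ('b, 'c) tensor) tensor" where
  "tensor_assoc = tensor_lift (\<lambda>s z. tensor_lift (\<lambda>x y. x \<otimes> y \<otimes> z) s)"

definition tensor_flip :: "('a::complex_vector, 'b::complex_vector) tensor \<Rightarrow> ('b, 'a) tensor" where
  "tensor_flip = tensor_lift (\<lambda>x y. y \<otimes> x)"

lemma tensor_flip: "clinear tensor_flip" "tensor_flip (x \<otimes> y) = y \<otimes> x"
proof -
  have bil: "cbilinear (\<lambda>x y. y \<otimes> x)"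
    by (simp add: cbilinear_def clinear_iff tens_bilinear)
  show "clinear tensor_flip" "tensor_flip (x \<otimes> y) = y \<otimes> x"
    by (simp_all add: tensor_flip_def clinear_tensor_lift[OF bil] tensor_lift_tens[OF bil])
qed

lemma tensor_flip_flip: "tensor_flip (tensor_flip t) = t"
  by (induction t) (simp_all add: clinearD(1)[OF tensor_flip(1)] tensor_flip(2))

lemma algebra_hom_tensor_flip: "algebra_hom tensor_flip"
proof -
  note lin = clinearD(1)[OF tensor_flip(1)]
  have "tensor_flip (s * t) = tensor_flip s * tensor_flip t" for s t :: "('a, 'b) tensor"
  proof (induction s)
    case (tens x y)
    show ?case by (induction t) (simp_all add: lin tens_mult_tens tensor_flip(2) distrib_left)
  qed (simp add: lin distrib_right)
  then show ?thesis by (simp add: algebra_hom_def tensor_flip(1))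
qed

lemma tensor_assoc:
  fixes x :: "'a::complex_vector" and y :: "'b::complex_vector" and z :: "'c::complex_vector"
  shows "clinear (tensor_assoc :: (('a, 'b) tensor, 'c) tensor \<Rightarrow> _)" "tensor_assoc ((x \<otimes> y) \<otimes> z) = x \<otimes> y \<otimes> z"
proof -
  have bil: "cbilinear (\<lambda>(x::'a) (y::'b). x \<otimes> y \<otimes> z)" for z :: 'c
    by (simp add: cbilinear_def clinear_iff tens_bilinear)
  note lin = clinearD[OF clinear_tensor_lift[OF bil]]
  have "clinear (\<lambda>z::'c. tensor_lift (\<lambda>x y. x \<otimes> y \<otimes> z) s)" for s :: "('a, 'b) tensor"
  proof (induction s)
    case (tens x y)
    show ?case unfolding tensor_lift_tens[OF bil] by (simp add: clinear_iff tens_bilinear)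
  next
    case (add s t)
    then show ?case by (simp add: lin clinear_iff scaleC_add_right algebra_simps)
  qed
  then have bil2: "cbilinear (\<lambda>(s :: ('a, 'b) tensor) (z :: 'c). tensor_lift (\<lambda>x y. x \<otimes> y \<otimes> z) s)"
    by (simp add: cbilinear_def clinear_tensor_lift[OF bil])
  show "clinear (tensor_assoc :: (('a, 'b) tensor, 'c) tensor \<Rightarrow> _)"
    and "tensor_assoc ((x \<otimes> y) \<otimes> z) = x \<otimes> y \<otimes> z"
    by (simp_all add: tensor_assoc_def clinear_tensor_lift[OF bil2] tensor_lift_tens[OF bil2] tensor_lift_tens[OF bil])
qed

lemma bij_tensor_assoc: "bij tensor_assoc"
proof -
  let ?g = "\<lambda>t. tensor_flip (tensor_assoc (tensor_flip (tensor_assoc (tensor_flip t))))"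
  note lin = clinearD(1)[OF tensor_assoc(1)] clinearD(1)[OF tensor_flip(1)]
  have "?g (tensor_assoc t) = t" for t :: "(('a, 'b) tensor, 'c) tensor"
  proof (induction t)
    case (tens s z)
    show ?case by (induction s) (simp_all add: lin tens_bilinear tensor_assoc(2) tensor_flip(2))
  qed (simp add: lin)
  moreover have "tensor_assoc (?g t) = t" for t :: "('a, ('b, 'c) tensor) tensor"
  proof (induction t)
    case (tens x s)
    show ?case by (induction s) (simp_all add: lin tens_bilinear tensor_assoc(2) tensor_flip(2))
  qed (simp add: lin)
  ultimately show ?thesis by (rule o_bij[OF ext ext, unfolded o_def id_def])
qed

lemma algebra_hom_tensor_assoc: "algebra_hom tensor_assoc"
proof -
  note lin = clinearD(1)[OF tensor_assoc(1)]
  have "tensor_assoc (s * t) = tensor_assoc s * tensor_assoc t" for s t :: "(('a, 'b) tensor, 'c) tensor"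
  proof (induction s)
    case (tens s z)
    show ?case
    proof (induction t)
      case (tens t z')
      show ?case
      proof (induction s)
        case (tens x y)
        show ?case
          by (induction t) (simp_all add: lin tens_mult_tens tensor_assoc(2) tens_bilinear distrib_left)
      qed (simp add: lin tens_mult_tens tens_bilinear distrib_right)
    qed (simp add: lin distrib_left)
  qed (simp add: lin distrib_right)
  then show ?thesis by (simp add: algebra_hom_def tensor_assoc(1))
qed


section \<open>The multiplier algebra\<close>

text \<open>A multiplier of \<open>A\<close> is a pair \<open>(L, R)\<close>, where \<open>L b\<close> and \<open>R b\<close> stand for \<open>m b\<close> and \<open>b m\<close>.
  For non-degenerate \<open>A\<close> linearity and the two module properties follow from the last condition.\<close>

typedef (overloaded) 'a multiplier =
  "{(L, R) :: ('a::complex_algebra \<Rightarrow> 'a) \<times> ('a \<Rightarrow> 'a) | L R. clinear L \<and> clinear R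
     \<and> (\<forall>a b. L (a * b) = L a * b) \<and> (\<forall>a b. R (a * b) = a * R b)
     \<and> (\<forall>a b. a * L b = R a * b)}"
  by (rule exI[of _ "(\<lambda>x. x, \<lambda>x. x)"]) (simp add: clinear_iff)

setup_lifting type_definition_multiplier

lift_definition lact :: "'a::complex_algebra multiplier \<Rightarrow> 'a \<Rightarrow> 'a" is fst .
lift_definition ract :: "'a::complex_algebra \<Rightarrow> 'a multiplier \<Rightarrow> 'a" is "\<lambda>a m. snd m a" .

lemma lact: "clinear (lact m)" "lact m (a * b) = lact m a * b"
  and ract: "clinear (\<lambda>a. ract a m)" "ract (a * b) m = a * ract b m"
  and lact_ract: "a * lact m b = ract a m * b"
  by (transfer; auto simp: eta_contract_eq)+

lemma multiplier_eqI: "(\<And>a. lact m a = lact n a) \<Longrightarrow> (\<And>a. ract a m = ract a n) \<Longrightarrow> m = n"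
  by transfer (auto simp: prod_eq_iff)

instantiation multiplier :: (complex_algebra) complex_algebra
begin
lift_definition zero_multiplier :: "'a multiplier" is "(\<lambda>_. 0, \<lambda>_. 0)"
  by (simp add: clinear_iff)
lift_definition plus_multiplier :: "'a multiplier \<Rightarrow> 'a multiplier \<Rightarrow> 'a multiplier"
  is "\<lambda>(L, R) (L', R'). (\<lambda>x. L x + L' x, \<lambda>x. R x + R' x)"
  by (clarsimp simp: clinear_iff scaleC_add_right algebra_simps)
lift_definition uminus_multiplier :: "'a multiplier \<Rightarrow> 'a multiplier"
  is "\<lambda>(L, R). (\<lambda>x. - L x, \<lambda>x. - R x)"
  by (clarsimp simp: clinear_iff algebra_simps)
lift_definition minus_multiplier :: "'a multiplier \<Rightarrow> 'a multiplier \<Rightarrow> 'a multiplier"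
  is "\<lambda>(L, R) (L', R'). (\<lambda>x. L x - L' x, \<lambda>x. R x - R' x)"
  by (clarsimp simp: clinear_iff complex_vector.scale_right_diff_distrib algebra_simps)
lift_definition scaleC_multiplier :: "complex \<Rightarrow> 'a multiplier \<Rightarrow> 'a multiplier"
  is "\<lambda>c (L, R). (\<lambda>x. c *\<^sub>C L x, \<lambda>x. c *\<^sub>C R x)"
  by (clarsimp simp: clinear_iff scaleC_add_right scaleC_scaleC mult.commute mult_scaleC_left mult_scaleC_right)
lift_definition times_multiplier :: "'a multiplier \<Rightarrow> 'a multiplier \<Rightarrow> 'a multiplier"
  is "\<lambda>(L, R) (L', R'). (\<lambda>x. L (L' x), \<lambda>x. R' (R x))"
  by (clarsimp simp: clinear_iff)
instance
  by standard (transfer; clarsimp simp: clinear_iff fun_eq_iff scaleC_add_right scaleC_add_left scaleC_scaleC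
      scaleC_one algebra_simps)+
end

instantiation multiplier :: (complex_algebra) one
begin
lift_definition one_multiplier :: "'a multiplier" is "(\<lambda>x. x, \<lambda>x. x)"
  by (simp add: clinear_iff)
instance ..
end

instance multiplier :: (complex_algebra) monoid_mult
  by standard (transfer; auto)+

lift_definition to_mult :: "'a::complex_algebra \<Rightarrow> 'a multiplier" is "\<lambda>a. (\<lambda>x. a * x, \<lambda>x. x * a)"
  by (simp add: clinear_mult mult.assoc)

text \<open>For a non-degenerate algebra \<^const>\<open>to_mult\<close> is injective, and \<open>A\<close> is identified with its image
  in \<open>M(A)\<close>; \<open>from_mult\<close> is then the inverse on that image.\<close>

definition from_mult :: "'a::complex_algebra multiplier \<Rightarrow> 'a" where
  "from_mult = inv to_mult"

definition nondegenerate :: "'a::complex_algebra itself \<Rightarrow> bool" where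
  "nondegenerate _ \<longleftrightarrow> (\<forall>a::'a. (\<forall>b. a * b = 0) \<longrightarrow> a = 0) \<and> (\<forall>a::'a. (\<forall>b. b * a = 0) \<longrightarrow> a = 0)"

definition idempotent :: "'a::complex_algebra itself \<Rightarrow> bool" where
  "idempotent _ \<longleftrightarrow> complex_vector.span {a * b | a b :: 'a. True} = UNIV"

lift_definition mtens :: "'a::complex_algebra multiplier \<Rightarrow> 'b::complex_algebra multiplier \<Rightarrow> ('a, 'b) tensor multiplier"
    (infixr "\<otimes>\<^sub>M" 76)
  is "\<lambda>(L, R) (L', R'). (tensor_map L L', tensor_map R R')"
proof (clarsimp, intro conjI allI)
  fix L R :: "'a \<Rightarrow> 'a" and L' R' :: "'b \<Rightarrow> 'b" and s t :: "('a, 'b) tensor"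
  assume lin: "clinear L" "clinear R" "clinear L'" "clinear R'"
    and m: "\<forall>a b. L (a * b) = L a * b" "\<forall>a b. R (a * b) = a * R b" "\<forall>a b. a * L b = R a * b"
      "\<forall>a b. L' (a * b) = L' a * b" "\<forall>a b. R' (a * b) = a * R' b" "\<forall>a b. a * L' b = R' a * b"
  note tm = tensor_map[OF lin(1,3)] tensor_map[OF lin(2,4)]
  note simps = tm(2,4) clinearD[OF tm(1)] clinearD[OF tm(3)]
  show "clinear (tensor_map L L')" "clinear (tensor_map R R')" by (fact tm)+
  show "tensor_map L L' (s * t) = tensor_map L L' s * t"
  proof (induction s)
    case (tens x y)
    show ?case by (induction t) (simp_all add: simps tens_mult_tens m distrib_left)
  qed (simp add: simps distrib_right)
  show "tensor_map R R' (s * t) = s * tensor_map R R' t"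
  proof (induction s)
    case (tens x y)
    show ?case by (induction t) (simp_all add: simps tens_mult_tens m distrib_left)
  qed (simp add: simps distrib_right)
  show "s * tensor_map L L' t = tensor_map R R' s * t"
  proof (induction s)
    case (tens x y)
    show ?case by (induction t) (simp_all add: simps tens_mult_tens m distrib_left)
  qed (simp add: simps distrib_right)
qed

text \<open>Transport of multipliers along an algebra isomorphism \<open>f\<close>.\<close>

definition mult_transport :: "('a::complex_algebra \<Rightarrow> 'b::complex_algebra) \<Rightarrow> 'a multiplier \<Rightarrow> 'b multiplier" where
  "mult_transport f m = Abs_multiplier (\<lambda>b. f (lact m (inv f b)), \<lambda>b. f (ract (inv f b) m))"

lemma mult_transport:
  assumes f: "algebra_hom f" "bij f"
  shows "lact (mult_transport f m) b = f (lact m (inv f b))"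
    and "ract b (mult_transport f m) = f (ract (inv f b) m)"
proof -
  have [simp]: "inv f (f a) = a" "f (inv f b) = b" for a b
    using f(2) by (simp_all add: bij_is_inj bij_is_surj surj_f_inv_f)
  have [simp]: "f (x + y) = f x + f y" "f (c *\<^sub>C x) = c *\<^sub>C f x" "f (x * y) = f x * f y" for x y c
    using f(1) by (auto simp: algebra_hom_def clinear_iff)
  have i: "inv f (x + y) = inv f x + inv f y" "inv f (c *\<^sub>C x) = c *\<^sub>C inv f x"
    "inv f (x * y) = inv f x * inv f y" for x y c
    using f(2) by (intro inv_f_eq; simp add: bij_is_inj)+
  have lr: "lact m (x + y) = lact m x + lact m y" "lact m (c *\<^sub>C x) = c *\<^sub>C lact m x"
    "ract (x + y) m = ract x m + ract y m" "ract (c *\<^sub>C x) m = c *\<^sub>C ract x m" for x y c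
    using lact(1)[of m] ract(1)[of m] by (auto simp: clinear_iff)
  have mid: "a * f (lact m (inv f b)) = f (ract (inv f a) m) * b" for a b
    using arg_cong[OF lact_ract[of "inv f a" m "inv f b"], of f] by simp
  have "(\<lambda>b. f (lact m (inv f b)), \<lambda>b. f (ract (inv f b) m)) \<in>
    {(L, R) | L R. clinear L \<and> clinear R \<and> (\<forall>a b. L (a * b) = L a * b) \<and> (\<forall>a b. R (a * b) = a * R b)
     \<and> (\<forall>a b. a * L b = R a * b)}"
    using mid by (simp add: clinear_iff i lr lact(2) ract(2))
  then show "lact (mult_transport f m) b = f (lact m (inv f b))"
    and "ract b (mult_transport f m) = f (ract (inv f b) m)"
    by (simp_all add: mult_transport_def lact.rep_eq ract.rep_eq Abs_multiplier_inverse)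
qed

text \<open>All threefold tensor products are taken in \<open>A \<otimes> (A \<otimes> A)\<close>. The maps below are \<open>x \<mapsto> x \<otimes> 1\<close>
  and \<open>x \<mapsto> x\<^sub>1\<^sub>3\<close> from \<open>M(A \<otimes> A)\<close> to \<open>M(A \<otimes> A \<otimes> A)\<close>; the embedding on the second and third
  factors is \<open>x \<mapsto> 1 \<otimes>\<^sub>M x\<close>.\<close>

type_synonym 'a tensor2 = "('a, 'a) tensor"
type_synonym 'a tensor3 = "('a, 'a tensor2) tensor"

definition leg12 :: "'a::complex_algebra tensor2 multiplier \<Rightarrow> 'a tensor3 multiplier" where
  "leg12 x = mult_transport tensor_assoc (x \<otimes>\<^sub>M (1 :: 'a multiplier))"

definition leg13 :: "'a::complex_algebra tensor2 multiplier \<Rightarrow> 'a tensor3 multiplier" where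
  "leg13 x = mult_transport (tensor_map id tensor_flip \<circ> tensor_assoc) (x \<otimes>\<^sub>M (1 :: 'a multiplier))"

text \<open>The extension to \<open>M(A)\<close> of a homomorphism \<open>\<gamma> : A \<rightarrow> M(B)\<close> with prescribed value \<open>e\<close> at \<open>1\<close>
  (where \<open>e\<close> is an idempotent with \<open>\<gamma>(A) B = e B\<close> and \<open>B \<gamma>(A) = B e\<close>).\<close>

definition mult_extension ::
  "('a::complex_algebra \<Rightarrow> 'b::complex_algebra multiplier) \<Rightarrow> 'b multiplier \<Rightarrow> 'a multiplier \<Rightarrow> 'b multiplier" where
  "mult_extension \<gamma> e = (THE F. algebra_hom F \<and> (\<forall>a. F (to_mult a) = \<gamma> a) \<and> F 1 = e)"


section \<open>Coproducts and counits\<close>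

definition T1 :: "('a::complex_algebra \<Rightarrow> 'a tensor2 multiplier) \<Rightarrow> 'a tensor2 \<Rightarrow> 'a tensor2" where
  "T1 \<Delta> = tensor_lift (\<lambda>a b. from_mult (\<Delta> a * (1 \<otimes>\<^sub>M to_mult b)))"

definition T2 :: "('a::complex_algebra \<Rightarrow> 'a tensor2 multiplier) \<Rightarrow> 'a tensor2 \<Rightarrow> 'a tensor2" where
  "T2 \<Delta> = tensor_lift (\<lambda>a b. from_mult ((to_mult a \<otimes>\<^sub>M 1) * \<Delta> b))"

definition coproduct_id :: "('a::complex_algebra \<Rightarrow> 'a tensor2 multiplier) \<Rightarrow> 'a tensor2 \<Rightarrow> 'a tensor3 multiplier" where
  "coproduct_id \<Delta> = tensor_lift (\<lambda>a b. mult_transport tensor_assoc (\<Delta> a \<otimes>\<^sub>M to_mult b))"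

definition id_coproduct :: "('a::complex_algebra \<Rightarrow> 'a tensor2 multiplier) \<Rightarrow> 'a tensor2 \<Rightarrow> 'a tensor3 multiplier" where
  "id_coproduct \<Delta> = tensor_lift (\<lambda>a b. to_mult a \<otimes>\<^sub>M \<Delta> b)"

definition coproduct :: "('a::complex_algebra \<Rightarrow> 'a tensor2 multiplier) \<Rightarrow> bool" where
  "coproduct \<Delta> \<longleftrightarrow> algebra_hom \<Delta>
     \<and> (\<forall>a b. \<Delta> a * (1 \<otimes>\<^sub>M to_mult b) \<in> range to_mult)
     \<and> (\<forall>a b. (to_mult a \<otimes>\<^sub>M 1) * \<Delta> b \<in> range to_mult)
     \<and> (\<forall>a b c. (to_mult a \<otimes>\<^sub>M 1) * coproduct_id \<Delta> (T1 \<Delta> (b \<otimes> c))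
          = id_coproduct \<Delta> (T2 \<Delta> (a \<otimes> b)) * (1 \<otimes>\<^sub>M 1 \<otimes>\<^sub>M to_mult c))"

definition full_coproduct :: "('a::complex_algebra \<Rightarrow> 'a tensor2 multiplier) \<Rightarrow> bool" where
  "full_coproduct \<Delta> \<longleftrightarrow> coproduct \<Delta>
     \<and> \<Inter>{V. complex_vector.subspace V
           \<and> (\<forall>a b. T1 \<Delta> (a \<otimes> b) \<in> complex_vector.span {v \<otimes> x | v x. v \<in> V})} = UNIV
     \<and> \<Inter>{W. complex_vector.subspace W
           \<and> (\<forall>a b. T2 \<Delta> (a \<otimes> b) \<in> complex_vector.span {x \<otimes> w | x w. w \<in> W})} = UNIV"

definition counit :: "('a::complex_algebra \<Rightarrow> 'a tensor2 multiplier) \<Rightarrow> ('a \<Rightarrow> complex) \<Rightarrow> bool" where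
  "counit \<Delta> \<epsilon> \<longleftrightarrow> clinear \<epsilon>
     \<and> (\<forall>a b. tensor_lift (\<lambda>x y. \<epsilon> x *\<^sub>C y) (T1 \<Delta> (a \<otimes> b)) = a * b)
     \<and> (\<forall>a c. tensor_lift (\<lambda>x y. \<epsilon> y *\<^sub>C x) (T2 \<Delta> (c \<otimes> a)) = c * a)"


section \<open>Weak multiplier Hopf algebras\<close>

text \<open>The data \<open>\<epsilon>\<close>, \<open>E\<close>, \<open>G\<^sub>1\<close>, \<open>G\<^sub>2\<close> are determined by \<open>\<Delta>\<close>.\<close>

locale weak_multiplier_Hopf_algebra =
  fixes \<Delta> :: "'a::complex_algebra \<Rightarrow> 'a tensor2 multiplier"
    and \<epsilon> :: "'a \<Rightarrow> complex"
    and E :: "'a tensor2 multiplier"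
    and G\<^sub>1 G\<^sub>2 :: "'a tensor2 \<Rightarrow> 'a tensor2"
  assumes nondegenerate: "nondegenerate TYPE('a)"
    and idempotent: "idempotent TYPE('a)"
    and full_coproduct: "full_coproduct \<Delta>"
    and counit: "counit \<Delta> \<epsilon>"
    and E_idem: "E * E = E"
    and range_T1: "range (T1 \<Delta>) = range (lact E)"
    and range_T2: "range (T2 \<Delta>) = range (\<lambda>x. ract x E)"
    and id_coproduct_E: "mult_extension (id_coproduct \<Delta>) (1 \<otimes>\<^sub>M E) E = leg12 E * (1 \<otimes>\<^sub>M E)"
    and E_legs_commute: "leg12 E * (1 \<otimes>\<^sub>M E) = (1 \<otimes>\<^sub>M E) * leg12 E"
    and G1_linear: "clinear G\<^sub>1"
    and G1: "to_mult (tensor_assoc (tensor_map G\<^sub>1 id (inv tensor_assoc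
               (from_mult (leg13 (\<Delta> a) * (1 \<otimes>\<^sub>M to_mult (b \<otimes> c)))))))
             = leg13 (\<Delta> a) * (1 \<otimes>\<^sub>M E) * (1 \<otimes>\<^sub>M to_mult (b \<otimes> c))"
    and G2_linear: "clinear G\<^sub>2"
    and G2: "to_mult (tensor_map id G\<^sub>2
               (from_mult (leg12 (to_mult (a \<otimes> b)) * leg13 (\<Delta> c))))
             = leg12 (to_mult (a \<otimes> b)) * leg12 E * leg13 (\<Delta> c)"
    and kernel_T1: "{x. T1 \<Delta> x = 0} = range (\<lambda>x. x - G\<^sub>1 x)"
    and kernel_T2: "{x. T2 \<Delta> x = 0} = range (\<lambda>x. x - G\<^sub>2 x)"

text \<open>In the definition of the antipode \<open>R\<^sub>1 (a \<otimes> b)\<close> and \<open>R\<^sub>2 (a \<otimes> b)\<close> are the elements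
  \<open>\<Sum> a\<^sub>(\<^sub>1\<^sub>) \<otimes> S(a\<^sub>(\<^sub>2\<^sub>)) b\<close> and \<open>\<Sum> a S(b\<^sub>(\<^sub>1\<^sub>)) \<otimes> b\<^sub>(\<^sub>2\<^sub>)\<close> of \<open>A \<otimes> A\<close>, specified by covering the first,
  respectively the second, leg. The four equations for \<open>E\<close>, \<open>G\<^sub>1\<close>, \<open>G\<^sub>2\<close> in Sweedler notation are then
  \<open>E (a \<otimes> b) = \<Sum> a\<^sub>(\<^sub>1\<^sub>) \<otimes> a\<^sub>(\<^sub>2\<^sub>) S(a\<^sub>(\<^sub>3\<^sub>)) b\<close>, \<open>(a \<otimes> b) E = \<Sum> a S(b\<^sub>(\<^sub>1\<^sub>)) b\<^sub>(\<^sub>2\<^sub>) \<otimes> b\<^sub>(\<^sub>3\<^sub>)\<close>,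
  \<open>G\<^sub>1 (a \<otimes> b) = \<Sum> a\<^sub>(\<^sub>1\<^sub>) \<otimes> S(a\<^sub>(\<^sub>2\<^sub>)) a\<^sub>(\<^sub>3\<^sub>) b\<close> and \<open>G\<^sub>2 (a \<otimes> b) = \<Sum> a b\<^sub>(\<^sub>1\<^sub>) S(b\<^sub>(\<^sub>2\<^sub>)) \<otimes> b\<^sub>(\<^sub>3\<^sub>)\<close>; the last equation is
  \<open>\<Sum> S(a\<^sub>(\<^sub>1\<^sub>)) a\<^sub>(\<^sub>2\<^sub>) S(a\<^sub>(\<^sub>3\<^sub>)) b = S(a) b\<close>.\<close>

definition antipode ::
  "('a::complex_algebra \<Rightarrow> 'a tensor2 multiplier) \<Rightarrow> 'a tensor2 multiplier \<Rightarrow> ('a tensor2 \<Rightarrow> 'a tensor2) \<Rightarrow>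
   ('a tensor2 \<Rightarrow> 'a tensor2) \<Rightarrow> ('a \<Rightarrow> 'a multiplier) \<Rightarrow> bool" where
  "antipode \<Delta> E G\<^sub>1 G\<^sub>2 S \<longleftrightarrow> algebra_antihom S
     \<and> complex_vector.span {lact (S a) b | a b. True} = UNIV
     \<and> complex_vector.span {ract b (S a) | a b. True} = UNIV
     \<and> (\<exists>R\<^sub>1 R\<^sub>2. clinear R\<^sub>1 \<and> clinear R\<^sub>2
         \<and> (\<forall>a b c. (to_mult c \<otimes>\<^sub>M 1) * to_mult (R\<^sub>1 (a \<otimes> b))
              = tensor_lift (\<lambda>x y. to_mult x \<otimes>\<^sub>M S y) (T2 \<Delta> (c \<otimes> a)) * (1 \<otimes>\<^sub>M to_mult b))
         \<and> (\<forall>a b c. to_mult (R\<^sub>2 (a \<otimes> b)) * (1 \<otimes>\<^sub>M to_mult c)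
              = (to_mult a \<otimes>\<^sub>M 1) * tensor_lift (\<lambda>x y. S x \<otimes>\<^sub>M to_mult y) (T1 \<Delta> (b \<otimes> c)))
         \<and> (\<forall>a b. lact E (a \<otimes> b) = T1 \<Delta> (R\<^sub>1 (a \<otimes> b)))
         \<and> (\<forall>a b. ract (a \<otimes> b) E = T2 \<Delta> (R\<^sub>2 (a \<otimes> b)))
         \<and> (\<forall>a b. G\<^sub>1 (a \<otimes> b) = R\<^sub>1 (T1 \<Delta> (a \<otimes> b)))
         \<and> (\<forall>a b. G\<^sub>2 (a \<otimes> b) = R\<^sub>2 (T2 \<Delta> (a \<otimes> b)))
         \<and> (\<forall>a b. tensor_lift (\<lambda>x y. lact (S x) y) (T1 \<Delta> (R\<^sub>1 (a \<otimes> b))) = lact (S a) b))"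

locale regular_weak_multiplier_Hopf_algebra = weak_multiplier_Hopf_algebra +
  fixes S :: "'a::complex_algebra \<Rightarrow> 'a multiplier"
  assumes antipode: "antipode \<Delta> E G\<^sub>1 G\<^sub>2 S"
    and regular: "bij_betw S UNIV (range to_mult)"

text \<open>\<open>target_counit \<Delta> S a\<close> is \<open>\<epsilon>\<^sub>t(a) = \<Sum> a\<^sub>(\<^sub>1\<^sub>) S(a\<^sub>(\<^sub>2\<^sub>))\<close>, the multiplier with
  \<open>b \<epsilon>\<^sub>t(a) = \<Sum> b a\<^sub>(\<^sub>1\<^sub>) S(a\<^sub>(\<^sub>2\<^sub>))\<close> for all \<open>b\<close>.\<close>

definition target_counit ::
  "('a::complex_algebra \<Rightarrow> 'a tensor2 multiplier) \<Rightarrow> ('a \<Rightarrow> 'a multiplier) \<Rightarrow> 'a \<Rightarrow> 'a multiplier" where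
  "target_counit \<Delta> S a =
     (THE m. \<forall>b. to_mult b * m = tensor_lift (\<lambda>x y. to_mult x * S y) (T2 \<Delta> (b \<otimes> a)))"


section \<open>Cointegrals\<close>

text \<open>The slices \<open>(id \<otimes> f) d\<close> and \<open>(f \<otimes> id) d\<close>, defined for \<open>d \<in> M(A \<otimes> A)\<close> such that the products
  below lie in \<open>A \<otimes> A\<close>; in the regular case this holds for \<open>d = \<Delta>(a)\<close>.\<close>

definition slice_id_f :: "('a::complex_algebra \<Rightarrow> complex) \<Rightarrow> 'a tensor2 multiplier \<Rightarrow> 'a multiplier" where
  "slice_id_f f d = (THE m. \<forall>b.
     lact m b = tensor_lift (\<lambda>x y. f y *\<^sub>C x) (from_mult (d * (to_mult b \<otimes>\<^sub>M 1))) \<and>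
     ract b m = tensor_lift (\<lambda>x y. f y *\<^sub>C x) (from_mult ((to_mult b \<otimes>\<^sub>M 1) * d)))"

definition slice_f_id :: "('a::complex_algebra \<Rightarrow> complex) \<Rightarrow> 'a tensor2 multiplier \<Rightarrow> 'a multiplier" where
  "slice_f_id f d = (THE m. \<forall>b.
     lact m b = tensor_lift (\<lambda>x y. f x *\<^sub>C y) (from_mult (d * (1 \<otimes>\<^sub>M to_mult b))) \<and>
     ract b m = tensor_lift (\<lambda>x y. f x *\<^sub>C y) (from_mult ((1 \<otimes>\<^sub>M to_mult b) * d)))"

definition left_cointegral ::
  "('a::complex_algebra \<Rightarrow> 'a tensor2 multiplier) \<Rightarrow> ('a \<Rightarrow> 'a multiplier) \<Rightarrow> 'a multiplier \<Rightarrow> bool" where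
  "left_cointegral \<Delta> S h \<longleftrightarrow> h \<noteq> 0 \<and> (\<forall>a. to_mult a * h = target_counit \<Delta> S a * h)"

definition faithful_cointegral :: "('a::complex_algebra \<Rightarrow> 'a tensor2 multiplier) \<Rightarrow> 'a \<Rightarrow> bool" where
  "faithful_cointegral \<Delta> h \<longleftrightarrow>
     (\<forall>f. clinear f \<longrightarrow> slice_id_f f (\<Delta> h) = 0 \<or> slice_f_id f (\<Delta> h) = 0 \<longrightarrow> f = (\<lambda>_. 0))"


section \<open>Frobenius algebras\<close>

text \<open>The left module structure on the dual space is \<open>(a \<omega>)(b) = \<omega>(b a)\<close>.\<close>

definition dual_act :: "'a::complex_algebra \<Rightarrow> ('a \<Rightarrow> complex) \<Rightarrow> 'a \<Rightarrow> complex" where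
  "dual_act a \<omega> = (\<lambda>b. \<omega> (b * a))"

definition reduced_dual :: "('a::complex_algebra \<Rightarrow> complex) set" where
  "reduced_dual = {dual_act a \<omega> | a \<omega>. clinear \<omega>}"

text \<open>Linearity of \<open>\<phi>\<close> with respect to the pointwise vector space structure on functionals is
  expressed by linearity of \<open>\<lambda>a. \<phi> a b\<close> for each \<open>b\<close>.\<close>

definition frobenius :: "'a::complex_algebra itself \<Rightarrow> bool" where
  "frobenius _ \<longleftrightarrow> (\<exists>\<phi> :: 'a \<Rightarrow> 'a \<Rightarrow> complex. (\<forall>b. clinear (\<lambda>a. \<phi> a b))
     \<and> (\<forall>a x. \<phi> (a * x) = dual_act a (\<phi> x)) \<and> bij_betw \<phi> UNIV reduced_dual)"

end

theory Submission
  imports Defs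
begin

text \<open>The proof rests on one identity for a left cointegral \<open>h \<in> A\<close>, lemma \<open>cointegral_move\<close>:
  \<open>(1 \<otimes> p) \<Delta>(h) = (S(p) \<otimes> 1) \<Delta>(h)\<close>. It turns slicing of \<open>\<Delta>(h)\<close> into a module map. For a functional \<open>\<theta>\<close>
  put \<open>x\<^sub>\<theta> = (\<theta> S\<inverse> \<otimes> id) \<Delta>(h)\<close>, a multiplier of \<open>A\<close>; then \<open>x\<^bsub>a \<theta>\<^esub> = a x\<^sub>\<theta>\<close>, where \<open>a \<theta> = \<theta>(\<cdot> a)\<close>. The
  multiplier \<open>x\<^bsub>a \<theta>\<^esub>\<close> lies in \<open>A\<close>, because it is a slice of \<open>(S(a) \<otimes> 1) \<Delta>(h) \<in> A \<otimes> A\<close>. Faithfulness is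
  used twice: non-degeneracy of one slice makes \<open>\<theta> \<mapsto> x\<^sub>\<theta>\<close> injective, and non-degeneracy of the other one
  says that no non-zero functional vanishes on all \<open>x\<^bsub>a \<theta>\<^esub>\<close>, so that these elements span \<open>A\<close>. Hence
  every \<open>x \<in> A\<close> is \<open>x\<^sub>\<theta>\<close> for exactly one functional \<open>\<theta>\<close>, and \<open>\<phi> : x \<mapsto> \<theta>\<close> is an injective module map from
  \<open>A\<close> onto the linear span of \<open>{a \<theta>}\<close>.

  It remains to see that \<open>\<phi>(x)\<close> is itself of the form \<open>a \<theta>\<close>, that is, that the set \<open>A A'\<close> is its own
  span. This follows from the existence of local units, lemma \<open>left_local_unit\<close>: if \<open>u x = x\<close>, then
  \<open>\<phi>(x) = u \<phi>(x)\<close>. To find \<open>u\<close>, write \<open>E = \<Sum> E\<^sub>1 \<otimes> E\<^sub>2\<close> and recall that \<open>\<Sum> S(E\<^sub>1) E\<^sub>2 = 1\<close>. The second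
  leg of \<open>E (p \<otimes> x) = \<Sum> p\<^sub>(\<^sub>1\<^sub>) \<otimes> p\<^sub>(\<^sub>2\<^sub>) S(p\<^sub>(\<^sub>3\<^sub>)) x\<close> lies in \<open>A x\<close>. If in addition \<open>E (1 \<otimes> x)\<close> is a
  finite sum \<open>\<Sum> m\<^sub>j \<otimes> r\<^sub>j x\<close> with multipliers \<open>m\<^sub>j\<close>, then \<open>x = \<Sum> S(m\<^sub>j) r\<^sub>j x\<close> and \<open>u = \<Sum> S(m\<^sub>j) r\<^sub>j\<close> is
  as required. The finiteness again comes from the cointegral: for a slice \<open>x = (\<omega> \<otimes> id) (\<Delta>(h) (c \<otimes> 1))\<close>
  with \<open>\<Delta>(h) (c \<otimes> 1) = \<Sum> S(p\<^sub>j) \<otimes> q\<^sub>j\<close>, a finite sum, the identity above gives \<open>E (1 \<otimes> x) = \<Sum> m\<^sub>j \<otimes> q\<^sub>j\<close>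
  with \<open>m\<^sub>j = (id \<otimes> \<omega> S) ((1 \<otimes> p\<^sub>j) E)\<close>, and such slices span \<open>A\<close>.

  The identity itself is \<open>\<Sum> S(p\<^sub>(\<^sub>1\<^sub>)) p\<^sub>(\<^sub>2\<^sub>) h\<^sub>(\<^sub>1\<^sub>) \<otimes> p\<^sub>(\<^sub>3\<^sub>) h\<^sub>(\<^sub>2\<^sub>)\<close> computed in two ways. On the
  one hand \<open>\<Sum> S(p\<^sub>(\<^sub>1\<^sub>)) p\<^sub>(\<^sub>2\<^sub>) \<otimes> p\<^sub>(\<^sub>3\<^sub>) = (1 \<otimes> p) E\<close> and \<open>E \<Delta>(h) = \<Delta>(h)\<close>. On the other hand
  \<open>p h = \<epsilon>\<^sub>t(p) h\<close> yields \<open>\<Sum> p\<^sub>(\<^sub>1\<^sub>) \<otimes> p\<^sub>(\<^sub>2\<^sub>) h = E (p \<otimes> h)\<close>, the axiom \<open>(id \<otimes> \<Delta>) E = (E \<otimes> 1) (1 \<otimes> E)\<close>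
  evaluates \<open>(id \<otimes> \<Delta>) (E (p \<otimes> h))\<close> as \<open>(E \<otimes> 1) (p \<otimes> \<Delta>(h))\<close>, and contracting the first two legs with
  \<open>\<Sum> S(E\<^sub>1) E\<^sub>2 = 1\<close> leaves \<open>(S(p) \<otimes> 1) \<Delta>(h)\<close>. The Sweedler sums stand for elements of tensor products
  only after multiplication by covering factors; each step is therefore proved in a covered form, and
  the covering factors are cancelled by non-degeneracy.\<close>

section \<open>Slices of tensors\<close>

lemma clinear_ident: "clinear (\<lambda>x. x)"
  by (simp add: clinear_iff)

lemma clinear_compose: "clinear g \<Longrightarrow> clinear f \<Longrightarrow> clinear (\<lambda>x. g (f x))"
  by (simp add: clinear_iff)

lemma clinear_tens: "clinear f \<Longrightarrow> clinear (\<lambda>x. f x \<otimes> y)" "clinear g \<Longrightarrow> clinear (\<lambda>x. y \<otimes> g x)"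
  by (simp_all add: clinear_iff tens_bilinear)

lemma clinear_lact: "clinear f \<Longrightarrow> clinear (\<lambda>x. lact m (f x))"
  and clinear_ract: "clinear f \<Longrightarrow> clinear (\<lambda>x. ract (f x) m)"
  using lact(1)[of m] ract(1)[of m] by (simp_all add: clinear_iff)

lemma clinear_mult_compose:
  "clinear f \<Longrightarrow> clinear (\<lambda>x. a * f x)" "clinear f \<Longrightarrow> clinear (\<lambda>x. f x * a)"
  for a :: "'a::complex_algebra"
  by (simp_all add: clinear_iff mult_scaleC_left mult_scaleC_right algebra_simps)

lemma clinear_scaleC_left: "clinear f \<Longrightarrow> clinear (\<lambda>x. f x *\<^sub>C y)" for f :: "_ \<Rightarrow> complex"
  by (simp add: clinear_iff scaleC_add_left scaleC_scaleC)

lemma clinear_scaleC_right: "clinear f \<Longrightarrow> clinear (\<lambda>x. c *\<^sub>C f x)"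
  by (simp add: clinear_iff scaleC_add_right scaleC_scaleC mult.commute)

lemma clinear_tensor_map: "clinear f \<Longrightarrow> clinear g \<Longrightarrow> clinear h \<Longrightarrow> clinear (\<lambda>x. tensor_map f g (h x))"
  by (rule clinear_compose[OF tensor_map(1)])

lemmas clinear_intros = clinear_ident clinear_tens clinear_lact clinear_ract clinear_mult_compose
  clinear_scaleC_left clinear_scaleC_right clinear_tensor_map

lemma clinear_sum: "clinear f \<Longrightarrow> f (sum g I) = (\<Sum>i\<in>I. f (g i))"
  by (induction I rule: infinite_finite_induct) (simp_all add: clinearD)

definition slice_first :: "('a::complex_vector \<Rightarrow> complex) \<Rightarrow> ('a, 'b::complex_vector) tensor \<Rightarrow> 'b" where
  "slice_first f = tensor_lift (\<lambda>x y. f x *\<^sub>C y)"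

definition slice_second :: "('b::complex_vector \<Rightarrow> complex) \<Rightarrow> ('a::complex_vector, 'b) tensor \<Rightarrow> 'a" where
  "slice_second f = tensor_lift (\<lambda>x y. f y *\<^sub>C x)"

lemma slice_first:
  assumes "clinear f"
  shows "clinear (slice_first f)" "slice_first f (x \<otimes> y) = f x *\<^sub>C y"
proof -
  have "cbilinear (\<lambda>x y. f x *\<^sub>C y)"
    unfolding cbilinear_def using assms by (intro conjI allI clinear_intros)
  from clinear_tensor_lift[OF this] tensor_lift_tens[OF this]
  show "clinear (slice_first f)" "slice_first f (x \<otimes> y) = f x *\<^sub>C y"
    by (simp_all add: slice_first_def)
qed

lemma slice_second:
  assumes "clinear f"
  shows "clinear (slice_second f)" "slice_second f (x \<otimes> y) = f y *\<^sub>C x"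
proof -
  have "cbilinear (\<lambda>x y. f y *\<^sub>C x)"
    unfolding cbilinear_def using assms by (intro conjI allI clinear_intros)
  from clinear_tensor_lift[OF this] tensor_lift_tens[OF this]
  show "clinear (slice_second f)" "slice_second f (x \<otimes> y) = f y *\<^sub>C x"
    by (simp_all add: slice_second_def)
qed

lemma clinear_slices:
  "clinear f \<Longrightarrow> clinear h \<Longrightarrow> clinear (\<lambda>x. slice_first f (h x))"
  "clinear g \<Longrightarrow> clinear k \<Longrightarrow> clinear (\<lambda>x. slice_second g (k x))"
  by (rule clinear_compose[OF slice_first(1)] clinear_compose[OF slice_second(1)]; assumption)+

lemmas clinear_slice_intros = clinear_intros clinear_slices slice_first(1) slice_second(1)

lemma slice_first_map:
  assumes "clinear f" "clinear F" "clinear G"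
  shows "slice_first f (tensor_map F G w) = G (slice_first (\<lambda>x. f (F x)) w)"
proof (rule clinear_eq_tensor)
  have c: "clinear (\<lambda>x. f (F x))" by (rule clinear_compose) (fact assms)+
  show "clinear (\<lambda>w. slice_first f (tensor_map F G w))"
    by (rule clinear_slices(1)[OF assms(1) tensor_map(1)[OF assms(2,3)]])
  show "clinear (\<lambda>w. G (slice_first (\<lambda>x. f (F x)) w))"
    by (intro clinear_slice_intros clinear_compose[OF assms(3)] assms c)
  show "slice_first f (tensor_map F G (x \<otimes> y)) = G (slice_first (\<lambda>x. f (F x)) (x \<otimes> y))" for x y
    by (simp add: slice_first assms c tensor_map clinearD(2)[OF assms(3)])
qed

lemma slice_second_map:
  assumes "clinear f" "clinear F" "clinear G"
  shows "slice_second f (tensor_map F G w) = F (slice_second (\<lambda>y. f (G y)) w)"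
proof (rule clinear_eq_tensor)
  have c: "clinear (\<lambda>y. f (G y))" by (rule clinear_compose) (fact assms)+
  show "clinear (\<lambda>w. slice_second f (tensor_map F G w))"
    by (rule clinear_slices(2)[OF assms(1) tensor_map(1)[OF assms(2,3)]])
  show "clinear (\<lambda>w. F (slice_second (\<lambda>y. f (G y)) w))"
    by (intro clinear_slice_intros clinear_compose[OF assms(2)] assms c)
  show "slice_second f (tensor_map F G (x \<otimes> y)) = F (slice_second (\<lambda>y. f (G y)) (x \<otimes> y))" for x y
    by (simp add: slice_second assms c tensor_map clinearD(2)[OF assms(2)])
qed

lemma slice_first_linear:
  assumes "clinear f" "clinear g"
  shows "slice_first (\<lambda>x. f x + g x) w = slice_first f w + slice_first g w"
    "slice_first (\<lambda>x. c * f x) w = c *\<^sub>C slice_first f w"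
proof -
  have c: "clinear (\<lambda>x. f x + g x)" "clinear (\<lambda>x. c * f x)"
    using assms by (auto simp: clinear_iff algebra_simps)
  show "slice_first (\<lambda>x. f x + g x) w = slice_first f w + slice_first g w"
    by (induction w) (simp_all add: slice_first(2)[OF c(1)] slice_first(2)[OF assms(1)] slice_first(2)[OF assms(2)]
      clinearD(1)[OF slice_first(1)[OF c(1)]] clinearD(1)[OF slice_first(1)[OF assms(1)]]
      clinearD(1)[OF slice_first(1)[OF assms(2)]] scaleC_add_left)
  show "slice_first (\<lambda>x. c * f x) w = c *\<^sub>C slice_first f w"
    by (induction w) (simp_all add: slice_first(2)[OF c(2)] slice_first(2)[OF assms(1)]
      clinearD(1)[OF slice_first(1)[OF c(2)]] clinearD(1)[OF slice_first(1)[OF assms(1)]] scaleC_add_right scaleC_scaleC)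
qed

lemma slice_slice:
  assumes "clinear f" "clinear g"
  shows "g (slice_first f w) = f (slice_second g w)"
proof (rule clinear_eq_tensor[of "\<lambda>w. g (slice_first f w)"])
  show "clinear (\<lambda>w. g (slice_first f w))" by (intro clinear_slice_intros clinear_compose[OF assms(2)] assms)
  show "clinear (\<lambda>w. f (slice_second g w))" by (intro clinear_slice_intros clinear_compose[OF assms(1)] assms)
qed (simp add: slice_first slice_second assms clinearD(2)[OF assms(1)] clinearD(2)[OF assms(2)])

lemma clinear_representation:
  assumes "complex_vector.independent B" "complex_vector.span B = UNIV"
  shows "clinear (\<lambda>v. complex_vector.representation B v b)"
  using assms
  by (simp add: clinear_iff complex_vector.representation_add complex_vector.representation_scale)

text \<open>Allowing every larger finite index set makes the claim additive in \<open>w\<close>, which the induction needs.\<close>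

lemma tensor_basis_expansion:
  fixes w :: "('a::complex_vector, 'b::complex_vector) tensor"
  assumes B: "complex_vector.independent B" "complex_vector.span B = UNIV"
  shows "\<exists>H. finite H \<and> H \<subseteq> B \<and> (\<forall>H'. finite H' \<and> H \<subseteq> H' \<longrightarrow>
    w = (\<Sum>b\<in>H'. slice_second (\<lambda>v. complex_vector.representation B v b) w \<otimes> b))"
proof (induction w)
  case (tens x y)
  let ?r = "complex_vector.representation B y"
  let ?H = "{b. ?r b \<noteq> 0}"
  have "x \<otimes> y = (\<Sum>b\<in>H'. slice_second (\<lambda>v. complex_vector.representation B v b) (x \<otimes> y) \<otimes> b)"
    if "finite H'" "?H \<subseteq> H'" for H'
  proof -
    have "(\<Sum>b\<in>H'. ?r b *\<^sub>C b) = (\<Sum>b | ?r b \<noteq> 0. ?r b *\<^sub>C b)"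
      by (rule sum.mono_neutral_right) (use that in auto)
    also have "\<dots> = y"
      by (rule complex_vector.sum_nonzero_representation_eq[OF B(1)]) (simp add: B(2))
    finally have "x \<otimes> y = x \<otimes> (\<Sum>b\<in>H'. ?r b *\<^sub>C b)" by simp
    also have "\<dots> = (\<Sum>b\<in>H'. x \<otimes> (?r b *\<^sub>C b))"
      by (rule clinear_sum) (intro clinear_intros)
    finally show ?thesis
      unfolding slice_second(2)[OF clinear_representation[OF B]] tens_bilinear .
  qed
  moreover have "finite ?H" by (rule complex_vector.finite_representation)
  moreover have "?H \<subseteq> B" using complex_vector.representation_ne_zero by blast
  ultimately show ?case by blast
next
  case (add s t)
  let ?c = "\<lambda>b v. complex_vector.representation B v b"
  from add obtain H K where H: "finite H" "H \<subseteq> B" and K: "finite K" "K \<subseteq> B"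
    and s: "\<forall>H'. finite H' \<and> H \<subseteq> H' \<longrightarrow> s = (\<Sum>b\<in>H'. slice_second (?c b) s \<otimes> b)"
    and t: "\<forall>H'. finite H' \<and> K \<subseteq> H' \<longrightarrow> t = (\<Sum>b\<in>H'. slice_second (?c b) t \<otimes> b)"
    by (elim exE conjE)
  have "s + t = (\<Sum>b\<in>H'. slice_second (?c b) (s + t) \<otimes> b)" if "finite H'" "H \<union> K \<subseteq> H'" for H'
  proof -
    have "s = (\<Sum>b\<in>H'. slice_second (?c b) s \<otimes> b)" "t = (\<Sum>b\<in>H'. slice_second (?c b) t \<otimes> b)"
      using s[rule_format, of H'] t[rule_format, of H'] that by auto
    then have "s + t = (\<Sum>b\<in>H'. slice_second (?c b) s \<otimes> b) + (\<Sum>b\<in>H'. slice_second (?c b) t \<otimes> b)"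
      by (rule arg_cong2[where f="(+)"])
    then show ?thesis
      unfolding clinearD(1)[OF slice_second(1)[OF clinear_representation[OF B]]] tens_bilinear(1) sum.distrib .
  qed
  then show ?case
    using H K by (intro exI[of _ "H \<union> K"]) simp
qed

lemma slices_second_eq_0:
  assumes "\<And>f. clinear f \<Longrightarrow> slice_second f w = 0"
  shows "w = 0"
proof -
  let ?B = "complex_vector.extend_basis {}"
  have B: "complex_vector.independent ?B" "complex_vector.span ?B = UNIV"
    by (simp_all add: complex_vector.independent_extend_basis complex_vector.span_extend_basis
        complex_vector.independent_empty)
  obtain H where H: "w = (\<Sum>b\<in>H. slice_second (\<lambda>v. complex_vector.representation ?B v b) w \<otimes> b)"
    using tensor_basis_expansion[OF B, of w] by (elim exE conjE allE impE) (rule conjI, assumption, rule order_refl)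
  show ?thesis
    by (subst H) (simp add: assms[OF clinear_representation[OF B]] clinearD(3)[OF clinear_tens(1)[OF clinear_ident]])
qed

lemma slices_first_eq_0:
  fixes w :: "('a::complex_vector, 'b::complex_vector) tensor"
  assumes "\<And>f. clinear f \<Longrightarrow> slice_first f w = 0"
  shows "w = 0"
proof -
  have "slice_second f (tensor_flip w) = slice_first f w" if f: "clinear f" for f :: "'a \<Rightarrow> complex"
    by (rule clinear_eq_tensor[OF clinear_slices(2)[OF f tensor_flip(1)] slice_first(1)[OF f]])
       (simp add: f slice_first slice_second tensor_flip)
  then have "tensor_flip w = 0"
    by (intro slices_second_eq_0) (simp add: assms)
  then show ?thesis
    by (metis clinearD(3) tensor_flip(1) tensor_flip_flip)
qed

text \<open>Slicing the second leg commutes with maps acting on the first leg, so a jointly injective family stays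
  jointly injective after tensoring. With \<open>F c\<close> a multiplication by \<open>c\<close>, this cancels covering factors.\<close>

lemma tensor_map_first_cancel:
  fixes w :: "('a::complex_vector, 'b::complex_vector) tensor"
  assumes "\<And>c. clinear (F c)" "\<And>x. (\<And>c. F c x = 0) \<Longrightarrow> x = 0" "\<And>c. tensor_map (F c) (\<lambda>x. x) w = 0"
  shows "w = 0"
proof (rule slices_second_eq_0)
  fix f :: "'b \<Rightarrow> complex" assume f: "clinear f"
  have "F c (slice_second f w) = 0" for c
    using slice_second_map[OF f assms(1) clinear_ident, of c w]
    by (simp add: assms(3) clinearD(3)[OF slice_second(1)[OF f]])
  then show "slice_second f w = 0" by (rule assms(2))
qed

lemma tensor_map_second_cancel:
  fixes w :: "('a::complex_vector, 'b::complex_vector) tensor"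
  assumes "\<And>c. clinear (F c)" "\<And>x. (\<And>c. F c x = 0) \<Longrightarrow> x = 0" "\<And>c. tensor_map (\<lambda>x. x) (F c) w = 0"
  shows "w = 0"
proof (rule slices_first_eq_0)
  fix f :: "'a \<Rightarrow> complex" assume f: "clinear f"
  have "F c (slice_first f w) = 0" for c
    using slice_first_map[OF f clinear_ident assms(1), of c w]
    by (simp add: assms(3) clinearD(3)[OF slice_first(1)[OF f]])
  then show "slice_first f w = 0" by (rule assms(2))
qed

lemma tensor_map_diff:
  assumes "clinear f" "clinear g" "tensor_map f g v = tensor_map f g w"
  shows "tensor_map f g (v - w) = 0"
  using assms by (simp add: clinearD[OF tensor_map(1)])

text \<open>If the span were proper, a basis of it could be extended by a vector whose coordinate functional
  vanishes on \<open>X\<close>.\<close>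

lemma span_eq_UNIV_functional:
  fixes X :: "'a::complex_vector set"
  assumes "\<And>f. clinear f \<Longrightarrow> (\<And>x. x \<in> X \<Longrightarrow> f x = 0) \<Longrightarrow> f = (\<lambda>_. 0 :: complex)"
  shows "complex_vector.span X = UNIV"
proof (rule ccontr)
  assume "complex_vector.span X \<noteq> UNIV"
  obtain B where B: "B \<subseteq> X" "complex_vector.independent B" "X \<subseteq> complex_vector.span B"
    using complex_vector.basis_exists by metis
  let ?C = "complex_vector.extend_basis B"
  have C: "B \<subseteq> ?C" "complex_vector.independent ?C" "complex_vector.span ?C = UNIV"
    by (simp_all add: B(2) complex_vector.extend_basis_superset complex_vector.independent_extend_basis
        complex_vector.span_extend_basis)
  obtain b where b: "b \<in> ?C" "b \<notin> B"
  proof -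
    have "\<not> ?C \<subseteq> B"
    proof
      assume "?C \<subseteq> B"
      then have "complex_vector.span ?C \<subseteq> complex_vector.span X"
        using B(1) by (intro complex_vector.span_mono) auto
      then show False using C(3) \<open>complex_vector.span X \<noteq> UNIV\<close> by auto
    qed
    then show thesis using that by auto
  qed
  have "complex_vector.representation ?C x b = 0" if "x \<in> X" for x
  proof -
    have "complex_vector.representation ?C x = complex_vector.representation B x"
      by (rule complex_vector.representation_extend[OF C(2) _ C(1)]) (use B(3) that in auto)
    then show ?thesis using b(2) complex_vector.representation_ne_zero[of B x b] by auto
  qed
  then have "(\<lambda>x. complex_vector.representation ?C x b) = (\<lambda>_. 0)"
    by (intro assms clinear_representation C)
  then have "complex_vector.representation ?C b b = 0" by (rule fun_cong)
  then show False by (simp add: complex_vector.representation_basis[OF C(2) b(1)])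
qed

lemma functionals_separate:
  fixes x :: "'a::complex_vector"
  assumes "\<And>f. clinear f \<Longrightarrow> f x = (0 :: complex)"
  shows "x = 0"
proof (rule ccontr)
  assume "x \<noteq> 0"
  then have x: "complex_vector.independent {x}" by simp
  let ?B = "complex_vector.extend_basis {x}"
  have B: "complex_vector.independent ?B" "complex_vector.span ?B = UNIV" "x \<in> ?B"
    using complex_vector.extend_basis_superset[OF x]
    by (simp_all add: complex_vector.independent_extend_basis[OF x] complex_vector.span_extend_basis[OF x])
  show False
    using assms[OF clinear_representation[OF B(1,2), of x]] by (simp add: complex_vector.representation_basis[OF B(1,3)])
qed

lemma slice_second_zero:
  fixes w :: "('a::complex_vector, 'b::complex_vector) tensor"
  shows "slice_second (\<lambda>_. 0) w = 0"
proof -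
  have c: "clinear (\<lambda>_ :: 'b. 0 :: complex)" by (simp add: clinear_iff)
  show ?thesis
    by (induction w) (simp_all add: slice_second(2)[OF c] clinearD(1)[OF slice_second(1)[OF c]])
qed

lemma finite_second_leg:
  fixes w :: "('a::complex_vector, 'b::complex_vector) tensor"
  shows "\<exists>F. finite F \<and> (\<forall>f. clinear f \<longrightarrow> (\<forall>y\<in>F. f y = 0) \<longrightarrow> slice_second f w = 0)"
proof (induction w)
  case (tens x y)
  have "slice_second f (x \<otimes> y) = 0" if "clinear f" "f y = 0" for f :: "'b \<Rightarrow> complex"
    by (simp add: slice_second(2)[OF that(1)] that(2))
  then show ?case by (intro exI[of _ "{y}"]) blast
next
  case (add s t)
  then obtain F G where "finite F" "finite G"
    and F: "\<forall>f. clinear f \<longrightarrow> (\<forall>y\<in>F. f y = 0) \<longrightarrow> slice_second f s = 0"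
    and G: "\<forall>f. clinear f \<longrightarrow> (\<forall>y\<in>G. f y = 0) \<longrightarrow> slice_second f t = 0"
    by (elim exE conjE)
  show ?case
  proof (rule exI[of _ "F \<union> G"], intro conjI allI impI)
    show "finite (F \<union> G)" using \<open>finite F\<close> \<open>finite G\<close> by simp
    fix f :: "'b \<Rightarrow> complex" assume f: "clinear f" "\<forall>y\<in>F \<union> G. f y = 0"
    then have "slice_second f s = 0" "slice_second f t = 0" using F G by blast+
    then show "slice_second f (s + t) = 0" by (simp add: clinearD(1)[OF slice_second(1)[OF f(1)]])
  qed
qed

text \<open>Extend a basis of \<open>X\<close> to the whole space. A coordinate belonging to a basis vector outside \<open>X\<close> vanishes
  on \<open>X\<close>, and all but finitely many coordinates vanish on \<open>F\<close>, so both kinds of terms drop out of the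
  expansion of \<open>w\<close>. The index set \<open>B\<close> does not depend on \<open>w\<close>: one expansion serves a whole family of
  tensors.\<close>

lemma finite_expansion_in_subspace:
  fixes F X :: "'b::complex_vector set"
  assumes F: "finite F" and X: "complex_vector.subspace X"
  shows "\<exists>B \<beta>. finite B \<and> B \<subseteq> X \<and> (\<forall>b\<in>B. clinear (\<beta> b)) \<and>
    (\<forall>w :: ('a::complex_vector, 'b) tensor.
      (\<forall>f. clinear f \<longrightarrow> (\<forall>y\<in>F. f y = 0) \<longrightarrow> slice_second f w = 0) \<longrightarrow>
      (\<forall>f. clinear f \<longrightarrow> (\<forall>y\<in>X. f y = 0) \<longrightarrow> slice_second f w = 0) \<longrightarrow>
      w = (\<Sum>b\<in>B. slice_second (\<beta> b) w \<otimes> b))"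
proof -
  obtain B where B: "B \<subseteq> X" "complex_vector.independent B" "X \<subseteq> complex_vector.span B"
    using complex_vector.basis_exists by metis
  let ?C = "complex_vector.extend_basis B"
  have C: "B \<subseteq> ?C" "complex_vector.independent ?C" "complex_vector.span ?C = UNIV"
    by (simp_all add: B(2) complex_vector.extend_basis_superset complex_vector.independent_extend_basis
        complex_vector.span_extend_basis)
  define \<beta> where "\<beta> b v = complex_vector.representation ?C v b" for b v
  have \<beta>: "clinear (\<beta> b)" for b
    unfolding \<beta>_def[abs_def] by (rule clinear_representation[OF C(2,3)])
  have \<beta>_X: "\<beta> b x = 0" if "x \<in> X" "b \<notin> B" for b x
  proof -
    have "complex_vector.representation ?C x = complex_vector.representation B x"
      by (rule complex_vector.representation_extend[OF C(2) _ C(1)]) (use B(3) that in auto)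
    then show ?thesis using that(2) complex_vector.representation_ne_zero[of B x b] by (auto simp: \<beta>_def)
  qed
  define G where "G = (\<Union>y\<in>F. {b. \<beta> b y \<noteq> 0})"
  have G: "finite G"
    unfolding G_def \<beta>_def using F complex_vector.finite_representation by auto
  have "w = (\<Sum>b\<in>G \<inter> B. slice_second (\<beta> b) w \<otimes> b)"
    if wF: "\<forall>f. clinear f \<longrightarrow> (\<forall>y\<in>F. f y = 0) \<longrightarrow> slice_second f w = 0"
      and wX: "\<forall>f. clinear f \<longrightarrow> (\<forall>y\<in>X. f y = 0) \<longrightarrow> slice_second f w = 0" for w :: "('a, 'b) tensor"
  proof -
    obtain H where H: "finite H" and HH: "\<forall>H'. finite H' \<and> H \<subseteq> H' \<longrightarrow> w = (\<Sum>b\<in>H'. slice_second (\<beta> b) w \<otimes> b)"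
      using tensor_basis_expansion[OF C(2,3), of w] unfolding \<beta>_def by (elim exE conjE)
    have "(\<Sum>b\<in>H \<union> (G \<inter> B). slice_second (\<beta> b) w \<otimes> b) = (\<Sum>b\<in>G \<inter> B. slice_second (\<beta> b) w \<otimes> b)"
    proof (rule sum.mono_neutral_right)
      show "\<forall>b\<in>H \<union> G \<inter> B - G \<inter> B. slice_second (\<beta> b) w \<otimes> b = 0"
      proof
        fix b assume "b \<in> H \<union> G \<inter> B - G \<inter> B"
        then consider "b \<notin> G" | "b \<notin> B" by blast
        then have "slice_second (\<beta> b) w = 0"
        proof cases
          case 1
          then have "\<forall>y\<in>F. \<beta> b y = 0" by (auto simp: G_def)
          with wF \<beta> show ?thesis by blast
        next
          case 2
          then have "\<forall>y\<in>X. \<beta> b y = 0" using \<beta>_X by blast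
          with wX \<beta> show ?thesis by blast
        qed
        then show "slice_second (\<beta> b) w \<otimes> b = 0"
          by (simp add: clinearD(3)[OF clinear_tens(1)[OF clinear_ident]])
      qed
    qed (use H G in auto)
    moreover have "w = (\<Sum>b\<in>H \<union> (G \<inter> B). slice_second (\<beta> b) w \<otimes> b)"
      by (rule HH[rule_format]) (use H G in auto)
    ultimately show ?thesis by (rule trans[rotated])
  qed
  then show ?thesis
    using G B(1) \<beta> by (intro exI[of _ "G \<inter> B"] exI[of _ \<beta>]) auto
qed

section \<open>Non-degenerate algebras and their multipliers\<close>

lemma nondegenerateD:
  fixes a :: "'a::complex_algebra"
  assumes "nondegenerate TYPE('a)"
  shows "(\<And>b. a * b = 0) \<Longrightarrow> a = 0" "(\<And>b. b * a = 0) \<Longrightarrow> a = 0"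
proof -
  show "a = 0" if "\<And>b. a * b = 0"
    using assms that unfolding nondegenerate_def by blast
  show "a = 0" if "\<And>b. b * a = 0"
    using assms that unfolding nondegenerate_def by blast
qed

lemma nondegenerate_cancel:
  fixes a b :: "'a::complex_algebra"
  assumes nd: "nondegenerate TYPE('a)"
  shows "(\<And>c. a * c = b * c) \<Longrightarrow> a = b" "(\<And>c. c * a = c * b) \<Longrightarrow> a = b"
proof -
  { assume "\<And>c. a * c = b * c"
    then have "a - b = 0" by - (rule nondegenerateD(1)[OF nd], simp only: left_diff_distrib diff_self)
    then show "a = b" by simp }
  { assume "\<And>c. c * a = c * b"
    then have "a - b = 0" by - (rule nondegenerateD(2)[OF nd], simp only: right_diff_distrib diff_self)
    then show "a = b" by simp }
qed

lemma tens_mult_left: "tensor_map ((*) a) ((*) b) w = (a \<otimes> b) * w"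
proof (rule clinear_eq_tensor[where t=w])
  show "clinear (tensor_map ((*) a) ((*) b))" by (rule tensor_map(1)[OF clinear_mult(1) clinear_mult(1)])
  show "clinear ((*) (a \<otimes> b))" by (rule clinear_mult)
qed (simp only: tensor_map(2)[OF clinear_mult(1) clinear_mult(1)] tens_mult_tens)

lemma tens_mult_right: "tensor_map (\<lambda>x. x * a) (\<lambda>x. x * b) w = w * (a \<otimes> b)"
proof (rule clinear_eq_tensor[where t=w and g="\<lambda>w. w * (a \<otimes> b)"])
  show "clinear (tensor_map (\<lambda>x. x * a) (\<lambda>x. x * b))" by (rule tensor_map(1)[OF clinear_mult(2) clinear_mult(2)])
  show "clinear (\<lambda>w. w * (a \<otimes> b))" by (rule clinear_mult)
qed (simp only: tensor_map(2)[OF clinear_mult(2) clinear_mult(2)] tens_mult_tens)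

lemma tensor_map_comp:
  assumes "clinear f" "clinear g" "clinear f'" "clinear g'"
  shows "tensor_map f g (tensor_map f' g' w) = tensor_map (\<lambda>x. f (f' x)) (\<lambda>x. g (g' x)) w"
proof -
  note c = clinear_compose[OF assms(1,3)] clinear_compose[OF assms(2,4)]
  show ?thesis
  proof (rule clinear_eq_tensor[where t=w and f="\<lambda>w. tensor_map f g (tensor_map f' g' w)"])
    show "clinear (\<lambda>w. tensor_map f g (tensor_map f' g' w))"
      by (rule clinear_compose[OF tensor_map(1)[OF assms(1,2)] tensor_map(1)[OF assms(3,4)]])
    show "clinear (tensor_map (\<lambda>x. f (f' x)) (\<lambda>x. g (g' x)))"
      by (rule tensor_map(1)[OF c])
    show "tensor_map f g (tensor_map f' g' (x \<otimes> y)) = tensor_map (\<lambda>x. f (f' x)) (\<lambda>x. g (g' x)) (x \<otimes> y)" for x y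
      by (simp only: tensor_map(2)[OF assms(1,2)] tensor_map(2)[OF assms(3,4)] tensor_map(2)[OF c])
  qed
qed

lemma nondegenerate_tensor:
  assumes "nondegenerate TYPE('a::complex_algebra)" "nondegenerate TYPE('b::complex_algebra)"
  shows "nondegenerate TYPE(('a, 'b) tensor)"
  unfolding nondegenerate_def
proof (intro conjI allI impI)
  fix w :: "('a, 'b) tensor"
  { assume *: "\<forall>v. w * v = 0"
    show "w = 0"
    proof (rule tensor_map_first_cancel[of "\<lambda>c x. x * c"])
      show "tensor_map (\<lambda>x. x * c) (\<lambda>x. x) w = 0" for c
      proof (rule tensor_map_second_cancel[of "\<lambda>d x. x * d"])
        show "tensor_map (\<lambda>x. x) (\<lambda>x. x * d) (tensor_map (\<lambda>x. x * c) (\<lambda>x. x) w) = 0" for d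
          unfolding tensor_map_comp[OF clinear_ident clinear_mult(2) clinear_mult(2) clinear_ident]
          by (simp add: tens_mult_right *)
      qed (rule clinear_mult, rule nondegenerateD(1)[OF assms(2)], assumption)
    qed (rule clinear_mult, rule nondegenerateD(1)[OF assms(1)], assumption) }
  { assume *: "\<forall>v. v * w = 0"
    show "w = 0"
    proof (rule tensor_map_first_cancel[of "\<lambda>c x. c * x"])
      show "tensor_map (\<lambda>x. c * x) (\<lambda>x. x) w = 0" for c
      proof (rule tensor_map_second_cancel[of "\<lambda>d x. d * x"])
        show "tensor_map (\<lambda>x. x) (\<lambda>x. d * x) (tensor_map (\<lambda>x. c * x) (\<lambda>x. x) w) = 0" for d
          unfolding tensor_map_comp[OF clinear_ident clinear_mult(1) clinear_mult(1) clinear_ident]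
          by (simp add: tens_mult_left *)
      qed (rule clinear_mult, rule nondegenerateD(2)[OF assms(2)], assumption)
    qed (rule clinear_mult, rule nondegenerateD(2)[OF assms(1)], assumption) }
qed

lemma lact_simps [simp]:
  "lact (m * n) x = lact m (lact n x)" "lact 1 x = x" "lact (to_mult a) x = a * x" "lact 0 x = 0"
  "lact (m + n) x = lact m x + lact n x" "lact (c *\<^sub>C m) x = c *\<^sub>C lact m x"
  by (transfer; auto)+

lemma ract_simps [simp]:
  "ract x (m * n) = ract (ract x m) n" "ract x 1 = x" "ract x (to_mult a) = x * a" "ract x 0 = 0"
  "ract x (m + n) = ract x m + ract x n" "ract x (c *\<^sub>C m) = c *\<^sub>C ract x m"
  by (transfer; auto)+

lemma lact_mtens: "lact (m \<otimes>\<^sub>M n) w = tensor_map (lact m) (lact n) w"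
  and ract_mtens: "ract w (m \<otimes>\<^sub>M n) = tensor_map (\<lambda>x. ract x m) (\<lambda>x. ract x n) w"
  by (transfer; auto simp: eta_contract_eq)+

lemma lact_mtens_tens [simp]: "lact (m \<otimes>\<^sub>M n) (x \<otimes> y) = lact m x \<otimes> lact n y"
  and ract_mtens_tens [simp]: "ract (x \<otimes> y) (m \<otimes>\<^sub>M n) = ract x m \<otimes> ract y n"
  by (simp_all add: lact_mtens ract_mtens tensor_map lact ract)

lemma lact_cong_nondegenerate:
  fixes m n :: "'a::complex_algebra multiplier"
  assumes "nondegenerate TYPE('a)" "\<And>x. lact m x = lact n x"
  shows "m = n"
proof (rule multiplier_eqI)
  show "ract x m = ract x n" for x
    by (rule nondegenerate_cancel(1)[OF assms(1)]) (metis lact_ract assms(2))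
qed (fact assms(2))

lemma ract_cong_nondegenerate:
  fixes m n :: "'a::complex_algebra multiplier"
  assumes "nondegenerate TYPE('a)" "\<And>x. ract x m = ract x n"
  shows "m = n"
proof (rule multiplier_eqI)
  show "lact m x = lact n x" for x
    by (rule nondegenerate_cancel(2)[OF assms(1)]) (metis lact_ract assms(2))
qed (fact assms(2))

lemma inj_to_mult:
  assumes "nondegenerate TYPE('a::complex_algebra)"
  shows "inj (to_mult :: 'a \<Rightarrow> _)"
proof (rule injI)
  fix a b :: 'a assume "to_mult a = to_mult b"
  then show "a = b"
    by - (rule nondegenerate_cancel(1)[OF assms], metis lact_simps(3))
qed

lemma from_mult_to_mult:
  assumes "nondegenerate TYPE('a::complex_algebra)"
  shows "from_mult (to_mult (a::'a)) = a"
  by (simp add: from_mult_def inv_f_f inj_to_mult[OF assms])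

lemma clinear_to_mult: "clinear to_mult"
  by (auto simp: clinear_iff mult_scaleC_left mult_scaleC_right algebra_simps intro!: multiplier_eqI)

lemma to_mult_mult:
  "to_mult (a * b) = to_mult a * to_mult b" "m * to_mult a = to_mult (lact m a)" "to_mult a * m = to_mult (ract a m)"
  by (auto intro!: multiplier_eqI simp: mult.assoc lact ract lact_ract)

lemma to_mult_tens: "to_mult a \<otimes>\<^sub>M to_mult b = to_mult (a \<otimes> b)"
  by (rule multiplier_eqI) (simp_all add: lact_mtens ract_mtens tens_mult_left tens_mult_right lact_simps[abs_def] ract_simps[abs_def])

lemma mtens_mult: "(m \<otimes>\<^sub>M n) * (m' \<otimes>\<^sub>M n') = (m * m') \<otimes>\<^sub>M (n * n')"
  by (rule multiplier_eqI)
     (simp_all add: lact_mtens ract_mtens tensor_map_comp lact ract lact_simps[abs_def] ract_simps[abs_def])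

lemma multiplier_tensor_eqI:
  assumes "\<And>x y. lact m (x \<otimes> y) = lact n (x \<otimes> y)" "\<And>x y. ract (x \<otimes> y) m = ract (x \<otimes> y) n"
  shows "m = n"
proof (rule multiplier_eqI)
  show "lact m w = lact n w" for w
    by (rule clinear_eq_tensor[where f="lact m" and g="lact n", OF lact(1) lact(1) assms(1)])
  show "ract w m = ract w n" for w
    by (rule clinear_eq_tensor[where f="\<lambda>w. ract w m" and g="\<lambda>w. ract w n", OF ract(1) ract(1) assms(2)])
qed

lemma mtens_bilinear:
  "(m + m') \<otimes>\<^sub>M n = m \<otimes>\<^sub>M n + m' \<otimes>\<^sub>M n" "m \<otimes>\<^sub>M (n + n') = m \<otimes>\<^sub>M n + m \<otimes>\<^sub>M n'"
  "(c *\<^sub>C m) \<otimes>\<^sub>M n = c *\<^sub>C (m \<otimes>\<^sub>M n)" "m \<otimes>\<^sub>M (c *\<^sub>C n) = c *\<^sub>C (m \<otimes>\<^sub>M n)"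
  by (rule multiplier_tensor_eqI; simp add: tens_bilinear)+

text \<open>Covering a single leg suffices, since multiplying one leg by all elements of its algebra is already
  jointly injective on \<open>A \<otimes> B\<close>.\<close>

lemma mtens_one_cancel:
  fixes m n :: "('a::complex_algebra, 'b::complex_algebra) tensor multiplier"
  assumes nd: "nondegenerate TYPE('a)" "nondegenerate TYPE('b)"
  shows "(\<And>c. (to_mult c \<otimes>\<^sub>M 1) * m = (to_mult c \<otimes>\<^sub>M 1) * n) \<Longrightarrow> m = n"
    and "(\<And>c. m * (1 \<otimes>\<^sub>M to_mult c) = n * (1 \<otimes>\<^sub>M to_mult c)) \<Longrightarrow> m = n"
proof -
  note ndt = nondegenerate_tensor[OF nd]
  { assume *: "\<And>c. (to_mult c \<otimes>\<^sub>M 1) * m = (to_mult c \<otimes>\<^sub>M 1) * n"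
    show "m = n"
    proof (rule lact_cong_nondegenerate[OF ndt])
      fix w
      have "lact m w - lact n w = 0"
      proof (rule tensor_map_first_cancel[of "\<lambda>c x. c * x"])
        show "tensor_map ((*) c) (\<lambda>x. x) (lact m w - lact n w) = 0" for c
        proof (rule tensor_map_diff[OF clinear_mult(1) clinear_ident])
          have "lact (to_mult c \<otimes>\<^sub>M (1 :: 'b multiplier)) v = tensor_map ((*) c) (\<lambda>x. x) v" for v
            by (simp add: lact_mtens lact_simps[abs_def])
          then show "tensor_map ((*) c) (\<lambda>x. x) (lact m w) = tensor_map ((*) c) (\<lambda>x. x) (lact n w)"
            using arg_cong[OF *[of c], of "\<lambda>m. lact m w"] by simp
        qed
      qed (rule clinear_mult, rule nondegenerateD(2)[OF nd(1)], assumption)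
      then show "lact m w = lact n w" by simp
    qed }
  { assume *: "\<And>c. m * (1 \<otimes>\<^sub>M to_mult c) = n * (1 \<otimes>\<^sub>M to_mult c)"
    show "m = n"
    proof (rule ract_cong_nondegenerate[OF ndt])
      fix w
      have "ract w m - ract w n = 0"
      proof (rule tensor_map_second_cancel[of "\<lambda>c x. x * c"])
        show "tensor_map (\<lambda>x. x) (\<lambda>x. x * c) (ract w m - ract w n) = 0" for c
        proof (rule tensor_map_diff[OF clinear_ident clinear_mult(2)])
          have "ract v ((1 :: 'a multiplier) \<otimes>\<^sub>M to_mult c) = tensor_map (\<lambda>x. x) (\<lambda>x. x * c) v" for v
            by (simp add: ract_mtens ract_simps[abs_def])
          then show "tensor_map (\<lambda>x. x) (\<lambda>x. x * c) (ract w m) = tensor_map (\<lambda>x. x) (\<lambda>x. x * c) (ract w n)"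
            using arg_cong[OF *[of c], of "\<lambda>m. ract w m"] by simp
        qed
      qed (rule clinear_mult, rule nondegenerateD(1)[OF nd(2)], assumption)
      then show "ract w m = ract w n" by simp
    qed }
qed

text \<open>Non-degeneracy turns the compatibility of \<open>L\<close> and \<open>R\<close> into their linearity and module properties.\<close>

lemma multiplier_of_pair:
  fixes L R :: "'a::complex_algebra \<Rightarrow> 'a"
  assumes nd: "nondegenerate TYPE('a)" and LR: "\<And>a b. a * L b = R a * b"
  shows "\<exists>m. (\<forall>a. lact m a = L a) \<and> (\<forall>a. ract a m = R a)"
proof -
  have L: "L (x + y) = L x + L y" "L (c *\<^sub>C x) = c *\<^sub>C L x" "L (x * y) = L x * y" for x y c
    by (rule nondegenerate_cancel(2)[OF nd], simp add: LR distrib_left mult_scaleC_right mult.assoc[symmetric])+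
  have R: "R (x + y) = R x + R y" "R (c *\<^sub>C x) = c *\<^sub>C R x" "R (x * y) = x * R y" for x y c
    by (rule nondegenerate_cancel(1)[OF nd], simp add: LR[symmetric] distrib_right mult_scaleC_left mult.assoc)+
  have "(L, R) \<in> {(L, R) | L R. clinear L \<and> clinear R \<and> (\<forall>a b. L (a * b) = L a * b)
      \<and> (\<forall>a b. R (a * b) = a * R b) \<and> (\<forall>a b. a * L b = R a * b)}"
    using L R LR by (simp add: clinear_iff)
  then show ?thesis
    by (intro exI[of _ "Abs_multiplier (L, R)"]) (simp add: lact.rep_eq ract.rep_eq Abs_multiplier_inverse)
qed

text \<open>The maps \<open>w \<mapsto> (c \<otimes> 1) w\<close>, \<open>(1 \<otimes> c) w\<close>, \<open>w (c \<otimes> 1)\<close> and \<open>w (1 \<otimes> c)\<close>. They are written through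
  \<^const>\<open>tensor_map\<close>, since the other leg may be a vector space without product.\<close>

abbreviation mul_l1 :: "'a::complex_algebra \<Rightarrow> ('a, 'b::complex_vector) tensor \<Rightarrow> ('a, 'b) tensor" where
  "mul_l1 c \<equiv> tensor_map ((*) c) (\<lambda>x. x)"
abbreviation mul_l2 :: "'b::complex_algebra \<Rightarrow> ('a::complex_vector, 'b) tensor \<Rightarrow> ('a, 'b) tensor" where
  "mul_l2 c \<equiv> tensor_map (\<lambda>x. x) ((*) c)"
abbreviation mul_r1 :: "'a::complex_algebra \<Rightarrow> ('a, 'b::complex_vector) tensor \<Rightarrow> ('a, 'b) tensor" where
  "mul_r1 c \<equiv> tensor_map (\<lambda>x. x * c) (\<lambda>x. x)"
abbreviation mul_r2 :: "'b::complex_algebra \<Rightarrow> ('a::complex_vector, 'b) tensor \<Rightarrow> ('a, 'b) tensor" where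
  "mul_r2 c \<equiv> tensor_map (\<lambda>x. x) (\<lambda>x. x * c)"

lemma mul_tens:
  "mul_l1 c (x \<otimes> y) = (c * x) \<otimes> y" "mul_l2 d (x \<otimes> y) = x \<otimes> (d * y)"
  "mul_r1 c (x \<otimes> y) = (x * c) \<otimes> y" "mul_r2 d (x \<otimes> y) = x \<otimes> (y * d)"
  by (simp_all add: tensor_map clinear_mult clinear_ident)

lemma clinear_mul:
  "clinear (mul_l1 c)" "clinear (mul_l2 d)" "clinear (mul_r1 c)" "clinear (mul_r2 d)"
  by (simp_all add: tensor_map clinear_mult clinear_ident)

lemmas mul_add = clinear_mul[THEN clinearD(1)]

lemma lact_mul:
  "lact (to_mult c \<otimes>\<^sub>M 1) w = mul_l1 c w" "lact (1 \<otimes>\<^sub>M to_mult d) w = mul_l2 d w"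
  "ract w (to_mult c \<otimes>\<^sub>M 1) = mul_r1 c w" "ract w (1 \<otimes>\<^sub>M to_mult d) = mul_r2 d w"
  by (simp_all add: lact_mtens ract_mtens lact_simps[abs_def] ract_simps[abs_def])

lemma mul_first_cancel:
  fixes v w :: "('a::complex_algebra, 'b::complex_vector) tensor"
  assumes "nondegenerate TYPE('a)"
  shows "(\<And>c. mul_l1 c v = mul_l1 c w) \<Longrightarrow> v = w" "(\<And>c. mul_r1 c v = mul_r1 c w) \<Longrightarrow> v = w"
proof -
  { assume *: "\<And>c. mul_l1 c v = mul_l1 c w"
    have "v - w = 0"
      by (rule tensor_map_first_cancel[of "\<lambda>c x. c * x"], rule clinear_mult, rule nondegenerateD(2)[OF assms],
          assumption, rule tensor_map_diff, rule clinear_mult, rule clinear_ident, rule *)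
    then show "v = w" by simp }
  { assume *: "\<And>c. mul_r1 c v = mul_r1 c w"
    have "v - w = 0"
      by (rule tensor_map_first_cancel[of "\<lambda>c x. x * c"], rule clinear_mult, rule nondegenerateD(1)[OF assms],
          assumption, rule tensor_map_diff, rule clinear_mult, rule clinear_ident, rule *)
    then show "v = w" by simp }
qed

lemma mul_second_cancel:
  fixes v w :: "('b::complex_vector, 'a::complex_algebra) tensor"
  assumes "nondegenerate TYPE('a)"
  shows "(\<And>c. mul_l2 c v = mul_l2 c w) \<Longrightarrow> v = w" "(\<And>c. mul_r2 c v = mul_r2 c w) \<Longrightarrow> v = w"
proof -
  { assume *: "\<And>c. mul_l2 c v = mul_l2 c w"
    have "v - w = 0"
      by (rule tensor_map_second_cancel[of "\<lambda>c x. c * x"], rule clinear_mult, rule nondegenerateD(2)[OF assms],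
          assumption, rule tensor_map_diff, rule clinear_ident, rule clinear_mult, rule *)
    then show "v = w" by simp }
  { assume *: "\<And>c. mul_r2 c v = mul_r2 c w"
    have "v - w = 0"
      by (rule tensor_map_second_cancel[of "\<lambda>c x. x * c"], rule clinear_mult, rule nondegenerateD(1)[OF assms],
          assumption, rule tensor_map_diff, rule clinear_ident, rule clinear_mult, rule *)
    then show "v = w" by simp }
qed

lemma lact_ract_commute:
  fixes w :: "'a::complex_algebra"
  assumes "nondegenerate TYPE('a)"
  shows "lact m (ract w n) = ract (lact m w) n"
  by (rule nondegenerate_cancel(2)[OF assms]) (metis lact_ract ract(2))

lemma mult_transport_tensor_assoc:
  "lact (mult_transport tensor_assoc m) (tensor_assoc w) = tensor_assoc (lact m w)"
  "ract (tensor_assoc w) (mult_transport tensor_assoc m) = tensor_assoc (ract w m)"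
  by (simp_all add: mult_transport[OF algebra_hom_tensor_assoc bij_tensor_assoc] inv_f_f[OF bij_is_inj[OF bij_tensor_assoc]])

lemma multiplier_tensor_assoc_eqI:
  assumes "\<And>w. lact m (tensor_assoc w) = lact n (tensor_assoc w)"
    "\<And>w. ract (tensor_assoc w) m = ract (tensor_assoc w) n"
  shows "m = n"
  by (rule multiplier_eqI) (metis assms bij_tensor_assoc bij_pointE)+

lemma tensor_assoc_map:
  fixes f :: "'a::complex_vector \<Rightarrow> 'a'::complex_vector" and g :: "'b::complex_vector \<Rightarrow> 'b'::complex_vector"
    and k :: "'c::complex_vector \<Rightarrow> 'c'::complex_vector"
  assumes "clinear f" "clinear g" "clinear k"
  shows "tensor_map f (tensor_map g k) (tensor_assoc w) = tensor_assoc (tensor_map (tensor_map f g) k w)"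
proof (induction w)
  case (tens s z)
  show ?case
    by (induction s)
      (simp_all add: tens_bilinear clinearD(1)[OF tensor_assoc(1)] clinearD(1)[OF tensor_map(1)] tensor_assoc(2) tensor_map assms)
next
  case (add s t)
  then show ?case
    by (simp add: clinearD(1)[OF tensor_assoc(1)] clinearD(1)[OF tensor_map(1)] tensor_map assms)
qed

lemma tensor_map_ident: "tensor_map (\<lambda>x. x) (\<lambda>x. x) w = w"
  by (induction w) (simp_all add: tensor_map(2)[OF clinear_ident clinear_ident]
    clinearD(1)[OF tensor_map(1)[OF clinear_ident clinear_ident]])

lemma tensor_assoc_mul:
  "tensor_assoc (tensor_map (mul_l1 a) (\<lambda>x. x) w) = mul_l1 a (tensor_assoc w)"
  "tensor_assoc (tensor_map (mul_r1 a) (\<lambda>x. x) w) = mul_r1 a (tensor_assoc w)"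
  using tensor_assoc_map[OF clinear_mult(1) clinear_ident clinear_ident, of a w]
    tensor_assoc_map[OF clinear_mult(2) clinear_ident clinear_ident, of a w]
  by (simp_all add: tensor_map_ident[abs_def])

lemma slice_mul:
  fixes w :: "'a::complex_algebra tensor2"
  assumes f: "clinear f"
  shows "slice_second f (mul_l1 c w) = c * slice_second f w" "slice_second f (mul_r1 c w) = slice_second f w * c"
    "slice_first f (mul_l2 c w) = c * slice_first f w" "slice_first f (mul_r2 c w) = slice_first f w * c"
  using slice_second_map[OF f clinear_mult(1) clinear_ident, of c w] slice_second_map[OF f clinear_mult(2) clinear_ident, of c w]
    slice_first_map[OF f clinear_ident clinear_mult(1), of c w] slice_first_map[OF f clinear_ident clinear_mult(2), of c w]
  by simp_all

section \<open>Extension of homomorphisms to multiplier algebras\<close>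

text \<open>The extension is given by a definite description, so its existence and uniqueness are the content here.
  Its value at \<open>m\<close> is forced: \<open>b F(m) = b e F(m)\<close>, and \<open>b e = \<Sum> b\<^sub>i \<gamma>(a\<^sub>i)\<close> must go to \<open>\<Sum> b\<^sub>i \<gamma>(a\<^sub>i m)\<close>;
  similarly on the other side. Uniqueness, applied to sums and products of values, also makes \<open>F\<close> a
  homomorphism.\<close>

lemma mult_extension_mult:
  fixes \<gamma> :: "'a::complex_algebra \<Rightarrow> 'b::complex_algebra multiplier"
  assumes nd: "nondegenerate TYPE('b)" and hom: "algebra_hom \<gamma>"
    and e: "e * e = e" "\<And>a. e * \<gamma> a = \<gamma> a" "\<And>a. \<gamma> a * e = \<gamma> a"
    and L: "\<And>b. lact e b \<in> complex_vector.span {lact (\<gamma> a) b' | a b'. True}"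
    and R: "\<And>b. ract b e \<in> complex_vector.span {ract b' (\<gamma> a) | a b'. True}"
  shows "mult_extension \<gamma> e m * \<gamma> a = \<gamma> (lact m a)"
proof -
  have \<gamma>: "\<gamma> (x * y) = \<gamma> x * \<gamma> y" "\<gamma> (x + y) = \<gamma> x + \<gamma> y" "\<gamma> (k *\<^sub>C x) = k *\<^sub>C \<gamma> x" for x y k
    using hom by (auto simp: algebra_hom_def clinear_iff)
  have \<gamma>r: "ract (ract b (\<gamma> x)) (\<gamma> y) = ract b (\<gamma> (x * y))" for x y b
    by (simp add: \<gamma>)
  have el: "lact e (lact (\<gamma> x) b) = lact (\<gamma> x) b" "lact (\<gamma> x) (lact e b) = lact (\<gamma> x) b" for x b
    using arg_cong[OF e(2), of "\<lambda>m. lact m b" x] arg_cong[OF e(3), of "\<lambda>m. lact m b" x] by simp_all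
  have er: "ract (ract b (\<gamma> x)) e = ract b (\<gamma> x)" "ract (ract b e) (\<gamma> x) = ract b (\<gamma> x)" for x b
    using arg_cong[OF e(2), of "\<lambda>m. ract b m" x] arg_cong[OF e(3), of "\<lambda>m. ract b m" x] by simp_all
  note lin = clinearD[OF lact(1)] clinearD[OF ract(1)]
  have ex: "\<exists>M. e * M = M \<and> M * e = M \<and> (\<forall>c. M * \<gamma> c = \<gamma> (lact m c))" for m
  proof -
    \<comment> \<open>the candidate \<open>z\<close> for \<open>b F(m)\<close>\<close>
    have exR: "\<exists>z. ract z e = z \<and> (\<forall>c. ract z (\<gamma> c) = ract b (\<gamma> (lact m c)))" for b
    proof -
      have "ract b e \<in> {v. \<exists>z. ract z e = z \<and> (\<forall>c. ract z (\<gamma> c) = ract v (\<gamma> (lact m c)))}" (is "_ \<in> ?X")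
      proof (rule subsetD[OF complex_vector.span_minimal R])
        show "{ract b' (\<gamma> a) | a b'. True} \<subseteq> ?X"
        proof clarify
          fix a b'
          show "\<exists>z. ract z e = z \<and> (\<forall>c. ract z (\<gamma> c) = ract (ract b' (\<gamma> a)) (\<gamma> (lact m c)))"
            by (rule exI[of _ "ract b' (\<gamma> (ract a m))"]) (simp add: er \<gamma>r lact_ract)
        qed
        show "complex_vector.subspace ?X"
        proof (rule complex_vector.subspaceI)
          show "0 \<in> ?X" by (auto simp: lin intro!: exI[of _ 0])
          show "x + y \<in> ?X" if "x \<in> ?X" "y \<in> ?X" for x y
          proof -
            from that obtain z z' where "ract z e = z" "\<forall>c. ract z (\<gamma> c) = ract x (\<gamma> (lact m c))"
              "ract z' e = z'" "\<forall>c. ract z' (\<gamma> c) = ract y (\<gamma> (lact m c))" by blast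
            then show ?thesis by (auto simp: lin intro!: exI[of _ "z + z'"])
          qed
          show "k *\<^sub>C x \<in> ?X" if "x \<in> ?X" for k x
          proof -
            from that obtain z where "ract z e = z" "\<forall>c. ract z (\<gamma> c) = ract x (\<gamma> (lact m c))" by blast
            then show ?thesis by (auto simp: lin intro!: exI[of _ "k *\<^sub>C z"])
          qed
        qed
      qed
      then show ?thesis by (simp add: er)
    qed
    then obtain r where r: "\<And>b. ract (r b) e = r b" "\<And>b c. ract (r b) (\<gamma> c) = ract b (\<gamma> (lact m c))"
      by metis
    \<comment> \<open>the candidate \<open>y\<close> for \<open>F(m) b\<close>, pinned down by its compatibility with \<open>r\<close>\<close>
    have exL: "\<exists>y. lact e y = y \<and> (\<forall>b'. b' * y = r b' * b)" for b
    proof -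
      have "lact e b \<in> {v. \<exists>y. lact e y = y \<and> (\<forall>b'. b' * y = r b' * v)}" (is "_ \<in> ?X")
      proof (rule subsetD[OF complex_vector.span_minimal L])
        show "{lact (\<gamma> a) b' | a b'. True} \<subseteq> ?X"
        proof clarify
          fix a b'
          show "\<exists>y. lact e y = y \<and> (\<forall>b. b * y = r b * lact (\<gamma> a) b')"
            by (rule exI[of _ "lact (\<gamma> (lact m a)) b'"]) (simp add: el lact_ract r)
        qed
        show "complex_vector.subspace ?X"
        proof (rule complex_vector.subspaceI)
          show "0 \<in> ?X" by (auto simp: lin intro!: exI[of _ 0])
          show "x + y \<in> ?X" if "x \<in> ?X" "y \<in> ?X" for x y
          proof -
            from that obtain z z' where "lact e z = z" "\<forall>c. c * z = r c * x"
              "lact e z' = z'" "\<forall>c. c * z' = r c * y" by blast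
            then show ?thesis by (auto simp: lin distrib_left intro!: exI[of _ "z + z'"])
          qed
          show "k *\<^sub>C x \<in> ?X" if "x \<in> ?X" for k x
          proof -
            from that obtain z where "lact e z = z" "\<forall>c. c * z = r c * x" by blast
            then show ?thesis by (auto simp: lin mult_scaleC_right intro!: exI[of _ "k *\<^sub>C z"])
          qed
        qed
      qed
      then show ?thesis by (simp add: lact_ract r)
    qed
    then obtain l where l: "\<And>b. lact e (l b) = l b" "\<And>b b'. b' * l b = r b' * b" by metis
    obtain M where M: "\<And>b. lact M b = l b" "\<And>b. ract b M = r b"
      using multiplier_of_pair[OF nd, of l r] l(2) by blast
    have "e * M = M" by (rule lact_cong_nondegenerate[OF nd]) (simp add: M l)
    moreover have "M * e = M" by (rule ract_cong_nondegenerate[OF nd]) (simp add: M r)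
    moreover have "M * \<gamma> c = \<gamma> (lact m c)" for c by (rule ract_cong_nondegenerate[OF nd]) (simp add: M r)
    ultimately show ?thesis by blast
  qed
  have unique: "M = N" if "M * e = M" "N * e = N" "\<And>c. M * \<gamma> c = N * \<gamma> c" for M N
  proof (rule lact_cong_nondegenerate[OF nd])
    fix b
    have "lact e b \<in> {v. lact M v = lact N v}"
    proof (rule subsetD[OF complex_vector.span_minimal L])
      show "{lact (\<gamma> a) b' | a b'. True} \<subseteq> {v. lact M v = lact N v}"
      proof clarify
        show "lact M (lact (\<gamma> a) b') = lact N (lact (\<gamma> a) b')" for a b'
          using arg_cong[OF that(3), of "\<lambda>m. lact m b'" a] by simp
      qed
      show "complex_vector.subspace {v. lact M v = lact N v}"
        by (auto intro!: complex_vector.subspaceI simp: lin)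
    qed
    then show "lact M b = lact N b"
      using arg_cong[OF that(1), of "\<lambda>m. lact m b"] arg_cong[OF that(2), of "\<lambda>m. lact m b"] by simp
  qed
  obtain F where F: "\<And>m. e * F m = F m" "\<And>m. F m * e = F m" "\<And>m c. F m * \<gamma> c = \<gamma> (lact m c)"
    using ex by metis
  have F_hom: "algebra_hom F"
    unfolding algebra_hom_def clinear_iff
  proof (intro conjI allI)
    fix x y :: "'a multiplier" and k
    show "F (x + y) = F x + F y"
      by (rule unique) (simp_all add: F distrib_right \<gamma>)
    show "F (k *\<^sub>C x) = k *\<^sub>C F x"
      by (rule unique) (simp_all add: F mult_scaleC_left \<gamma>)
    show "F (x * y) = F x * F y"
      by (rule unique) (simp_all add: F mult.assoc)
  qed
  have "mult_extension \<gamma> e = F"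
    unfolding mult_extension_def
  proof (rule the_equality)
    show "algebra_hom F \<and> (\<forall>a. F (to_mult a) = \<gamma> a) \<and> F 1 = e"
    proof (intro conjI allI F_hom)
      show "F (to_mult a) = \<gamma> a" for a by (rule unique) (simp_all add: F e \<gamma>)
      show "F 1 = e" by (rule unique) (simp_all add: F e)
    qed
    fix F' assume F': "algebra_hom F' \<and> (\<forall>a. F' (to_mult a) = \<gamma> a) \<and> F' 1 = e"
    have mult: "F' x * F' y = F' (x * y)" for x y using F' by (simp add: algebra_hom_def)
    show "F' = F"
    proof (rule ext, rule unique)
      fix m
      show "F' m * e = F' m" using mult[of m 1] F' by simp
      show "F' m * \<gamma> c = F m * \<gamma> c" for c
        using mult[of m "to_mult c"] F' by (simp add: F to_mult_mult)
    qed (simp add: F)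
  qed
  then show ?thesis by (simp add: F)
qed

section \<open>The coproduct and its canonical idempotent\<close>

context weak_multiplier_Hopf_algebra
begin

lemma nondegenerate2: "nondegenerate TYPE('a tensor2)"
  by (intro nondegenerate_tensor nondegenerate)

lemma nondegenerate3: "nondegenerate TYPE('a tensor3)"
  by (intro nondegenerate_tensor nondegenerate)

lemma to_mult_eq_iff: "to_mult v = to_mult w \<longleftrightarrow> v = w" for v w :: "'a tensor2"
  using inj_to_mult[OF nondegenerate2] by (auto dest: injD)

lemma coproduct: "coproduct \<Delta>"
  using full_coproduct by (simp add: full_coproduct_def)

lemma Delta: "clinear \<Delta>" "\<Delta> (x * y) = \<Delta> x * \<Delta> y"
  using coproduct by (simp_all add: coproduct_def algebra_hom_def)

lemma clinear_from_mult:
  fixes F :: "'c::complex_vector \<Rightarrow> 'a tensor2 multiplier"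
  assumes "\<And>x. F x \<in> range to_mult" "clinear F"
  shows "clinear (\<lambda>x. from_mult (F x))"
proof -
  have *: "to_mult (from_mult (F x)) = F x" for x
    unfolding from_mult_def by (rule f_inv_into_f[OF assms(1)])
  have "to_mult (from_mult (F (x + y))) = to_mult (from_mult (F x) + from_mult (F y))"
    and "to_mult (from_mult (F (c *\<^sub>C x))) = to_mult (c *\<^sub>C from_mult (F x))" for x y c
    unfolding clinearD[OF clinear_to_mult] * by (simp_all add: clinearD[OF assms(2)])
  then show ?thesis by (simp add: clinear_iff to_mult_eq_iff)
qed

lemma to_mult_from_mult: "m \<in> range to_mult \<Longrightarrow> to_mult (from_mult m) = m"
  unfolding from_mult_def by (rule f_inv_into_f)

lemma T1: "clinear (T1 \<Delta>)" "to_mult (T1 \<Delta> (a \<otimes> b)) = \<Delta> a * (1 \<otimes>\<^sub>M to_mult b)"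
proof -
  have range: "\<Delta> a * (1 \<otimes>\<^sub>M to_mult b) \<in> range to_mult" for a b
    using coproduct by (simp add: coproduct_def)
  have "clinear (\<lambda>a. \<Delta> a * (1 \<otimes>\<^sub>M to_mult b))" "clinear (\<lambda>b. \<Delta> a * (1 \<otimes>\<^sub>M to_mult b))" for a b
    by (simp_all add: clinear_iff clinearD[OF Delta(1)] clinearD[OF clinear_to_mult] mtens_bilinear
        distrib_left distrib_right mult_scaleC_left mult_scaleC_right)
  then have bil: "cbilinear (\<lambda>a b. from_mult (\<Delta> a * (1 \<otimes>\<^sub>M to_mult b)))"
    unfolding cbilinear_def by (intro conjI allI clinear_from_mult range)
  show "clinear (T1 \<Delta>)" by (simp add: T1_def clinear_tensor_lift[OF bil])
  show "to_mult (T1 \<Delta> (a \<otimes> b)) = \<Delta> a * (1 \<otimes>\<^sub>M to_mult b)"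
    unfolding T1_def tensor_lift_tens[OF bil] by (rule to_mult_from_mult[OF range])
qed

lemma T2: "clinear (T2 \<Delta>)" "to_mult (T2 \<Delta> (a \<otimes> b)) = (to_mult a \<otimes>\<^sub>M 1) * \<Delta> b"
proof -
  have range: "(to_mult a \<otimes>\<^sub>M 1) * \<Delta> b \<in> range to_mult" for a b
    using coproduct by (simp add: coproduct_def)
  have "clinear (\<lambda>a. (to_mult a \<otimes>\<^sub>M 1) * \<Delta> b)" "clinear (\<lambda>b. (to_mult a \<otimes>\<^sub>M 1) * \<Delta> b)" for a b
    by (simp_all add: clinear_iff clinearD[OF Delta(1)] clinearD[OF clinear_to_mult] mtens_bilinear
        distrib_left distrib_right mult_scaleC_left mult_scaleC_right)
  then have bil: "cbilinear (\<lambda>a b. from_mult ((to_mult a \<otimes>\<^sub>M 1) * \<Delta> b))"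
    unfolding cbilinear_def by (intro conjI allI clinear_from_mult range)
  show "clinear (T2 \<Delta>)" by (simp add: T2_def clinear_tensor_lift[OF bil])
  show "to_mult (T2 \<Delta> (a \<otimes> b)) = (to_mult a \<otimes>\<^sub>M 1) * \<Delta> b"
    unfolding T2_def tensor_lift_tens[OF bil] by (rule to_mult_from_mult[OF range])
qed

lemma T2_mult: "T2 \<Delta> (a \<otimes> b) * w = mul_l1 a (lact (\<Delta> b) w)"
  using arg_cong[OF T2(2), of "\<lambda>m. lact m w" a b] by (simp add: lact_mul)

lemma mul_l1_T1: "mul_l1 c (T1 \<Delta> (a \<otimes> b)) = mul_r2 b (T2 \<Delta> (c \<otimes> a))"
  by (simp add: to_mult_eq_iff[symmetric] lact_mul[symmetric] to_mult_mult[symmetric] T1 T2 mult.assoc)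

lemma mul_r1_T1: "mul_r1 c (T1 \<Delta> (a \<otimes> b)) = lact (\<Delta> a) (c \<otimes> b)"
  by (simp add: to_mult_eq_iff[symmetric] lact_mul[symmetric] to_mult_mult[symmetric] T1 mult.assoc mtens_mult)
     (simp add: to_mult_tens to_mult_mult)

lemma mul_l2_T2: "mul_l2 c (T2 \<Delta> (a \<otimes> b)) = ract (a \<otimes> c) (\<Delta> b)"
  by (simp add: to_mult_eq_iff[symmetric] lact_mul[symmetric] to_mult_mult[symmetric] T2 mult.assoc[symmetric] mtens_mult)
     (simp add: to_mult_tens to_mult_mult)

lemma E_Delta: "E * \<Delta> a = \<Delta> a"
proof (rule mtens_one_cancel(2)[OF nondegenerate nondegenerate])
  fix b
  obtain w where w: "T1 \<Delta> (a \<otimes> b) = lact E w" using range_T1 by blast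
  have "lact E (T1 \<Delta> (a \<otimes> b)) = T1 \<Delta> (a \<otimes> b)"
    using arg_cong[OF E_idem, of "\<lambda>m. lact m w"] by (simp add: w)
  then show "E * \<Delta> a * (1 \<otimes>\<^sub>M to_mult b) = \<Delta> a * (1 \<otimes>\<^sub>M to_mult b)"
    by (simp add: mult.assoc T1(2)[symmetric] to_mult_mult)
qed

lemma Delta_E: "\<Delta> a * E = \<Delta> a"
proof (rule mtens_one_cancel(1)[OF nondegenerate nondegenerate])
  fix b
  obtain w where w: "T2 \<Delta> (b \<otimes> a) = ract w E" using range_T2 by blast
  have "ract (T2 \<Delta> (b \<otimes> a)) E = T2 \<Delta> (b \<otimes> a)"
    using arg_cong[OF E_idem, of "\<lambda>m. ract w m"] by (simp add: w)
  then show "(to_mult b \<otimes>\<^sub>M 1) * (\<Delta> a * E) = (to_mult b \<otimes>\<^sub>M 1) * \<Delta> a"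
    by (simp add: mult.assoc[symmetric] T2(2)[symmetric] to_mult_mult)
qed

lemma idempotent_induct [consumes 0, case_names mult add scale]:
  fixes x :: 'a
  assumes "\<And>p q. P (p * q)" "\<And>x y. P x \<Longrightarrow> P y \<Longrightarrow> P (x + y)" "\<And>c x. P x \<Longrightarrow> P (c *\<^sub>C x)"
  shows "P x"
proof -
  have "complex_vector.subspace {x. P x}"
    using assms(1)[of 0 0] by (auto intro!: complex_vector.subspaceI assms)
  from complex_vector.span_minimal[OF _ this, of "{a * b | a b. True}"] show ?thesis
    using idempotent assms(1) unfolding idempotent_def by auto
qed

lemma lact_mul_r1: "lact m (mul_r1 c w) = mul_r1 c (lact m w)" for w :: "'a tensor2"
  using lact_ract_commute[OF nondegenerate2, of m w "to_mult c \<otimes>\<^sub>M 1"] by (simp only: lact_mul)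

lemma ract_mul_l2: "ract (mul_l2 c w) m = mul_l2 c (ract w m)" for w :: "'a tensor2"
  using lact_ract_commute[OF nondegenerate2, of "1 \<otimes>\<^sub>M to_mult c" w m] by (simp only: lact_mul)

text \<open>The range of \<open>T\<^sub>1\<close> is \<open>E (A \<otimes> A)\<close>. Idempotency of \<open>A\<close> supplies a factor \<open>q\<close> in the first leg, which
  turns \<open>\<Delta>(a) (1 \<otimes> b)\<close> into \<open>\<Delta>(a) (q \<otimes> b)\<close>.\<close>

lemma lact_E_span: "lact E w \<in> complex_vector.span {lact (\<Delta> a) v | a v. True}" (is "_ \<in> complex_vector.span ?X")
proof (induction w)
  case (tens u v)
  show ?case
  proof (induction u rule: idempotent_induct)
    case (mult p q)
    obtain t where t: "lact E (p \<otimes> v) = T1 \<Delta> t" using range_T1 by blast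
    have "lact E ((p * q) \<otimes> v) = mul_r1 q (T1 \<Delta> t)"
      using lact_mul_r1[of E q "p \<otimes> v"] by (simp add: mul_tens t)
    moreover have "mul_r1 q (T1 \<Delta> t) \<in> complex_vector.span ?X"
    proof (induction t)
      case (tens x y)
      show ?case unfolding mul_r1_T1 by (rule complex_vector.span_base) blast
    qed (simp add: mul_add clinearD[OF T1(1)] complex_vector.span_add)
    ultimately show ?case by simp
  qed (simp_all add: tens_bilinear clinearD[OF lact(1)] complex_vector.span_add complex_vector.span_scale)
qed (simp add: clinearD[OF lact(1)] complex_vector.span_add)

lemma ract_E_span: "ract w E \<in> complex_vector.span {ract v (\<Delta> a) | a v. True}" (is "_ \<in> complex_vector.span ?X")
proof (induction w)
  case (tens u v)
  show ?case
  proof (induction v rule: idempotent_induct)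
    case (mult p q)
    obtain t where t: "ract (u \<otimes> q) E = T2 \<Delta> t" using range_T2 by (metis rangeI image_iff)
    have "ract (u \<otimes> (p * q)) E = mul_l2 p (T2 \<Delta> t)"
      using ract_mul_l2[of p "u \<otimes> q" E] by (simp add: mul_tens t)
    moreover have "mul_l2 p (T2 \<Delta> t) \<in> complex_vector.span ?X"
    proof (induction t)
      case (tens x y)
      show ?case unfolding mul_l2_T2 by (rule complex_vector.span_base) blast
    qed (simp add: mul_add clinearD[OF T2(1)] complex_vector.span_add)
    ultimately show ?case by simp
  qed (simp_all add: tens_bilinear clinearD[OF ract(1)] complex_vector.span_add complex_vector.span_scale)
qed (simp add: clinearD[OF ract(1)] complex_vector.span_add)

lemma id_coproduct: "clinear (id_coproduct \<Delta>)" "id_coproduct \<Delta> (a \<otimes> b) = to_mult a \<otimes>\<^sub>M \<Delta> b"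
proof -
  have bil: "cbilinear (\<lambda>a b. to_mult a \<otimes>\<^sub>M \<Delta> b)"
    by (simp add: cbilinear_def clinear_iff clinearD[OF Delta(1)] clinearD[OF clinear_to_mult] mtens_bilinear)
  show "clinear (id_coproduct \<Delta>)" "id_coproduct \<Delta> (a \<otimes> b) = to_mult a \<otimes>\<^sub>M \<Delta> b"
    by (simp_all add: id_coproduct_def clinear_tensor_lift[OF bil] tensor_lift_tens[OF bil])
qed

lemma algebra_hom_id_coproduct: "algebra_hom (id_coproduct \<Delta>)"
proof -
  have "id_coproduct \<Delta> (s * t) = id_coproduct \<Delta> s * id_coproduct \<Delta> t" for s t
  proof (induction s)
    case (tens x y)
    show ?case
      by (induction t)
         (simp_all add: id_coproduct(2) clinearD[OF id_coproduct(1)] tens_mult_tens mtens_mult Delta to_mult_mult(1) distrib_left)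
  qed (simp add: clinearD[OF id_coproduct(1)] distrib_right)
  then show ?thesis by (simp add: algebra_hom_def id_coproduct)
qed

lemma one_E_id_coproduct: "(1 \<otimes>\<^sub>M E) * id_coproduct \<Delta> t = id_coproduct \<Delta> t"
  "id_coproduct \<Delta> t * (1 \<otimes>\<^sub>M E) = id_coproduct \<Delta> t"
  by (induction t)
     (simp_all add: id_coproduct(2) clinearD[OF id_coproduct(1)] mtens_mult E_Delta Delta_E distrib_left distrib_right)

lemma tens_in_subspace:
  assumes X: "complex_vector.subspace X" and x: "x \<in> complex_vector.span U" and y: "y \<in> complex_vector.span V"
    and *: "\<And>u v. u \<in> U \<Longrightarrow> v \<in> V \<Longrightarrow> u \<otimes> v \<in> X"
  shows "x \<otimes> y \<in> X"
proof -
  note cl = complex_vector.subspace_0[OF X] complex_vector.subspace_add[OF X] complex_vector.subspace_scale[OF X]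
  have "complex_vector.subspace {y. u \<otimes> y \<in> X}" for u
    by (rule complex_vector.subspaceI)
       (simp_all add: cl tens_bilinear clinearD(3)[OF clinear_tens(2)[OF clinear_ident]])
  from complex_vector.span_minimal[OF _ this] have 1: "u \<otimes> y \<in> X" if "u \<in> U" for u
    using * that y by blast
  have "complex_vector.subspace {x. x \<otimes> y \<in> X}"
    by (rule complex_vector.subspaceI)
       (simp_all add: cl tens_bilinear clinearD(3)[OF clinear_tens(1)[OF clinear_ident]])
  from complex_vector.span_minimal[OF _ this] show ?thesis
    using 1 x by blast
qed

text \<open>The axiom \<open>(id \<otimes> \<Delta>) E = (E \<otimes> 1) (1 \<otimes> E)\<close> multiplied by \<open>(id \<otimes> \<Delta>) t\<close>; the factor \<open>1 \<otimes> E\<close> is absorbed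
  because \<open>E \<Delta>(a) = \<Delta>(a)\<close>.\<close>

lemma id_coproduct_lact_E: "leg12 E * id_coproduct \<Delta> t = id_coproduct \<Delta> (lact E t)"
proof -
  have A: "x \<in> complex_vector.span {p * q | p q. True}" for x :: 'a
    using idempotent by (simp add: idempotent_def)
  have L: "lact (1 \<otimes>\<^sub>M E) b \<in> complex_vector.span {lact (id_coproduct \<Delta> t) b' | t b'. True}"
    (is "_ \<in> complex_vector.span ?X") for b
  proof (induction b)
    case (tens c w)
    have "c \<otimes> lact E w \<in> complex_vector.span ?X"
    proof (rule tens_in_subspace[OF complex_vector.subspace_span A lact_E_span])
      fix u v assume "u \<in> {p * q | p q :: 'a. True}" "v \<in> {lact (\<Delta> a) v | a v. True}"
      then obtain p q a v' where "u = p * q" "v = lact (\<Delta> a) v'" by blast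
      then have "u \<otimes> v = lact (id_coproduct \<Delta> (p \<otimes> a)) (q \<otimes> v')" by (simp add: id_coproduct)
      then show "u \<otimes> v \<in> complex_vector.span ?X" by (intro complex_vector.span_base) blast
    qed
    then show ?case by simp
  qed (simp add: clinearD[OF lact(1)] complex_vector.span_add)
  have R: "ract b (1 \<otimes>\<^sub>M E) \<in> complex_vector.span {ract b' (id_coproduct \<Delta> t) | t b'. True}"
    (is "_ \<in> complex_vector.span ?X") for b
  proof (induction b)
    case (tens c w)
    have "c \<otimes> ract w E \<in> complex_vector.span ?X"
    proof (rule tens_in_subspace[OF complex_vector.subspace_span A ract_E_span])
      fix u v assume "u \<in> {p * q | p q :: 'a. True}" "v \<in> {ract v (\<Delta> a) | a v. True}"
      then obtain p q a v' where "u = p * q" "v = ract v' (\<Delta> a)" by blast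
      then have "u \<otimes> v = ract (p \<otimes> v') (id_coproduct \<Delta> (q \<otimes> a))" by (simp add: id_coproduct)
      then show "u \<otimes> v \<in> complex_vector.span ?X" by (intro complex_vector.span_base) blast
    qed
    then show ?case by simp
  qed (simp add: clinearD[OF ract(1)] complex_vector.span_add)
  have idem: "(1 \<otimes>\<^sub>M E) * (1 \<otimes>\<^sub>M E) = (1 \<otimes>\<^sub>M E :: 'a tensor3 multiplier)"
    by (simp add: mtens_mult E_idem)
  from mult_extension_mult[OF nondegenerate3 algebra_hom_id_coproduct idem one_E_id_coproduct L R, of E t]
  show ?thesis
    by (simp add: id_coproduct_E mult.assoc one_E_id_coproduct)
qed

lemma lact_leg12: "lact (leg12 m) (c \<otimes> w) = tensor_assoc (tensor_map (\<lambda>u. lact m (c \<otimes> u)) (\<lambda>x. x) w)"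
proof -
  have c: "clinear (\<lambda>u. lact m (c \<otimes> u))" by (intro clinear_intros)
  show ?thesis
  proof (induction w)
    case (tens u v)
    have "lact (leg12 m) (tensor_assoc ((c \<otimes> u) \<otimes> v)) = tensor_assoc (lact m (c \<otimes> u) \<otimes> v)"
      unfolding leg12_def mult_transport_tensor_assoc by simp
    then show ?case by (simp add: tensor_assoc(2) tensor_map(2)[OF c clinear_ident])
  qed (simp add: tens_bilinear clinearD(1)[OF lact(1)] clinearD(1)[OF tensor_assoc(1)]
      clinearD(1)[OF tensor_map(1)[OF c clinear_ident]])
qed

lemma lact_id_coproduct:
  "lact (id_coproduct \<Delta> t) (c \<otimes> w) = mul_r1 c (tensor_map (\<lambda>x. x) (\<lambda>z. lact (\<Delta> z) w) t)"
proof -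
  have c: "clinear (\<lambda>z. lact (\<Delta> z) w)" by (simp add: clinear_iff clinearD[OF Delta(1)])
  show ?thesis
    by (induction t)
       (simp_all add: id_coproduct(2) tensor_map(2)[OF clinear_ident c] mul_tens mul_add
         clinearD(1)[OF id_coproduct(1)] clinearD(1)[OF tensor_map(1)[OF clinear_ident c]])
qed

text \<open>This is \<open>(id \<otimes> \<Delta>) (E (p \<otimes> h)) = (E \<otimes> 1) (p \<otimes> \<Delta>(h))\<close>, with the last two legs applied to \<open>w\<close>. The first
  leg is left uncovered: the two sides agree after multiplication by every \<open>c \<otimes> 1 \<otimes> 1\<close> from the right.\<close>

lemma coproduct_slice_E:
  "tensor_map (\<lambda>x. x) (\<lambda>z. lact (\<Delta> z) w) (lact E (p \<otimes> h))
   = tensor_assoc (tensor_map (\<lambda>u. lact E (p \<otimes> u)) (\<lambda>x. x) (lact (\<Delta> h) w))"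
proof (rule mul_first_cancel(2)[OF nondegenerate])
  fix c
  let ?f = "\<lambda>u. lact E (p \<otimes> u)"
  have f: "clinear ?f" by (intro clinear_intros)
  have E: "lact E ((p * c) \<otimes> u) = mul_r1 c (?f u)" for u
    using lact_mul_r1[of E c "p \<otimes> u"] by (simp add: mul_tens)
  have "mul_r1 c (tensor_map (\<lambda>x. x) (\<lambda>z. lact (\<Delta> z) w) (lact E (p \<otimes> h)))
      = lact (leg12 E * id_coproduct \<Delta> (p \<otimes> h)) (c \<otimes> w)"
    by (simp add: id_coproduct_lact_E lact_id_coproduct)
  also have "\<dots> = tensor_assoc (tensor_map (\<lambda>u. lact E ((p * c) \<otimes> u)) (\<lambda>x. x) (lact (\<Delta> h) w))"
    by (simp add: id_coproduct lact_leg12)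
  also have "\<dots> = tensor_assoc (tensor_map (mul_r1 c) (\<lambda>x. x) (tensor_map ?f (\<lambda>x. x) (lact (\<Delta> h) w)))"
    by (simp only: E tensor_map_comp[OF clinear_mul(3) clinear_ident f clinear_ident])
  also have "\<dots> = mul_r1 c (tensor_assoc (tensor_map ?f (\<lambda>x. x) (lact (\<Delta> h) w)))"
    by (simp only: tensor_assoc_mul)
  finally show "mul_r1 c (tensor_map (\<lambda>x. x) (\<lambda>z. lact (\<Delta> z) w) (lact E (p \<otimes> h)))
      = mul_r1 c (tensor_assoc (tensor_map ?f (\<lambda>x. x) (lact (\<Delta> h) w)))" .
qed

text \<open>Coassociativity as an identity in \<open>A \<otimes> A \<otimes> A\<close>: both sides are \<open>\<Sum> a b\<^sub>(\<^sub>1\<^sub>) \<otimes> b\<^sub>(\<^sub>2\<^sub>) \<otimes> b\<^sub>(\<^sub>3\<^sub>) c\<close>.\<close>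

lemma coassociative:
  "tensor_assoc (tensor_map (\<lambda>x. T2 \<Delta> (a \<otimes> x)) (\<lambda>x. x) (T1 \<Delta> (b \<otimes> c)))
   = tensor_map (\<lambda>x. x) (\<lambda>y. T1 \<Delta> (y \<otimes> c)) (T2 \<Delta> (a \<otimes> b))"
proof -
  have c1: "clinear (\<lambda>y. T1 \<Delta> (y \<otimes> c))" and c2: "clinear (\<lambda>x. T2 \<Delta> (a \<otimes> x))"
    by (rule clinear_compose[OF T1(1)] clinear_compose[OF T2(1)]; intro clinear_intros)+
  have assoc_mult: "tensor_assoc (v * w) = tensor_assoc v * tensor_assoc w" for v w :: "('a tensor2, 'a) tensor"
    by (rule algebra_hom_tensor_assoc[unfolded algebra_hom_def, THEN conjunct2, rule_format])
  have tr: "mult_transport tensor_assoc (m + n) = mult_transport tensor_assoc m + mult_transport tensor_assoc n"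
    "mult_transport tensor_assoc (k *\<^sub>C m) = k *\<^sub>C mult_transport tensor_assoc m"
    "mult_transport tensor_assoc m * mult_transport tensor_assoc n = mult_transport tensor_assoc (m * n)"
    "mult_transport tensor_assoc (to_mult w) = to_mult (tensor_assoc w)"
    for m n :: "('a tensor2, 'a) tensor multiplier" and k and w :: "('a tensor2, 'a) tensor"
    using assoc_mult
    by (auto intro!: multiplier_tensor_assoc_eqI simp: mult_transport_tensor_assoc clinearD[OF tensor_assoc(1)])
  have bil: "cbilinear (\<lambda>a (b :: 'a). mult_transport tensor_assoc (\<Delta> a \<otimes>\<^sub>M to_mult b))"
    by (simp add: cbilinear_def clinear_iff clinearD[OF Delta(1)] clinearD[OF clinear_to_mult] mtens_bilinear tr)
  have one: "mult_transport tensor_assoc ((to_mult a \<otimes>\<^sub>M (1 :: 'a multiplier)) \<otimes>\<^sub>M (1 :: 'a multiplier))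
      = to_mult a \<otimes>\<^sub>M (1 :: 'a tensor2 multiplier)"
    by (rule multiplier_tensor_assoc_eqI)
       (simp_all only: mult_transport_tensor_assoc ract_mtens lact_mtens lact_mul[abs_def] tensor_assoc_mul
         lact_simps[abs_def] ract_simps[abs_def])
  have A: "(to_mult a \<otimes>\<^sub>M 1) * coproduct_id \<Delta> t = to_mult (tensor_assoc (tensor_map (\<lambda>x. T2 \<Delta> (a \<otimes> x)) (\<lambda>x. x) t))" for t
  proof (induction t)
    case (tens x y)
    show ?case
      unfolding coproduct_id_def tensor_lift_tens[OF bil] one[symmetric] tr mtens_mult T2(2)[symmetric]
      by (simp add: to_mult_tens tr tensor_map(2)[OF c2 clinear_ident])
  next
    case (add s t)
    then show ?case
      by (simp add: coproduct_id_def clinearD(1)[OF clinear_tensor_lift[OF bil]] distrib_left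
          clinearD(1)[OF tensor_map(1)[OF c2 clinear_ident]] clinearD(1)[OF tensor_assoc(1)] clinearD(1)[OF clinear_to_mult])
  qed
  have B: "id_coproduct \<Delta> t * (1 \<otimes>\<^sub>M 1 \<otimes>\<^sub>M to_mult c) = to_mult (tensor_map (\<lambda>x. x) (\<lambda>y. T1 \<Delta> (y \<otimes> c)) t)" for t
    by (induction t)
       (simp_all add: id_coproduct(2) mtens_mult T1(2)[symmetric] to_mult_tens tensor_map(2)[OF clinear_ident c1]
         clinearD(1)[OF id_coproduct(1)] distrib_right clinearD(1)[OF tensor_map(1)[OF clinear_ident c1]]
         clinearD(1)[OF clinear_to_mult])
  have "(to_mult a \<otimes>\<^sub>M 1) * coproduct_id \<Delta> (T1 \<Delta> (b \<otimes> c))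
      = id_coproduct \<Delta> (T2 \<Delta> (a \<otimes> b)) * (1 \<otimes>\<^sub>M 1 \<otimes>\<^sub>M to_mult c)"
    using coproduct unfolding coproduct_def by blast
  then show ?thesis by (simp add: A B inj_eq[OF inj_to_mult[OF nondegenerate3]])
qed

end

section \<open>The antipode and the target map\<close>

context regular_weak_multiplier_Hopf_algebra
begin

text \<open>In the regular case the antipode takes values in \<open>A\<close>, and \<open>\<sigma>\<close> is the antipode as a bijection of \<open>A\<close>.\<close>

definition \<sigma> :: "'a \<Rightarrow> 'a" where
  "\<sigma> a = from_mult (S a)"

lemma to_mult_\<sigma>: "S a = to_mult (\<sigma> a)"
proof -
  have "S a \<in> range to_mult" using regular by (auto simp: bij_betw_def)
  then show ?thesis by (simp add: \<sigma>_def from_mult_def f_inv_into_f)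
qed

lemma \<sigma>: "clinear \<sigma>" "\<sigma> (x * y) = \<sigma> y * \<sigma> x" "bij \<sigma>"
proof -
  have inj: "inj (to_mult :: 'a \<Rightarrow> _)" by (rule inj_to_mult[OF nondegenerate])
  have S: "S (x + y) = S x + S y" "S (c *\<^sub>C x) = c *\<^sub>C S x" "S (x * y) = S y * S x" for x y c
    using antipode by (auto simp: antipode_def algebra_antihom_def clinear_iff)
  show "clinear \<sigma>"
    unfolding clinear_iff
    using S(1,2) by (simp add: to_mult_\<sigma> clinearD[OF clinear_to_mult, symmetric] inj_eq[OF inj])
  show "\<sigma> (x * y) = \<sigma> y * \<sigma> x"
    using S(3)[of x y] by (simp add: to_mult_\<sigma> to_mult_mult(1)[symmetric] inj_eq[OF inj])
  have "S = to_mult \<circ> \<sigma>" by (simp add: fun_eq_iff to_mult_\<sigma>)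
  then have "bij_betw (to_mult \<circ> \<sigma>) UNIV (range (to_mult :: 'a \<Rightarrow> _))" using regular by simp
  then have "bij_betw (inv to_mult \<circ> (to_mult \<circ> \<sigma>)) UNIV UNIV"
    by (rule bij_betw_trans) (simp add: inj inj_imp_bij_betw_inv)
  then show "bij \<sigma>" by (simp add: o_assoc inv_o_cancel[OF inj])
qed

lemma inv_\<sigma>: "inv \<sigma> (\<sigma> x) = x" "\<sigma> (inv \<sigma> x) = x"
  using \<sigma>(3) by (simp_all add: bij_is_inj bij_is_surj surj_f_inv_f)

lemma clinear_inv_\<sigma>: "clinear (inv \<sigma>)"
proof -
  have add: "inv \<sigma> (\<sigma> x + \<sigma> y) = x + y" and scale: "inv \<sigma> (c *\<^sub>C \<sigma> x) = c *\<^sub>C x" for x y c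
    by (simp_all add: clinearD(1,2)[OF \<sigma>(1), symmetric] inv_\<sigma>)
  show ?thesis
    using add[of "inv \<sigma> x" "inv \<sigma> y" for x y] scale[of c "inv \<sigma> x" for c x] by (simp add: clinear_iff inv_\<sigma>)
qed

definition mult_\<sigma>_second :: "'a tensor2 \<Rightarrow> 'a" where
  "mult_\<sigma>_second = tensor_lift (\<lambda>x y. x * \<sigma> y)"

definition mult_\<sigma>_first :: "'a tensor2 \<Rightarrow> 'a" where
  "mult_\<sigma>_first = tensor_lift (\<lambda>x y. \<sigma> x * y)"

lemma mult_\<sigma>_second: "clinear mult_\<sigma>_second" "mult_\<sigma>_second (x \<otimes> y) = x * \<sigma> y"
proof -
  have bil: "cbilinear (\<lambda>x y. x * \<sigma> y)"
    unfolding cbilinear_def by (intro conjI allI clinear_intros \<sigma>)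
  show "clinear mult_\<sigma>_second" "mult_\<sigma>_second (x \<otimes> y) = x * \<sigma> y"
    by (simp_all add: mult_\<sigma>_second_def clinear_tensor_lift[OF bil] tensor_lift_tens[OF bil])
qed

lemma mult_\<sigma>_first: "clinear mult_\<sigma>_first" "mult_\<sigma>_first (x \<otimes> y) = \<sigma> x * y"
proof -
  have bil: "cbilinear (\<lambda>x y. \<sigma> x * y)"
    unfolding cbilinear_def by (intro conjI allI clinear_intros \<sigma>)
  show "clinear mult_\<sigma>_first" "mult_\<sigma>_first (x \<otimes> y) = \<sigma> x * y"
    by (simp_all add: mult_\<sigma>_first_def clinear_tensor_lift[OF bil] tensor_lift_tens[OF bil])
qed

end

text \<open>The antipode axioms only assert the existence of the maps \<open>R\<^sub>1 (a \<otimes> b) = \<Sum> a\<^sub>(\<^sub>1\<^sub>) \<otimes> S(a\<^sub>(\<^sub>2\<^sub>)) b\<close> and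
  \<open>R\<^sub>2 (a \<otimes> b) = \<Sum> a S(b\<^sub>(\<^sub>1\<^sub>)) \<otimes> b\<^sub>(\<^sub>2\<^sub>)\<close>. They are fixed here, with their properties stated for
  elements of \<open>A \<otimes> A\<close> instead of multipliers. The last one says \<open>\<Sum> S(E\<^sub>1) E\<^sub>2 = 1\<close>.\<close>

locale antipode_maps = regular_weak_multiplier_Hopf_algebra +
  fixes R\<^sub>1 R\<^sub>2 :: "'a tensor2 \<Rightarrow> 'a tensor2"
  assumes R1_linear: "clinear R\<^sub>1" and R2_linear: "clinear R\<^sub>2"
    and mul_l1_R1: "mul_l1 c (R\<^sub>1 (a \<otimes> b)) = tensor_map (\<lambda>x. x) (\<lambda>y. \<sigma> y * b) (T2 \<Delta> (c \<otimes> a))"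
    and mul_r2_R2: "mul_r2 c (R\<^sub>2 (a \<otimes> b)) = tensor_map (\<lambda>x. a * \<sigma> x) (\<lambda>y. y) (T1 \<Delta> (b \<otimes> c))"
    and lact_E: "lact E (a \<otimes> b) = T1 \<Delta> (R\<^sub>1 (a \<otimes> b))"
    and ract_E: "ract (a \<otimes> b) E = T2 \<Delta> (R\<^sub>2 (a \<otimes> b))"
    and mult_\<sigma>_first_E: "mult_\<sigma>_first (lact E (a \<otimes> b)) = \<sigma> a * b"

lemma (in regular_weak_multiplier_Hopf_algebra) obtain_antipode_maps:
  obtains R\<^sub>1 R\<^sub>2 where "antipode_maps \<Delta> \<epsilon> E G\<^sub>1 G\<^sub>2 S R\<^sub>1 R\<^sub>2"
proof -
  have bil1: "cbilinear (\<lambda>x y. to_mult (x \<otimes> \<sigma> y))" and bil2: "cbilinear (\<lambda>x y. to_mult (\<sigma> x \<otimes> y))"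
    unfolding cbilinear_def clinear_iff
    by (simp_all add: clinearD[OF \<sigma>(1)] clinearD[OF clinear_to_mult] tens_bilinear)
  have lift1: "tensor_lift (\<lambda>x y. to_mult (x \<otimes> \<sigma> y)) w = to_mult (tensor_map (\<lambda>x. x) \<sigma> w)" for w
    by (induction w)
       (simp_all add: tensor_lift_tens[OF bil1] clinearD(1)[OF clinear_tensor_lift[OF bil1]]
         tensor_map(2)[OF clinear_ident \<sigma>(1)] clinearD(1)[OF tensor_map(1)[OF clinear_ident \<sigma>(1)]] clinearD(1)[OF clinear_to_mult])
  have lift2: "tensor_lift (\<lambda>x y. to_mult (\<sigma> x \<otimes> y)) w = to_mult (tensor_map \<sigma> (\<lambda>x. x) w)" for w
    by (induction w)
       (simp_all add: tensor_lift_tens[OF bil2] clinearD(1)[OF clinear_tensor_lift[OF bil2]]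
         tensor_map(2)[OF \<sigma>(1) clinear_ident] clinearD(1)[OF tensor_map(1)[OF \<sigma>(1) clinear_ident]] clinearD(1)[OF clinear_to_mult])
  from antipode obtain R\<^sub>1 R\<^sub>2 where R: "clinear R\<^sub>1" "clinear R\<^sub>2"
    and R3: "\<forall>a b c. (to_mult c \<otimes>\<^sub>M 1) * to_mult (R\<^sub>1 (a \<otimes> b))
        = tensor_lift (\<lambda>x y. to_mult x \<otimes>\<^sub>M S y) (T2 \<Delta> (c \<otimes> a)) * (1 \<otimes>\<^sub>M to_mult b)"
    and R4: "\<forall>a b c. to_mult (R\<^sub>2 (a \<otimes> b)) * (1 \<otimes>\<^sub>M to_mult c)
        = (to_mult a \<otimes>\<^sub>M 1) * tensor_lift (\<lambda>x y. S x \<otimes>\<^sub>M to_mult y) (T1 \<Delta> (b \<otimes> c))"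
    and R5: "\<forall>a b. lact E (a \<otimes> b) = T1 \<Delta> (R\<^sub>1 (a \<otimes> b))"
    and R6: "\<forall>a b. ract (a \<otimes> b) E = T2 \<Delta> (R\<^sub>2 (a \<otimes> b))"
    and R7: "\<forall>a b. tensor_lift (\<lambda>x y. lact (S x) y) (T1 \<Delta> (R\<^sub>1 (a \<otimes> b))) = lact (S a) b"
    unfolding antipode_def by (elim conjE exE) (rule that; assumption)
  have "mul_l1 c (R\<^sub>1 (a \<otimes> b)) = tensor_map (\<lambda>x. x) (\<lambda>y. \<sigma> y * b) (T2 \<Delta> (c \<otimes> a))" for a b c
  proof -
    have "mul_l1 c (R\<^sub>1 (a \<otimes> b)) = mul_r2 b (tensor_map (\<lambda>x. x) \<sigma> (T2 \<Delta> (c \<otimes> a)))"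
      using R3[rule_format, of c a b] by (simp add: to_mult_\<sigma> to_mult_tens lift1 to_mult_mult(2,3) lact_mul to_mult_eq_iff)
    then show ?thesis by (simp add: tensor_map_comp[OF clinear_ident clinear_mult(2) clinear_ident \<sigma>(1)])
  qed
  moreover have "mul_r2 c (R\<^sub>2 (a \<otimes> b)) = tensor_map (\<lambda>x. a * \<sigma> x) (\<lambda>y. y) (T1 \<Delta> (b \<otimes> c))" for a b c
  proof -
    have "mul_r2 c (R\<^sub>2 (a \<otimes> b)) = mul_l1 a (tensor_map \<sigma> (\<lambda>x. x) (T1 \<Delta> (b \<otimes> c)))"
      using R4[rule_format, of a b c] by (simp add: to_mult_\<sigma> to_mult_tens lift2 to_mult_mult(2,3) lact_mul to_mult_eq_iff)
    then show ?thesis by (simp add: tensor_map_comp[OF clinear_mult(1) clinear_ident \<sigma>(1) clinear_ident])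
  qed
  moreover have "mult_\<sigma>_first (lact E (a \<otimes> b)) = \<sigma> a * b" for a b
    using R7 by (simp add: to_mult_\<sigma> lact_simps(3)[abs_def] mult_\<sigma>_first_def R5)
  ultimately have "antipode_maps \<Delta> \<epsilon> E G\<^sub>1 G\<^sub>2 S R\<^sub>1 R\<^sub>2"
    by (intro antipode_maps.intro antipode_maps_axioms.intro regular_weak_multiplier_Hopf_algebra_axioms R
        R5[rule_format] R6[rule_format])
  then show thesis by (rule that)
qed

context antipode_maps
begin

text \<open>Since \<open>R\<^sub>1 (a \<otimes> S(u)) = \<Sum> a\<^sub>(\<^sub>1\<^sub>) \<otimes> S(u a\<^sub>(\<^sub>2\<^sub>))\<close>, applying \<open>S\<inverse>\<close> to the second leg exhibits
  \<open>(1 \<otimes> u) \<Delta>(a)\<close> as an element of \<open>A \<otimes> A\<close>; likewise \<open>R\<^sub>2\<close> yields \<open>\<Delta>(a) (c \<otimes> 1)\<close>. These two elements are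
  \<open>T3 u a\<close> and \<open>T4 a c\<close>.\<close>

definition T3 :: "'a \<Rightarrow> 'a \<Rightarrow> 'a tensor2" where
  "T3 u a = tensor_map (\<lambda>x. x) (inv \<sigma>) (R\<^sub>1 (a \<otimes> \<sigma> u))"

definition T4 :: "'a \<Rightarrow> 'a \<Rightarrow> 'a tensor2" where
  "T4 a c = tensor_map (inv \<sigma>) (\<lambda>x. x) (R\<^sub>2 (\<sigma> c \<otimes> a))"

lemma clinear_T3: "clinear (T3 u)"
  unfolding T3_def[abs_def]
  by (intro clinear_tensor_map clinear_compose[OF R1_linear] clinear_intros clinear_inv_\<sigma>)

lemma R1_eq_T3: "R\<^sub>1 (a \<otimes> \<sigma> u) = tensor_map (\<lambda>x. x) \<sigma> (T3 u a)"
  by (simp add: T3_def tensor_map_comp clinear_ident \<sigma> clinear_inv_\<sigma> inv_\<sigma> tensor_map_ident)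

lemma to_mult_T3: "to_mult (T3 u a) = (1 \<otimes>\<^sub>M to_mult u) * \<Delta> a"
proof (rule mtens_one_cancel(1)[OF nondegenerate nondegenerate])
  fix c
  have "mul_l1 c (T3 u a) = tensor_map (\<lambda>x. x) (inv \<sigma>) (mul_l1 c (R\<^sub>1 (a \<otimes> \<sigma> u)))"
    by (simp add: T3_def tensor_map_comp clinear_ident clinear_mult clinear_inv_\<sigma>)
  also have "\<dots> = tensor_map (\<lambda>x. x) (inv \<sigma>) (tensor_map (\<lambda>x. x) (\<lambda>y. \<sigma> y * \<sigma> u) (T2 \<Delta> (c \<otimes> a)))"
    by (simp only: mul_l1_R1)
  also have "\<dots> = mul_l2 u (T2 \<Delta> (c \<otimes> a))"
    unfolding \<sigma>(2)[symmetric]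
    by (simp add: tensor_map_comp[OF clinear_ident clinear_inv_\<sigma> clinear_ident clinear_compose[OF \<sigma>(1) clinear_mult(1)]] inv_\<sigma>)
  finally have "(to_mult c \<otimes>\<^sub>M 1) * to_mult (T3 u a) = (1 \<otimes>\<^sub>M to_mult u) * to_mult (T2 \<Delta> (c \<otimes> a))"
    by (simp add: to_mult_mult(2) lact_mul)
  also have "\<dots> = (to_mult c \<otimes>\<^sub>M 1) * ((1 \<otimes>\<^sub>M to_mult u) * \<Delta> a)"
    by (simp add: T2(2) mult.assoc[symmetric] mtens_mult)
  finally show "(to_mult c \<otimes>\<^sub>M 1) * to_mult (T3 u a) = (to_mult c \<otimes>\<^sub>M 1) * ((1 \<otimes>\<^sub>M to_mult u) * \<Delta> a)" .
qed

lemma to_mult_T4: "to_mult (T4 a c) = \<Delta> a * (to_mult c \<otimes>\<^sub>M 1)"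
proof (rule mtens_one_cancel(2)[OF nondegenerate nondegenerate])
  fix e
  have "mul_r2 e (T4 a c) = tensor_map (inv \<sigma>) (\<lambda>x. x) (mul_r2 e (R\<^sub>2 (\<sigma> c \<otimes> a)))"
    by (simp add: T4_def tensor_map_comp clinear_ident clinear_mult clinear_inv_\<sigma>)
  also have "\<dots> = tensor_map (inv \<sigma>) (\<lambda>x. x) (tensor_map (\<lambda>x. \<sigma> c * \<sigma> x) (\<lambda>x. x) (T1 \<Delta> (a \<otimes> e)))"
    by (simp only: mul_r2_R2)
  also have "\<dots> = mul_r1 c (T1 \<Delta> (a \<otimes> e))"
    unfolding \<sigma>(2)[symmetric]
    by (simp add: tensor_map_comp[OF clinear_inv_\<sigma> clinear_ident clinear_compose[OF \<sigma>(1) clinear_mult(2)] clinear_ident] inv_\<sigma>)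
  finally have "to_mult (T4 a c) * (1 \<otimes>\<^sub>M to_mult e) = to_mult (T1 \<Delta> (a \<otimes> e)) * (to_mult c \<otimes>\<^sub>M 1)"
    by (simp add: to_mult_mult(3) lact_mul)
  also have "\<dots> = \<Delta> a * (to_mult c \<otimes>\<^sub>M 1) * (1 \<otimes>\<^sub>M to_mult e)"
    by (simp add: T1(2) mult.assoc mtens_mult)
  finally show "to_mult (T4 a c) * (1 \<otimes>\<^sub>M to_mult e) = \<Delta> a * (to_mult c \<otimes>\<^sub>M 1) * (1 \<otimes>\<^sub>M to_mult e)" .
qed

lemma mul_r2_T3: "mul_r2 e (T3 u a) = mul_l2 u (T1 \<Delta> (a \<otimes> e))"
  by (simp add: to_mult_eq_iff[symmetric] lact_mul[symmetric] to_mult_mult[symmetric] to_mult_T3 T1 mult.assoc)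

text \<open>Both sides are \<open>\<Sum> d p\<^sub>(\<^sub>1\<^sub>) \<otimes> p\<^sub>(\<^sub>2\<^sub>) \<otimes> u p\<^sub>(\<^sub>3\<^sub>)\<close>. Multiplying the third leg by \<open>e\<close> from the right
  reduces the claim to the coassociativity axiom, where \<open>e\<close> is the covering factor.\<close>

lemma coassociative_T3:
  "tensor_assoc (tensor_map (\<lambda>x. T2 \<Delta> (d \<otimes> x)) (\<lambda>x. x) (T3 u p)) = tensor_map (\<lambda>x. x) (T3 u) (T2 \<Delta> (d \<otimes> p))"
proof -
  let ?T2 = "\<lambda>x. T2 \<Delta> (d \<otimes> x)"
  have c2: "clinear ?T2" by (rule clinear_compose[OF T2(1)]) (intro clinear_intros)
  have c1: "clinear (\<lambda>y. T1 \<Delta> (y \<otimes> e))" for e by (rule clinear_compose[OF T1(1)]) (intro clinear_intros)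
  have leg3: "tensor_map (\<lambda>x. x) (tensor_map (\<lambda>x. x) k) (tensor_assoc (tensor_map ?T2 (\<lambda>x. x) t))
      = tensor_assoc (tensor_map ?T2 (\<lambda>x. x) (tensor_map (\<lambda>x. x) k t))" if k: "clinear k" for k :: "'a \<Rightarrow> 'a" and t
    by (simp only: tensor_assoc_map[OF clinear_ident clinear_ident k] tensor_map_ident[abs_def]
        tensor_map_comp[OF clinear_ident k c2 clinear_ident] tensor_map_comp[OF c2 clinear_ident clinear_ident k])
  have "tensor_map (\<lambda>x. x) (mul_r2 e) (tensor_assoc (tensor_map ?T2 (\<lambda>x. x) (T3 u p)))
      = tensor_map (\<lambda>x. x) (mul_r2 e) (tensor_map (\<lambda>x. x) (T3 u) (T2 \<Delta> (d \<otimes> p)))" for e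
  proof -
    have "tensor_map (\<lambda>x. x) (mul_r2 e) (tensor_assoc (tensor_map ?T2 (\<lambda>x. x) (T3 u p)))
       = tensor_map (\<lambda>x. x) (mul_l2 u) (tensor_assoc (tensor_map ?T2 (\<lambda>x. x) (T1 \<Delta> (p \<otimes> e))))"
      by (simp only: leg3 clinear_mult mul_r2_T3)
    also have "\<dots> = tensor_map (\<lambda>x. x) (\<lambda>y. mul_l2 u (T1 \<Delta> (y \<otimes> e))) (T2 \<Delta> (d \<otimes> p))"
      by (simp only: coassociative tensor_map_comp[OF clinear_ident clinear_mul(2) clinear_ident c1])
    also have "\<dots> = tensor_map (\<lambda>x. x) (mul_r2 e) (tensor_map (\<lambda>x. x) (T3 u) (T2 \<Delta> (d \<otimes> p)))"
      by (simp only: mul_r2_T3 tensor_map_comp[OF clinear_ident clinear_mul(4) clinear_ident clinear_T3])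
    finally show ?thesis .
  qed
  then have diff: "tensor_map (\<lambda>x. x) (mul_r2 e)
      (tensor_assoc (tensor_map ?T2 (\<lambda>x. x) (T3 u p)) - tensor_map (\<lambda>x. x) (T3 u) (T2 \<Delta> (d \<otimes> p))) = 0" for e
    by (rule tensor_map_diff[OF clinear_ident clinear_mul(4)])
  have inj: "w = 0" if "\<And>c. mul_r2 c w = 0" for w :: "'a tensor2"
    using mul_second_cancel(2)[OF nondegenerate, of w 0] by (simp add: that clinearD(3)[OF clinear_mul(4)])
  have "tensor_assoc (tensor_map ?T2 (\<lambda>x. x) (T3 u p)) - tensor_map (\<lambda>x. x) (T3 u) (T2 \<Delta> (d \<otimes> p)) = 0"
    by (rule tensor_map_second_cancel[where F=mul_r2, OF clinear_mul(4) inj diff])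
  then show ?thesis by simp
qed

text \<open>The element \<open>\<epsilon>\<^sub>t(a) u = \<Sum> a\<^sub>(\<^sub>1\<^sub>) S(a\<^sub>(\<^sub>2\<^sub>)) u\<close>.\<close>

definition target :: "'a \<Rightarrow> 'a \<Rightarrow> 'a" where
  "target a u = tensor_lift (*) (R\<^sub>1 (a \<otimes> u))"

lemma bilinear_times: "cbilinear ((*) :: 'a \<Rightarrow> 'a \<Rightarrow> 'a)"
  unfolding cbilinear_def by (intro conjI allI clinear_mult)

lemma target_T3: "target a (\<sigma> u) = mult_\<sigma>_second (T3 u a)"
proof -
  have "tensor_lift (*) (tensor_map (\<lambda>x. x) \<sigma> w) = mult_\<sigma>_second w" for w
    by (induction w)
       (simp_all add: tensor_map clinear_ident \<sigma> tensor_lift_tens[OF bilinear_times] mult_\<sigma>_second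
         clinearD(1)[OF clinear_tensor_lift[OF bilinear_times]] clinearD(1)[OF tensor_map(1)] clinearD(1)[OF mult_\<sigma>_second(1)])
  then show ?thesis by (simp add: target_def R1_eq_T3)
qed

lemma mult_target: "b * target a u = mult_\<sigma>_second (T2 \<Delta> (b \<otimes> a)) * u"
proof -
  have "tensor_lift (*) (mul_l1 b w) = b * tensor_lift (*) w" for w :: "'a tensor2"
    by (induction w)
       (simp_all add: mul_tens mul_add tensor_lift_tens[OF bilinear_times] mult.assoc distrib_left
         clinearD(1)[OF clinear_tensor_lift[OF bilinear_times]])
  moreover have c: "clinear (\<lambda>y. \<sigma> y * u)" by (intro clinear_intros \<sigma>)
  have "tensor_lift (*) (tensor_map (\<lambda>x. x) (\<lambda>y. \<sigma> y * u) w) = mult_\<sigma>_second w * u" for w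
    by (induction w)
       (simp_all add: tensor_map[OF clinear_ident c] tensor_lift_tens[OF bilinear_times] mult.assoc distrib_right mult_\<sigma>_second
         clinearD(1)[OF clinear_tensor_lift[OF bilinear_times]] clinearD(1)[OF tensor_map(1)[OF clinear_ident c]]
         clinearD(1)[OF mult_\<sigma>_second(1)])
  ultimately show ?thesis
    unfolding target_def by (metis mul_l1_R1)
qed

text \<open>Together with \<open>b \<mapsto> \<Sum> b a\<^sub>(\<^sub>1\<^sub>) S(a\<^sub>(\<^sub>2\<^sub>))\<close>, the map \<open>target a\<close> is a multiplier by \<open>mult_target\<close>, and
  this multiplier is the one that the description of \<^const>\<open>target_counit\<close> singles out.\<close>

lemma lact_target_counit: "lact (target_counit \<Delta> S a) u = target a u"
proof -
  have bil: "cbilinear (\<lambda>x y. to_mult (x * \<sigma> y))"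
    unfolding cbilinear_def clinear_iff
    by (simp add: clinearD[OF \<sigma>(1)] clinearD[OF clinear_to_mult] distrib_left distrib_right mult_scaleC_left mult_scaleC_right)
  have "to_mult x * S y = to_mult (x * \<sigma> y)" for x y
    using to_mult_\<sigma>[of y] by (simp only: to_mult_mult(1))
  then have S: "(\<lambda>x y. to_mult x * S y) = (\<lambda>x y. to_mult (x * \<sigma> y))"
    by (intro ext)
  have lift: "tensor_lift (\<lambda>x y. to_mult x * S y) w = to_mult (mult_\<sigma>_second w)" for w
    unfolding S
    by (induction w)
       (simp_all add: tensor_lift_tens[OF bil] clinearD(1)[OF clinear_tensor_lift[OF bil]]
         mult_\<sigma>_second clinearD(1)[OF mult_\<sigma>_second(1)] clinearD(1)[OF clinear_to_mult])
  obtain m where m: "\<And>u. lact m u = target a u" "\<And>b. ract b m = mult_\<sigma>_second (T2 \<Delta> (b \<otimes> a))"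
    using multiplier_of_pair[OF nondegenerate mult_target] by blast
  have "target_counit \<Delta> S a = m"
  proof -
    have "(\<forall>b. to_mult b * n = tensor_lift (\<lambda>x y. to_mult x * S y) (T2 \<Delta> (b \<otimes> a))) \<longleftrightarrow> n = m" for n
      unfolding lift unfolding to_mult_mult(3) inj_eq[OF inj_to_mult[OF nondegenerate]]
      by (auto intro!: ract_cong_nondegenerate[OF nondegenerate] simp: m)
    then show ?thesis unfolding target_counit_def by simp
  qed
  then show ?thesis by (simp add: m)
qed

text \<open>In Sweedler notation \<open>E (p \<otimes> u) = \<Sum> p\<^sub>(\<^sub>1\<^sub>) \<otimes> p\<^sub>(\<^sub>2\<^sub>) S(p\<^sub>(\<^sub>3\<^sub>)) u = \<Sum> p\<^sub>(\<^sub>1\<^sub>) \<otimes> \<epsilon>\<^sub>t(p\<^sub>(\<^sub>2\<^sub>)) u\<close>. The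
  two groupings of the legs agree by coassociativity.\<close>

lemma mul_l1_lact_E:
  "mul_l1 d (lact E (p \<otimes> u)) = tensor_map (\<lambda>x. x) (\<lambda>y. target y u) (T2 \<Delta> (d \<otimes> p))"
proof -
  obtain v where u: "u = \<sigma> v" using inv_\<sigma>(2) by metis
  let ?T2 = "\<lambda>x. T2 \<Delta> (d \<otimes> x)"
  have c2: "clinear ?T2" by (rule clinear_compose[OF T2(1)]) (intro clinear_intros)
  note cm = tensor_map(1)[OF clinear_ident mult_\<sigma>_second(1)]
  have a: "tensor_map (\<lambda>x. x) mult_\<sigma>_second (tensor_assoc (w \<otimes> y)) = mul_r2 (\<sigma> y) w" for w :: "'a tensor2" and y
    by (induction w)
       (simp_all add: tensor_assoc(2) tensor_map[OF clinear_ident mult_\<sigma>_second(1)] mult_\<sigma>_second mul_tens tens_bilinear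
         mul_add clinearD(1)[OF tensor_assoc(1)] clinearD(1)[OF cm])
  have "tensor_map (\<lambda>x. x) mult_\<sigma>_second (tensor_assoc (tensor_map ?T2 (\<lambda>x. x) t))
      = mul_l1 d (T1 \<Delta> (tensor_map (\<lambda>x. x) \<sigma> t))" for t
    by (induction t)
       (simp_all add: tensor_map(2)[OF c2 clinear_ident] tensor_map(2)[OF clinear_ident \<sigma>(1)] a mul_l1_T1 mul_add
         clinearD(1)[OF tensor_assoc(1)] clinearD(1)[OF cm] clinearD(1)[OF T1(1)]
         clinearD(1)[OF tensor_map(1)[OF c2 clinear_ident]] clinearD(1)[OF tensor_map(1)[OF clinear_ident \<sigma>(1)]])
  from this[of "T3 v p"] show ?thesis
    by (simp add: coassociative_T3 R1_eq_T3[symmetric] lact_E[symmetric] u target_T3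
        tensor_map_comp[OF clinear_ident mult_\<sigma>_second(1) clinear_ident clinear_T3])
qed

section \<open>Left cointegrals\<close>

lemma cointegral_mult:
  assumes "left_cointegral \<Delta> S (to_mult h)"
  shows "target a h = a * h"
proof -
  have "to_mult (a * h) = to_mult (target a h)"
    using assms by (simp add: left_cointegral_def to_mult_mult(1) to_mult_mult(2)[symmetric] lact_target_counit[symmetric])
  then show ?thesis by (simp add: inj_eq[OF inj_to_mult[OF nondegenerate]])
qed

text \<open>By \<open>mul_l1_lact_E\<close> and \<open>p h = \<epsilon>\<^sub>t(p) h\<close> both sides are \<open>\<Sum> p\<^sub>(\<^sub>1\<^sub>) \<otimes> p\<^sub>(\<^sub>2\<^sub>) h\<close>.\<close>

lemma cointegral_E:
  assumes h: "left_cointegral \<Delta> S (to_mult h)"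
  shows "lact E (p \<otimes> h) = T1 \<Delta> (p \<otimes> h)"
  by (rule mul_first_cancel(1)[OF nondegenerate]) (simp add: mul_l1_lact_E mul_l1_T1 cointegral_mult[OF h])

text \<open>With \<open>E (p \<otimes> h) = \<Sum> p\<^sub>(\<^sub>1\<^sub>) \<otimes> p\<^sub>(\<^sub>2\<^sub>) h\<close>, the identity \<open>coproduct_slice_E\<close> reads
  \<open>\<Sum> p\<^sub>(\<^sub>1\<^sub>) \<otimes> \<Delta>(p\<^sub>(\<^sub>2\<^sub>) h) = (E \<otimes> 1) (p \<otimes> \<Delta>(h))\<close>. Contract the first two legs by \<open>x \<otimes> y \<mapsto> S(x) y\<close>. The
  right-hand side becomes \<open>(S(p) \<otimes> 1) \<Delta>(h)\<close>, and the left-hand side becomes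
  \<open>\<Sum> (S(p\<^sub>(\<^sub>1\<^sub>)) \<otimes> 1) \<Delta>(p\<^sub>(\<^sub>2\<^sub>)) \<Delta>(h) = (1 \<otimes> p) E \<Delta>(h) = (1 \<otimes> p) \<Delta>(h)\<close>.\<close>

lemma cointegral_move:
  assumes h: "left_cointegral \<Delta> S (to_mult h)"
  shows "(1 \<otimes>\<^sub>M to_mult p) * \<Delta> h = (to_mult (\<sigma> p) \<otimes>\<^sub>M 1) * \<Delta> h"
proof (rule mtens_one_cancel(1)[OF nondegenerate nondegenerate])
  fix c
  show "(to_mult c \<otimes>\<^sub>M 1) * ((1 \<otimes>\<^sub>M to_mult p) * \<Delta> h) = (to_mult c \<otimes>\<^sub>M 1) * ((to_mult (\<sigma> p) \<otimes>\<^sub>M 1) * \<Delta> h)"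
  proof (rule lact_cong_nondegenerate[OF nondegenerate2])
    fix w
    \<comment> \<open>the contraction \<open>x \<otimes> y \<otimes> z \<mapsto> S(x) y \<otimes> z\<close>\<close>
    let ?\<Phi> = "tensor_lift (\<lambda>y v. mul_l1 (\<sigma> y) v) :: 'a tensor3 \<Rightarrow> 'a tensor2"
    have "clinear (\<lambda>y. mul_l1 (\<sigma> y) v)" for v :: "'a tensor2"
    proof (induction v)
      case (tens x y)
      show ?case unfolding mul_tens by (intro clinear_intros \<sigma>)
    next
      case (add s t)
      then show ?case by (simp add: clinear_iff mul_add scaleC_add_right)
    qed
    then have bil: "cbilinear (\<lambda>y v. mul_l1 (\<sigma> y) (v :: 'a tensor2))"
      unfolding cbilinear_def by (intro conjI allI clinear_mul)
    note \<Phi> = tensor_lift_tens[OF bil] clinearD(1)[OF clinear_tensor_lift[OF bil]]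
    have cE: "clinear (\<lambda>u. lact E (p \<otimes> u))" by (intro clinear_intros)
    have cD: "clinear (\<lambda>z. lact (\<Delta> z) w)" by (simp add: clinear_iff clinearD[OF Delta(1)])
    have a: "?\<Phi> (tensor_assoc (v \<otimes> z)) = mult_\<sigma>_first v \<otimes> z" for v z
      by (induction v) (simp_all add: tensor_assoc(2) \<Phi> mul_tens mult_\<sigma>_first tens_bilinear
        clinearD(1)[OF tensor_assoc(1)] clinearD(1)[OF mult_\<sigma>_first(1)])
    have b: "?\<Phi> (tensor_assoc (tensor_map (\<lambda>u. lact E (p \<otimes> u)) (\<lambda>x. x) v)) = mul_l1 (\<sigma> p) v" for v
      by (induction v) (simp_all add: tensor_map(2)[OF cE clinear_ident] a mult_\<sigma>_first_E mul_tens \<Phi> mul_add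
        clinearD(1)[OF tensor_assoc(1)] clinearD(1)[OF tensor_map(1)[OF cE clinear_ident]])
    have d: "mul_l1 c (?\<Phi> (tensor_map (\<lambda>x. x) (\<lambda>z. lact (\<Delta> z) w) v)) = T2 \<Delta> (tensor_map (\<lambda>x. c * \<sigma> x) (\<lambda>x. x) v) * w" for v
    proof -
      have c\<sigma>: "clinear (\<lambda>x. c * \<sigma> x)" by (intro clinear_intros \<sigma>)
      have "mul_l1 (c * x) v = mul_l1 c (mul_l1 x v)" for x and v :: "'a tensor2"
        by (simp only: tensor_map_comp[OF clinear_mult(1) clinear_ident clinear_mult(1) clinear_ident] mult.assoc[symmetric])
      then show ?thesis
        by (induction v) (simp_all add: tensor_map(2)[OF clinear_ident cD] tensor_map(2)[OF c\<sigma> clinear_ident] \<Phi> T2_mult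
          mul_add distrib_right clinearD(1)[OF T2(1)] clinearD(1)[OF tensor_map(1)[OF c\<sigma> clinear_ident]]
          clinearD(1)[OF tensor_map(1)[OF clinear_ident cD]])
    qed
    have e: "T2 \<Delta> (mul_r2 h v) = ract (T2 \<Delta> v) (\<Delta> h)" for v
    proof (induction v)
      case (tens x y)
      have "to_mult (T2 \<Delta> (x \<otimes> (y * h))) = to_mult (T2 \<Delta> (x \<otimes> y)) * \<Delta> h"
        by (simp add: T2(2) Delta(2) mult.assoc)
      then show ?case by (simp add: mul_tens to_mult_mult(3) to_mult_eq_iff)
    qed (simp add: mul_add clinearD(1)[OF T2(1)] clinearD(1)[OF ract(1)])
    have "mul_l1 c (mul_l1 (\<sigma> p) (lact (\<Delta> h) w))
        = mul_l1 c (?\<Phi> (tensor_map (\<lambda>x. x) (\<lambda>z. lact (\<Delta> z) w) (lact E (p \<otimes> h))))"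
      by (simp only: coproduct_slice_E b)
    also have "\<dots> = T2 \<Delta> (tensor_map (\<lambda>x. c * \<sigma> x) (\<lambda>x. x) (T1 \<Delta> (p \<otimes> h))) * w"
      by (simp only: cointegral_E[OF h] d)
    also have "\<dots> = T2 \<Delta> (mul_r2 h (R\<^sub>2 (c \<otimes> p))) * w"
      by (simp only: mul_r2_R2)
    also have "\<dots> = ract (ract (c \<otimes> p) E) (\<Delta> h) * w"
      by (simp only: e ract_E)
    also have "\<dots> = ract (c \<otimes> p) (\<Delta> h) * w"
      using arg_cong[OF E_Delta[of h], of "ract (c \<otimes> p)"] by simp
    also have "\<dots> = mul_l1 c (mul_l2 p (lact (\<Delta> h) w))"
      by (simp only: lact_ract[symmetric] tens_mult_left[symmetric] tensor_map_comp clinear_mult clinear_ident)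
    finally show "lact ((to_mult c \<otimes>\<^sub>M 1) * ((1 \<otimes>\<^sub>M to_mult p) * \<Delta> h)) w
        = lact ((to_mult c \<otimes>\<^sub>M 1) * ((to_mult (\<sigma> p) \<otimes>\<^sub>M 1) * \<Delta> h)) w"
      by (simp add: lact_mul)
  qed
qed

end

locale faithful_left_cointegral = antipode_maps +
  fixes h :: 'a
  assumes cointegral: "left_cointegral \<Delta> S (to_mult h)"
    and faithful: "faithful_cointegral \<Delta> h"
begin

lemma T3_mult: "mul_l2 b (T3 a h) = T3 (b * a) h"
proof -
  have "to_mult (mul_l2 b (T3 a h)) = to_mult (T3 (b * a) h)"
    by (simp add: lact_mul[symmetric] to_mult_mult(2)[symmetric] to_mult_T3 mult.assoc[symmetric] mtens_mult to_mult_mult(1))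
  then show ?thesis by (simp add: to_mult_eq_iff)
qed

lemma T3_move: "mul_l1 (\<sigma> a) (T3 b h) = T3 (b * a) h"
proof -
  have "(to_mult (\<sigma> a) \<otimes>\<^sub>M 1) * ((1 \<otimes>\<^sub>M to_mult b) * \<Delta> h) = (1 \<otimes>\<^sub>M to_mult b) * ((to_mult (\<sigma> a) \<otimes>\<^sub>M 1) * \<Delta> h)"
    by (simp add: mult.assoc[symmetric] mtens_mult)
  also have "\<dots> = (1 \<otimes>\<^sub>M to_mult (b * a)) * \<Delta> h"
    by (simp add: cointegral_move[OF cointegral, symmetric]) (simp add: mult.assoc[symmetric] mtens_mult to_mult_mult(1))
  finally have "to_mult (mul_l1 (\<sigma> a) (T3 b h)) = to_mult (T3 (b * a) h)"
    by (simp add: lact_mul[symmetric] to_mult_mult(2)[symmetric] to_mult_T3)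
  then show ?thesis by (simp add: to_mult_eq_iff)
qed

lemma T3_eq_T2: "T3 a h = T2 \<Delta> (\<sigma> a \<otimes> h)"
proof -
  have "to_mult (T3 a h) = to_mult (T2 \<Delta> (\<sigma> a \<otimes> h))"
    by (simp add: to_mult_T3 T2(2) cointegral_move[OF cointegral])
  then show ?thesis by (simp add: to_mult_eq_iff)
qed

lemma T4_move: "mul_l2 e (T4 h c) = mul_l1 (\<sigma> e) (T4 h c)"
proof -
  have "to_mult (mul_l2 e (T4 h c)) = to_mult (mul_l1 (\<sigma> e) (T4 h c))"
    by (simp add: lact_mul[symmetric] to_mult_mult(2)[symmetric] to_mult_T4 mult.assoc[symmetric] cointegral_move[OF cointegral])
  then show ?thesis by (simp add: to_mult_eq_iff)
qed

lemma mul_l1_T4: "mul_l1 c (T4 a b) = mul_r1 b (T2 \<Delta> (c \<otimes> a))"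
proof -
  have "to_mult (mul_l1 c (T4 a b)) = to_mult (mul_r1 b (T2 \<Delta> (c \<otimes> a)))"
    by (simp add: lact_mul[symmetric] to_mult_mult(2,3)[symmetric] to_mult_T4 T2(2) mult.assoc)
  then show ?thesis by (simp add: to_mult_eq_iff)
qed

text \<open>The slice of \<open>\<Delta>(h)\<close> is described by its products with \<open>b\<close> on both sides. If the products on one side
  vanish, then so do those on the other, because \<open>c (((id \<otimes> f) \<Delta>(h)) b) = (c ((id \<otimes> f) \<Delta>(h))) b\<close>.\<close>

lemma faithful_second:
  assumes f: "clinear f" and T2_0: "\<And>c. slice_second f (T2 \<Delta> (c \<otimes> h)) = 0"
  shows "f = (\<lambda>_. 0)"
proof -
  have T4: "slice_second f (T4 h b) = 0" for b
    by (rule nondegenerateD(2)[OF nondegenerate]) (simp add: slice_mul[OF f, symmetric] mul_l1_T4, simp add: slice_mul[OF f] T2_0)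
  have "slice_id_f f (\<Delta> h) = 0"
    unfolding slice_id_f_def slice_second_def[symmetric] to_mult_T4[symmetric] T2(2)[symmetric]
      from_mult_to_mult[OF nondegenerate2] T2_0 T4
    by (rule the_equality) (auto intro: multiplier_eqI)
  then show ?thesis using faithful f by (auto simp: faithful_cointegral_def)
qed

lemma faithful_second_T4:
  assumes f: "clinear f" and T4: "\<And>c. slice_second f (T4 h c) = 0"
  shows "f = (\<lambda>_. 0)"
proof (rule faithful_second[OF f])
  show "slice_second f (T2 \<Delta> (c \<otimes> h)) = 0" for c
    by (rule nondegenerateD(1)[OF nondegenerate]) (simp add: slice_mul[OF f, symmetric] mul_l1_T4[symmetric], simp add: slice_mul[OF f] T4)
qed

lemma faithful_first:
  assumes f: "clinear f" and T3: "\<And>b. slice_first f (T3 b h) = 0"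
  shows "f = (\<lambda>_. 0)"
proof -
  have T1_0: "slice_first f (T1 \<Delta> (h \<otimes> b)) = 0" for b
    by (rule nondegenerateD(2)[OF nondegenerate]) (simp add: slice_mul[OF f, symmetric] mul_r2_T3[symmetric], simp add: slice_mul[OF f] T3)
  have "slice_f_id f (\<Delta> h) = 0"
    unfolding slice_f_id_def slice_first_def[symmetric] to_mult_T3[symmetric] T1(2)[symmetric]
      from_mult_to_mult[OF nondegenerate2] T1_0 T3
    by (rule the_equality) (auto intro: multiplier_eqI)
  then show ?thesis using faithful f by (auto simp: faithful_cointegral_def)
qed

text \<open>A functional that kills all first-leg slices has vanishing second-leg slices, so this turns
  faithfulness into a spanning statement.\<close>

lemma span_slices:
  fixes t :: "'c \<Rightarrow> 'a tensor2"
  assumes "\<And>f. clinear f \<Longrightarrow> (\<And>c. slice_second f (t c) = 0) \<Longrightarrow> f = (\<lambda>_. 0)"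
  shows "complex_vector.span {slice_first \<omega> (t c) | \<omega> c. clinear \<omega>} = (UNIV :: 'a set)"
proof (rule span_eq_UNIV_functional)
  fix f :: "'a \<Rightarrow> complex"
  assume f: "clinear f" and *: "\<And>x. x \<in> {slice_first \<omega> (t c) | \<omega> c. clinear \<omega>} \<Longrightarrow> f x = 0"
  show "f = (\<lambda>_. 0)"
  proof (rule assms[OF f])
    show "slice_second f (t c) = 0" for c
    proof (rule functionals_separate)
      fix \<omega> :: "'a \<Rightarrow> complex" assume \<omega>: "clinear \<omega>"
      have "f (slice_first \<omega> (t c)) = 0" using \<omega> by (intro *) blast
      then show "\<omega> (slice_second f (t c)) = 0" by (simp add: slice_slice[OF \<omega> f])
    qed
  qed
qed

section \<open>Local units\<close>

text \<open>The second leg of \<open>E (p \<otimes> x) = T\<^sub>1 (R\<^sub>1 (p \<otimes> x))\<close> lies in \<open>A x\<close>, because \<open>R\<^sub>1\<close> and \<open>T\<^sub>1\<close> both multiply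
  the second factor from the left only.\<close>

lemma lact_E_in_ideal:
  assumes f: "clinear f" and fx: "\<And>r. f (r * x) = 0"
  shows "slice_second f (lact E (p \<otimes> x)) = 0"
proof -
  let ?X = "range (\<lambda>r. r * x)"
  have X: "complex_vector.subspace ?X"
    by (rule complex_vector.subspaceI)
       (auto simp: distrib_right[symmetric] mult_scaleC_left[symmetric] image_iff intro: exI[of _ 0])
  have R1: "slice_second g (R\<^sub>1 (p \<otimes> x)) = 0" if g: "clinear g" and gx: "\<forall>y\<in>?X. g y = 0" for g
  proof (rule nondegenerateD(2)[OF nondegenerate])
    fix c
    have c: "clinear (\<lambda>y. \<sigma> y * x)" by (intro clinear_intros \<sigma>)
    have zero: "(\<lambda>y. g (\<sigma> y * x)) = (\<lambda>_. 0)" using gx by auto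
    show "c * slice_second g (R\<^sub>1 (p \<otimes> x)) = 0"
      by (simp add: slice_mul[OF g, symmetric] mul_l1_R1 slice_second_map[OF g clinear_ident c] zero slice_second_zero)
  qed
  obtain F where F: "finite F" "\<forall>f. clinear f \<longrightarrow> (\<forall>y\<in>F. f y = 0) \<longrightarrow> slice_second f (R\<^sub>1 (p \<otimes> x)) = 0"
    using finite_second_leg by blast
  obtain B \<beta> where B: "finite B" "B \<subseteq> ?X" "R\<^sub>1 (p \<otimes> x) = (\<Sum>b\<in>B. slice_second (\<beta> b) (R\<^sub>1 (p \<otimes> x)) \<otimes> b)"
    using finite_expansion_in_subspace[OF F(1) X] F(2) R1 by blast
  have "slice_second f (T1 \<Delta> (a \<otimes> b)) = 0" if "b \<in> ?X" for a b
  proof (rule nondegenerateD(2)[OF nondegenerate])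
    fix c
    obtain r where b: "b = r * x" using \<open>b \<in> ?X\<close> by blast
    have "(\<lambda>y. f (y * b)) = (\<lambda>_. 0)" by (simp add: b mult.assoc[symmetric] fx)
    then have "slice_second f (mul_r2 b w) = 0" for w :: "'a tensor2"
      by (simp add: slice_second_map[OF f clinear_ident clinear_mult(2)] slice_second_zero)
    then show "c * slice_second f (T1 \<Delta> (a \<otimes> b)) = 0"
      by (simp add: slice_mul[OF f, symmetric] mul_l1_T1)
  qed
  then have "slice_second f (T1 \<Delta> (\<Sum>b\<in>B. slice_second (\<beta> b) (R\<^sub>1 (p \<otimes> x)) \<otimes> b)) = 0"
    using B(2) by (simp add: clinear_sum[OF T1(1)] clinear_sum[OF slice_second(1)[OF f]] subset_iff sum.neutral)
  then show ?thesis
    using B(3) by (simp add: lact_E)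
qed

text \<open>The condition that \<open>E (1 \<otimes> x)\<close> belongs to \<open>M(A) \<otimes> span F\<close> for a finite set \<open>F\<close>. Here \<open>L a\<close> is the
  element \<open>(a \<otimes> 1) E (1 \<otimes> x)\<close> of \<open>A \<otimes> A\<close>; it is crucial that \<open>F\<close> does not depend on \<open>a\<close>.\<close>

definition finite_right_leg :: "'a \<Rightarrow> bool" where
  "finite_right_leg x \<longleftrightarrow> (\<exists>L F. finite F
     \<and> (\<forall>a f. clinear f \<longrightarrow> (\<forall>y\<in>F. f y = 0) \<longrightarrow> slice_second f (L a) = 0)
     \<and> (\<forall>a p. mul_r1 p (L a) = mul_l1 a (lact E (p \<otimes> x))))"

text \<open>For \<open>t = \<Delta>(h) (c \<otimes> 1) = \<Sum> v\<^sub>j \<otimes> q\<^sub>j\<close> and \<open>x = (\<omega> \<otimes> id) t\<close>, moving the second leg of \<open>E\<close> across \<open>t\<close>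
  gives \<open>(a \<otimes> 1) E (1 \<otimes> x) = \<Sum> a E\<^sub>1 \<omega>(S(E\<^sub>2) v\<^sub>j) \<otimes> q\<^sub>j\<close>. Since \<open>S(E\<^sub>2) v\<^sub>j = S(S\<inverse>(v\<^sub>j) E\<^sub>2)\<close>, the
  first legs \<open>\<nu> a v\<^sub>j\<close> are slices of \<open>(a \<otimes> S\<inverse>(v\<^sub>j)) E \<in> A \<otimes> A\<close>, and the \<open>q\<^sub>j\<close> do not depend on \<open>a\<close>.\<close>

lemma finite_right_leg_slice:
  assumes \<omega>: "clinear \<omega>"
  shows "finite_right_leg (slice_first \<omega> (T4 h c))"
proof -
  define t where "t = T4 h c"
  let ?x = "slice_first \<omega> t"
  have \<omega>\<sigma>: "clinear (\<lambda>e. \<omega> (\<sigma> e * v))" for v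
    by (intro clinear_compose[OF \<omega>] clinear_intros \<sigma>)
  have \<omega>\<sigma>': "clinear (\<lambda>e. \<omega> (\<sigma> e))" by (rule clinear_compose[OF \<omega> \<sigma>(1)])
  define \<nu> where "\<nu> a v = slice_second (\<lambda>e. \<omega> (\<sigma> e)) (ract (a \<otimes> inv \<sigma> v) E)" for a v
  have \<nu>: "clinear (\<nu> a)" for a
    unfolding \<nu>_def[abs_def] by (intro clinear_slices \<omega>\<sigma>' clinear_intros clinear_inv_\<sigma>)
  have \<nu>_mult: "\<nu> a (\<sigma> e * v) = slice_second (\<lambda>e'. \<omega> (\<sigma> e' * v)) (ract (a \<otimes> e) E)" for a e v
  proof -
    have "inv \<sigma> (\<sigma> e * v) = inv \<sigma> v * e"
      using \<sigma>(2)[of "inv \<sigma> v" e] inv_\<sigma>(1)[of "inv \<sigma> v * e"] by (simp add: inv_\<sigma>(2))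
    moreover have "ract (a \<otimes> (inv \<sigma> v * e)) E = mul_l2 (inv \<sigma> v) (ract (a \<otimes> e) E)"
      using ract_mul_l2[of "inv \<sigma> v" "a \<otimes> e" E] by (simp add: mul_tens)
    ultimately show ?thesis
      by (simp add: \<nu>_def slice_second_map[OF \<omega>\<sigma>' clinear_ident clinear_mult(1)] \<sigma>(2) inv_\<sigma>(2))
  qed
  \<comment> \<open>with \<open>z = \<Sum> a\<^sub>i \<otimes> e\<^sub>i\<close>: expand \<open>e\<^sub>i x = (\<omega> \<otimes> id) ((S(e\<^sub>i) \<otimes> 1) t)\<close>\<close>
  have key: "z * (p \<otimes> ?x) = tensor_map (\<lambda>v. slice_second (\<lambda>e. \<omega> (\<sigma> e * v)) z * p) (\<lambda>x. x) t" for z :: "'a tensor2" and p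
  proof -
    have lin: "clinear (\<lambda>v. slice_second (\<lambda>e. \<omega> (\<sigma> e * v)) z)" for z :: "'a tensor2"
    proof (induction z)
      case (tens a e)
      show ?case unfolding slice_second(2)[OF \<omega>\<sigma>] by (intro clinear_intros clinear_compose[OF \<omega>])
    next
      case (add s t)
      then show ?case
        by (simp add: clinear_iff clinearD(1)[OF slice_second(1)[OF \<omega>\<sigma>]] scaleC_add_right)
    qed
    show ?thesis
    proof (induction z)
      case (tens a e)
      have c: "clinear (\<lambda>v. \<omega> (\<sigma> e * v) *\<^sub>C (a * p))" by (intro clinear_intros clinear_compose[OF \<omega>])
      have "(a * p) \<otimes> slice_first \<omega> (mul_l1 (\<sigma> e) u) = tensor_map (\<lambda>v. \<omega> (\<sigma> e * v) *\<^sub>C (a * p)) (\<lambda>x. x) u" for u :: "'a tensor2"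
        by (induction u) (simp_all add: mul_tens mul_add slice_first[OF \<omega>] tensor_map[OF c clinear_ident] tens_bilinear
          clinearD(1)[OF slice_first(1)[OF \<omega>]] clinearD(1)[OF tensor_map(1)[OF c clinear_ident]])
      moreover have "e * ?x = slice_first \<omega> (mul_l1 (\<sigma> e) t)"
        by (simp add: slice_mul[OF \<omega>, symmetric] t_def T4_move)
      ultimately show ?case
        by (simp add: slice_second(2)[OF \<omega>\<sigma>] tens_mult_tens mult_scaleC_left)
    next
      case (add z z')
      have c: "clinear (\<lambda>v. slice_second (\<lambda>e. \<omega> (\<sigma> e * v)) z * p)" for z :: "'a tensor2"
        using lin[of z] by (simp add: clinear_iff distrib_right mult_scaleC_left)
      have "clinear (\<lambda>v. slice_second (\<lambda>e. \<omega> (\<sigma> e * v)) z * p + slice_second (\<lambda>e. \<omega> (\<sigma> e * v)) z' * p)"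
        using c[of z] c[of z'] by (simp add: clinear_iff scaleC_add_right)
      then have "tensor_map (\<lambda>v. slice_second (\<lambda>e. \<omega> (\<sigma> e * v)) z * p + slice_second (\<lambda>e. \<omega> (\<sigma> e * v)) z' * p) (\<lambda>x. x) u
         = tensor_map (\<lambda>v. slice_second (\<lambda>e. \<omega> (\<sigma> e * v)) z * p) (\<lambda>x. x) u
         + tensor_map (\<lambda>v. slice_second (\<lambda>e. \<omega> (\<sigma> e * v)) z' * p) (\<lambda>x. x) u" for u :: "'a tensor2"
        by (induction u) (simp_all add: tensor_map[OF _ clinear_ident] c tens_bilinear clinearD(1)[OF tensor_map(1)[OF _ clinear_ident]])
      then show ?case
        by (simp add: distrib_right add clinearD(1)[OF slice_second(1)[OF \<omega>\<sigma>]])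
    qed
  qed
  define L where "L a = tensor_map (\<nu> a) (\<lambda>x. x) t" for a
  obtain F where F: "finite F" "\<forall>f. clinear f \<longrightarrow> (\<forall>y\<in>F. f y = 0) \<longrightarrow> slice_second f t = 0"
    using finite_second_leg by blast
  have "slice_second f (L a) = 0" if "clinear f" "\<forall>y\<in>F. f y = 0" for f a
    using F(2) that by (simp add: L_def slice_second_map[OF that(1) \<nu> clinear_ident] clinearD(3)[OF \<nu>])
  moreover have "mul_r1 p (L a) = mul_l1 a (lact E (p \<otimes> ?x))" for p a
  proof (rule mul_second_cancel(1)[OF nondegenerate])
    fix e
    have "mul_l2 e (mul_r1 p (L a)) = mul_r1 p (tensor_map (\<nu> a) (\<lambda>x. x) (mul_l2 e t))"
      by (simp only: L_def tensor_map_comp clinear_ident clinear_mult \<nu> clinear_compose[OF clinear_mult(2) \<nu>])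
    also have "\<dots> = mul_r1 p (tensor_map (\<nu> a) (\<lambda>x. x) (mul_l1 (\<sigma> e) t))"
      by (simp only: t_def T4_move)
    also have "\<dots> = tensor_map (\<lambda>v. \<nu> a (\<sigma> e * v) * p) (\<lambda>x. x) t"
      by (simp only: tensor_map_comp clinear_ident clinear_mult \<nu> clinear_compose[OF \<nu> clinear_mult(1)])
    also have "\<dots> = ract (a \<otimes> e) E * (p \<otimes> ?x)"
      by (simp only: \<nu>_mult key)
    also have "\<dots> = mul_l2 e (mul_l1 a (lact E (p \<otimes> ?x)))"
      by (simp only: lact_ract[symmetric] tens_mult_left[symmetric] tensor_map_comp clinear_mult clinear_ident)
    finally show "mul_l2 e (mul_r1 p (L a)) = mul_l2 e (mul_l1 a (lact E (p \<otimes> ?x)))" .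
  qed
  ultimately show ?thesis
    unfolding finite_right_leg_def t_def using F(1) by (intro exI[of _ L] exI[of _ F]) blast
qed

lemma finite_right_leg: "finite_right_leg x"
proof -
  have "complex_vector.subspace {x. finite_right_leg x}"
  proof (rule complex_vector.subspaceI; unfold mem_Collect_eq)
    show "finite_right_leg 0"
      unfolding finite_right_leg_def
    proof (intro exI conjI allI impI)
      show "finite {}" by simp
      show "slice_second f 0 = 0" if "clinear f" for f :: "'a \<Rightarrow> complex"
        by (rule clinearD(3)[OF slice_second(1)[OF that]])
      show "mul_r1 p 0 = mul_l1 a (lact E (p \<otimes> 0))" for a p
        by (simp add: clinear_mul[THEN clinearD(3)] clinearD(3)[OF lact(1)] clinearD(3)[OF clinear_tens(2)[OF clinear_ident]])
    qed
  next
    fix x y assume x: "finite_right_leg x" and y: "finite_right_leg y"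
    obtain L F where "finite F"
      and L: "\<forall>a f. clinear f \<longrightarrow> (\<forall>y\<in>F. f y = 0) \<longrightarrow> slice_second f (L a) = 0"
        "\<forall>a p. mul_r1 p (L a) = mul_l1 a (lact E (p \<otimes> x))"
      using x unfolding finite_right_leg_def by (elim exE conjE)
    obtain K G where "finite G"
      and K: "\<forall>a f. clinear f \<longrightarrow> (\<forall>y\<in>G. f y = 0) \<longrightarrow> slice_second f (K a) = 0"
        "\<forall>a p. mul_r1 p (K a) = mul_l1 a (lact E (p \<otimes> y))"
      using y unfolding finite_right_leg_def by (elim exE conjE)
    show "finite_right_leg (x + y)"
      unfolding finite_right_leg_def
    proof (intro exI conjI allI impI)
      show "finite (F \<union> G)" using \<open>finite F\<close> \<open>finite G\<close> by simp
      show "slice_second f (L a + K a) = 0" if "clinear f" "\<forall>y\<in>F \<union> G. f y = 0" for a f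
        using L(1)[rule_format, OF that(1)] K(1)[rule_format, OF that(1)] that(2) by (simp add: clinearD(1)[OF slice_second(1)[OF that(1)]])
      show "mul_r1 p (L a + K a) = mul_l1 a (lact E (p \<otimes> (x + y)))" for a p
        by (simp add: mul_add L K tens_bilinear clinearD(1)[OF lact(1)])
    qed
  next
    fix k x assume x: "finite_right_leg x"
    obtain L F where "finite F"
      and L: "\<forall>a f. clinear f \<longrightarrow> (\<forall>y\<in>F. f y = 0) \<longrightarrow> slice_second f (L a) = 0"
        "\<forall>a p. mul_r1 p (L a) = mul_l1 a (lact E (p \<otimes> x))"
      using x unfolding finite_right_leg_def by (elim exE conjE)
    show "finite_right_leg (k *\<^sub>C x)"
      unfolding finite_right_leg_def
    proof (intro exI conjI allI impI)
      show "finite F" by fact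
      show "slice_second f (k *\<^sub>C L a) = 0" if "clinear f" "\<forall>y\<in>F. f y = 0" for a f
        using L(1)[rule_format, OF that(1)] that(2) by (simp add: clinearD(2)[OF slice_second(1)[OF that(1)]])
      show "mul_r1 p (k *\<^sub>C L a) = mul_l1 a (lact E (p \<otimes> (k *\<^sub>C x)))" for a p
        by (simp add: clinear_mul[THEN clinearD(2)] L tens_bilinear clinearD(2)[OF lact(1)])
    qed
  qed
  moreover have "{slice_first \<omega> (T4 h c) | \<omega> c. clinear \<omega>} \<subseteq> {x. finite_right_leg x}"
    using finite_right_leg_slice by blast
  ultimately have "complex_vector.span {slice_first \<omega> (T4 h c) | \<omega> c. clinear \<omega>} \<subseteq> {x. finite_right_leg x}"
    by (intro complex_vector.span_minimal)
  then show ?thesis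
    using span_slices[of "T4 h", OF faithful_second_T4] by blast
qed

text \<open>Expand \<open>E (p \<otimes> x) = \<Sum> m\<^sub>b(p) \<otimes> b\<close> and \<open>(a \<otimes> 1) E (1 \<otimes> x) = \<Sum> \<mu>\<^sub>b(a) \<otimes> b\<close> over one finite set of
  elements \<open>b = r\<^sub>b x\<close> of \<open>A x\<close>, with coefficients taken by the same coordinate functionals. Then
  \<open>\<mu>\<^sub>b(a) p = a m\<^sub>b(p)\<close>, so \<open>m\<^sub>b\<close> is a multiplier acting on the left by \<open>m\<^sub>b(p)\<close> and on the right by
  \<open>\<mu>\<^sub>b(a)\<close>. The identity \<open>\<Sum> S(m\<^sub>b(p)) r\<^sub>b x = S(p) x\<close> then says that
  \<open>u = \<Sum> S(m\<^sub>b) r\<^sub>b = \<Sum> S(\<mu>\<^sub>b(S\<inverse>(r\<^sub>b)))\<close> is a left unit for \<open>x\<close>.\<close>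

lemma left_local_unit:
  fixes x :: 'a
  shows "\<exists>u. u * x = x"
proof -
  let ?X = "range (\<lambda>r. r * x)"
  have X: "complex_vector.subspace ?X"
    by (rule complex_vector.subspaceI)
       (auto simp: distrib_right[symmetric] mult_scaleC_left[symmetric] image_iff intro: exI[of _ 0])
  obtain L F where F: "finite F"
    and LF: "\<forall>a f. clinear f \<longrightarrow> (\<forall>y\<in>F. f y = 0) \<longrightarrow> slice_second f (L a) = 0"
    and LE: "\<forall>a p. mul_r1 p (L a) = mul_l1 a (lact E (p \<otimes> x))"
    using finite_right_leg[of x] unfolding finite_right_leg_def by (elim exE conjE)
  have slice: "slice_second f (L a) * p = a * slice_second f (lact E (p \<otimes> x))" if "clinear f" for f a p
    using arg_cong[OF LE[rule_format, of p a], of "slice_second f"] by (simp add: slice_mul[OF that])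
  have EX: "slice_second f (lact E (p \<otimes> x)) = 0" if "clinear f" "\<forall>y\<in>?X. f y = 0" for f p
    using lact_E_in_ideal[OF that(1)] that(2) by blast
  have EF: "slice_second f (lact E (p \<otimes> x)) = 0" if "clinear f" "\<forall>y\<in>F. f y = 0" for f p
    by (rule nondegenerateD(2)[OF nondegenerate]) (simp add: slice[OF that(1), symmetric] LF[rule_format, OF that(1)] that(2))
  obtain B \<beta> where B: "finite B" "B \<subseteq> ?X" and \<beta>: "\<forall>b\<in>B. clinear (\<beta> b)"
    and exp: "\<forall>w. (\<forall>f. clinear f \<longrightarrow> (\<forall>y\<in>F. f y = 0) \<longrightarrow> slice_second f w = 0) \<longrightarrow>
        (\<forall>f. clinear f \<longrightarrow> (\<forall>y\<in>?X. f y = 0) \<longrightarrow> slice_second f w = 0) \<longrightarrow>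
        w = (\<Sum>b\<in>B. slice_second (\<beta> b) (w :: 'a tensor2) \<otimes> b)"
    using finite_expansion_in_subspace[OF F X] by blast
  have "\<forall>b\<in>B. \<exists>r. b = r * x" using B(2) by blast
  then obtain r where r: "\<And>b. b \<in> B \<Longrightarrow> b = r b * x" by metis
  define \<mu> where "\<mu> b = slice_second (\<beta> b) (L (inv \<sigma> (r b)))" for b
  define u where "u = (\<Sum>b\<in>B. \<sigma> (\<mu> b))"
  have "\<sigma> p * (u * x) = \<sigma> p * x" for p
  proof -
    let ?m = "\<lambda>b. slice_second (\<beta> b) (lact E (p \<otimes> x))"
    have summand: "\<sigma> p * (\<sigma> (\<mu> b) * x) = \<sigma> (?m b) * b" if "b \<in> B" for b
    proof -
      have "\<sigma> p * (\<sigma> (\<mu> b) * x) = \<sigma> (\<mu> b * p) * x" by (simp add: \<sigma>(2) mult.assoc)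
      also have "\<mu> b * p = inv \<sigma> (r b) * ?m b" using slice \<beta> that by (simp add: \<mu>_def)
      also have "\<sigma> (inv \<sigma> (r b) * ?m b) * x = \<sigma> (?m b) * (r b * x)"
        by (simp add: \<sigma>(2) inv_\<sigma>(2) mult.assoc)
      finally show ?thesis using r[OF that] by simp
    qed
    have "\<sigma> p * (u * x) = (\<Sum>b\<in>B. \<sigma> p * (\<sigma> (\<mu> b) * x))"
      by (simp add: u_def sum_distrib_left sum_distrib_right)
    also have "\<dots> = (\<Sum>b\<in>B. \<sigma> (?m b) * b)"
      by (rule sum.cong) (simp_all add: summand)
    also have "\<dots> = mult_\<sigma>_first (\<Sum>b\<in>B. ?m b \<otimes> b)"
      by (simp add: clinear_sum[OF mult_\<sigma>_first(1)] mult_\<sigma>_first(2))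
    also have "(\<Sum>b\<in>B. ?m b \<otimes> b) = lact E (p \<otimes> x)"
      by (rule exp[rule_format, symmetric]) (use EX EF in blast)+
    finally show ?thesis by (simp add: mult_\<sigma>_first_E)
  qed
  then have "c * (u * x) = c * x" for c
    using inv_\<sigma>(2)[of c] by metis
  then have "u * x = x" by (rule nondegenerate_cancel(2)[OF nondegenerate])
  then show ?thesis ..
qed

section \<open>The Frobenius isomorphism\<close>

text \<open>The relation \<open>x = (\<theta> S\<inverse> \<otimes> id) \<Delta>(h)\<close>. For general \<open>\<theta>\<close> the slice is only a multiplier, hence the factor
  \<open>b\<close>.\<close>

definition represents :: "('a \<Rightarrow> complex) \<Rightarrow> 'a \<Rightarrow> bool" where
  "represents \<theta> x \<longleftrightarrow> clinear \<theta> \<and> (\<forall>b. b * x = slice_first (\<lambda>v. \<theta> (inv \<sigma> v)) (T3 b h))"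

lemma clinear_inv_\<sigma>_functional: "clinear \<theta> \<Longrightarrow> clinear (\<lambda>v. \<theta> (inv \<sigma> v))"
  by (rule clinear_compose[OF _ clinear_inv_\<sigma>])

lemma represents_add:
  assumes "represents \<theta> x" "represents \<eta> y"
  shows "represents (\<lambda>b. \<theta> b + \<eta> b) (x + y)"
  using assms
  by (auto simp: represents_def distrib_left slice_first_linear(1) clinear_inv_\<sigma>_functional)
     (auto simp: clinear_iff algebra_simps)

lemma represents_scale:
  assumes "represents \<theta> x"
  shows "represents (\<lambda>b. k * \<theta> b) (k *\<^sub>C x)"
  using assms
  by (auto simp: represents_def mult_scaleC_right slice_first_linear(2)[OF clinear_inv_\<sigma>_functional clinear_inv_\<sigma>_functional])
     (auto simp: clinear_iff algebra_simps)

lemma represents_zero: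
  assumes "represents \<theta> 0"
  shows "\<theta> = (\<lambda>_. 0)"
proof -
  have "(\<lambda>v. \<theta> (inv \<sigma> v)) = (\<lambda>_. 0)"
    by (rule faithful_first) (use assms in \<open>simp_all add: represents_def clinear_inv_\<sigma>_functional\<close>)
  then show ?thesis by (metis inv_\<sigma>(1))
qed

lemma represents_unique_functional:
  assumes "represents \<theta> x" "represents \<eta> x"
  shows "\<theta> = \<eta>"
  using represents_zero represents_add[OF assms(1) represents_scale[OF assms(2), of "- 1"]]
  by (auto simp: fun_eq_iff dest!: represents_zero)

lemma represents_unique_element:
  assumes "represents \<theta> x" "represents \<theta> y"
  shows "x = y"
  by (rule nondegenerate_cancel(2)[OF nondegenerate]) (use assms in \<open>simp add: represents_def\<close>)

text \<open>The functional \<open>(a \<theta>) S\<inverse>\<close> is \<open>\<theta> S\<inverse>(S(a) \<cdot>)\<close>, and \<open>S(a) \<otimes> 1\<close> may be moved to the other leg of \<open>\<Delta>(h)\<close>.\<close>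

lemma represents_act:
  assumes "represents \<theta> x"
  shows "represents (dual_act a \<theta>) (a * x)"
proof -
  have \<theta>: "clinear \<theta>" and *: "\<And>b. b * x = slice_first (\<lambda>v. \<theta> (inv \<sigma> v)) (T3 b h)"
    using assms by (auto simp: represents_def)
  have "inv \<sigma> v * a = inv \<sigma> (\<sigma> a * v)" for v
    using \<sigma>(2)[of "inv \<sigma> v" a] inv_\<sigma>(1)[of "inv \<sigma> v * a"] by (simp add: inv_\<sigma>(2))
  then have "b * (a * x) = slice_first (\<lambda>v. dual_act a \<theta> (inv \<sigma> v)) (T3 b h)" for b
    using slice_first_map[OF clinear_inv_\<sigma>_functional[OF \<theta>] clinear_mult(1) clinear_ident, of "\<sigma> a" "T3 b h"]
    by (simp add: dual_act_def T3_move *[symmetric] mult.assoc)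
  moreover have "clinear (dual_act a \<theta>)"
    unfolding dual_act_def by (rule clinear_compose[OF \<theta> clinear_mult(2)])
  ultimately show ?thesis by (simp add: represents_def)
qed

text \<open>Every element of \<open>A A'\<close> represents an element of \<open>A\<close>: the factor \<open>S(a) \<otimes> 1\<close> covers the first leg of
  \<open>\<Delta>(h)\<close>.\<close>

lemma represents_dual_act:
  assumes "clinear \<theta>"
  shows "represents (dual_act a \<theta>) (slice_first (\<lambda>v. \<theta> (inv \<sigma> v)) (T3 a h))"
proof -
  note c = clinear_inv_\<sigma>_functional[OF assms]
  have "inv \<sigma> v * a = inv \<sigma> (\<sigma> a * v)" for v
    using \<sigma>(2)[of "inv \<sigma> v" a] inv_\<sigma>(1)[of "inv \<sigma> v * a"] by (simp add: inv_\<sigma>(2))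
  then have "b * slice_first (\<lambda>v. \<theta> (inv \<sigma> v)) (T3 a h) = slice_first (\<lambda>v. dual_act a \<theta> (inv \<sigma> v)) (T3 b h)" for b
    using slice_first_map[OF c clinear_mult(1) clinear_ident, of "\<sigma> a" "T3 b h"]
    by (simp add: dual_act_def T3_move slice_mul[OF c, symmetric] T3_mult)
  moreover have "clinear (dual_act a \<theta>)"
    unfolding dual_act_def by (rule clinear_compose[OF assms clinear_mult(2)])
  ultimately show ?thesis by (simp add: represents_def)
qed

text \<open>The elements represented by \<open>A A'\<close> are the slices \<open>(\<omega> \<otimes> id) ((c \<otimes> 1) \<Delta>(h))\<close>, which span \<open>A\<close>.\<close>

lemma represents_exists: "\<exists>\<theta>. represents \<theta> x"
proof -
  have "complex_vector.subspace {x. \<exists>\<theta>. represents \<theta> x}"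
  proof (rule complex_vector.subspaceI; clarsimp)
    have "clinear (\<lambda>_ :: 'a. 0 :: complex)" by (simp add: clinear_iff)
    from represents_scale[OF represents_dual_act[OF this], of 0 undefined] show "\<exists>\<theta>. represents \<theta> 0"
      by auto
  qed (blast intro: represents_add represents_scale)+
  moreover have "{slice_first \<omega> (T2 \<Delta> (c \<otimes> h)) | \<omega> c. clinear \<omega>} \<subseteq> {x. \<exists>\<theta>. represents \<theta> x}"
  proof clarsimp
    fix \<omega> :: "'a \<Rightarrow> complex" and c assume "clinear \<omega>"
    from represents_dual_act[OF clinear_compose[OF this \<sigma>(1)], of "inv \<sigma> c"]
    show "\<exists>\<theta>. represents \<theta> (slice_first \<omega> (T2 \<Delta> (c \<otimes> h)))"
      by (auto simp: T3_eq_T2 inv_\<sigma>(2))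
  qed
  ultimately have "complex_vector.span {slice_first \<omega> (T2 \<Delta> (c \<otimes> h)) | \<omega> c. clinear \<omega>} \<subseteq> {x. \<exists>\<theta>. represents \<theta> x}"
    by (intro complex_vector.span_minimal)
  then show ?thesis
    using span_slices[of "\<lambda>c. T2 \<Delta> (c \<otimes> h)", OF faithful_second] by blast
qed

lemma frobenius_of_cointegral: "frobenius TYPE('a)"
proof -
  obtain \<phi> where \<phi>: "\<And>x. represents (\<phi> x) x" using represents_exists by metis
  have eq: "\<phi> x = \<theta>" if "represents \<theta> x" for x \<theta>
    by (rule represents_unique_functional[OF \<phi> that])
  have "clinear (\<lambda>a. \<phi> a b)" for b
    by (simp add: clinear_iff eq[OF represents_add[OF \<phi> \<phi>]] eq[OF represents_scale[OF \<phi>]])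
  moreover have act: "\<phi> (a * x) = dual_act a (\<phi> x)" for a x
    by (rule eq[OF represents_act[OF \<phi>]])
  moreover have "bij_betw \<phi> UNIV reduced_dual"
    unfolding bij_betw_def
  proof (intro conjI)
    show "inj \<phi>" by (rule injI) (metis represents_unique_element \<phi>)
    have "\<phi> x \<in> reduced_dual" for x
    proof -
      \<comment> \<open>a local unit places \<open>\<phi> x\<close> in \<open>A A'\<close> itself, not merely in its span\<close>
      obtain u where "u * x = x" using left_local_unit by blast
      then have "\<phi> x = dual_act u (\<phi> x)" using act[of u x] by simp
      then show ?thesis using \<phi>[of x] unfolding reduced_dual_def represents_def by blast
    qed
    moreover have "dual_act a \<theta> \<in> range \<phi>" if "clinear \<theta>" for a \<theta>
      by (rule range_eqI[where x="slice_first (\<lambda>v. \<theta> (inv \<sigma> v)) (T3 a h)"]) (rule eq[OF represents_dual_act[OF that], symmetric])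
    ultimately show "range \<phi> = reduced_dual" unfolding reduced_dual_def by blast
  qed
  ultimately show ?thesis unfolding frobenius_def by blast
qed

end

theorem proposition4p15:
  fixes \<Delta> :: "'a::complex_algebra \<Rightarrow> 'a tensor2 multiplier"
    and \<epsilon> :: "'a \<Rightarrow> complex"
    and E :: "'a tensor2 multiplier"
    and G\<^sub>1 G\<^sub>2 :: "'a tensor2 \<Rightarrow> 'a tensor2"
    and S :: "'a \<Rightarrow> 'a multiplier"
    and h :: 'a
  assumes "regular_weak_multiplier_Hopf_algebra \<Delta> \<epsilon> E G\<^sub>1 G\<^sub>2 S"
    and "left_cointegral \<Delta> S (to_mult h)"
    and "faithful_cointegral \<Delta> h"
  shows "frobenius TYPE('a)"
proof -
  interpret regular_weak_multiplier_Hopf_algebra \<Delta> \<epsilon> E G\<^sub>1 G\<^sub>2 S by (rule assms(1))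
  obtain R\<^sub>1 R\<^sub>2 where "antipode_maps \<Delta> \<epsilon> E G\<^sub>1 G\<^sub>2 S R\<^sub>1 R\<^sub>2" by (rule obtain_antipode_maps)
  then interpret faithful_left_cointegral \<Delta> \<epsilon> E G\<^sub>1 G\<^sub>2 S R\<^sub>1 R\<^sub>2 h
    by (intro faithful_left_cointegral.intro faithful_left_cointegral_axioms.intro assms)
  show ?thesis by (rule frobenius_of_cointegral)
qed

end
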